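(* Let $(N,g)$ be a compact smooth Riemannian manifold with smooth boundary $\partial N$. There exists a constant $C>0$ depending only on $N$ such that for every $\lambda\geq 1$ and every eigenfunction $e_\lambda$ of the positive Dirichlet Laplacian $\Delta_N$ with eigenvalue $\lambda^2$, i.e. $\Delta_N e_\lambda=\lambda^2e_\lambda$ in the interior of $N$ and $e_\lambda=0$ on $\partial N$, $$\|\nabla e_\lambda\|_\infty\leq C\,\lambda\,\|e_\lambda\|_\infty.$$
   Context: $(N,g)$ is an $n$-dimensional compact smooth Riemannian manifold with smooth boundary $\partial N$, and $\Delta_N$ is the positive Dirichlet Laplacian on $N$; in local coordinates $\Delta_N u=-\frac{1}{\sqrt{\det(g_{ij})}}\sum_{i,j}\partial_{x_i}\left(g^{ij}\sqrt{\det(g_{ij})}\,\partial_{x_j}u\right)$, with Dirichlet boundary condition $u=0$ on $\partial N$. The Dirichlet eigenvalues, counted with multiplicity, are $0<\lambda_1^2<\lambda_2^2\leq\lambda_3^2\leq\cdots$. Eigenfunctions are real-valued, smooth on $N$ and not identically zero. $\nabla u$ is the gradient vector field of $u$, with squared pointwise length $\sum_{i,j}g^{ij}\frac{\partial u}{\partial x_i}\frac{\partial u}{\partial x_j}$. $\|\cdot\|_\infty$ is the $L^\infty$ norm on $N$; for a vector field it is the $L^\infty$ norm of its pointwise length. *)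

theory Defs
  imports "HOL-Analysis.Analysis"
begin

text \<open>At a point of an open set, or of a relatively open subset \<open>D\<close> of a closed half space, the
  derivative within \<open>D\<close> is unique. At a boundary point of the half space it is the derivative of
  any differentiable extension.\<close>

definition pderiv_within ::
    "(real^'n) set \<Rightarrow> 'n::finite \<Rightarrow> (real^'n \<Rightarrow> real) \<Rightarrow> real^'n \<Rightarrow> real" where
  "pderiv_within D i f x = frechet_derivative f (at x within D) (axis i 1)"

primrec Ck_on_open :: "nat \<Rightarrow> (real^'n::finite) set \<Rightarrow> (real^'n \<Rightarrow> real) \<Rightarrow> bool" where
  "Ck_on_open 0 W f \<longleftrightarrow> continuous_on W f"
| "Ck_on_open (Suc k) W f \<longleftrightarrow>
     f differentiable_on W \<and> (\<forall>i. Ck_on_open k W (pderiv_within W i f))"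

text \<open>Smoothness on an arbitrary set means local extendability to smooth functions on open sets.\<close>

definition smooth_on :: "(real^'n::finite) set \<Rightarrow> (real^'n \<Rightarrow> real) \<Rightarrow> bool" where
  "smooth_on S f \<longleftrightarrow>
     (\<forall>x\<in>S. \<exists>W F. open W \<and> x \<in> W \<and> (\<forall>k. Ck_on_open k W F) \<and> (\<forall>y\<in>S \<inter> W. F y = f y))"

definition half_space :: "'n \<Rightarrow> (real^'n::finite) set" where
  "half_space k = {x. 0 \<le> x $ k}"

text \<open>A chart is a coordinate domain together with its coordinate map. The values of the map
  outside the domain are irrelevant.\<close>

type_synonym ('a, 'n) chart = "'a set \<times> ('a \<Rightarrow> real^'n)"

abbreviation chart_dom :: "('a, 'n::finite) chart \<Rightarrow> 'a set" where
  "chart_dom c \<equiv> fst c"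

abbreviation chart_map :: "('a, 'n::finite) chart \<Rightarrow> 'a \<Rightarrow> real^'n" where
  "chart_map c \<equiv> snd c"

definition chart_image :: "('a, 'n::finite) chart \<Rightarrow> (real^'n) set" where
  "chart_image c = chart_map c ` chart_dom c"

definition chart_inv :: "('a, 'n::finite) chart \<Rightarrow> real^'n \<Rightarrow> 'a" where
  "chart_inv c = inv_into (chart_dom c) (chart_map c)"

definition transition :: "('a, 'n::finite) chart \<Rightarrow> ('a, 'n) chart \<Rightarrow> real^'n \<Rightarrow> real^'n" where
  "transition c d = (\<lambda>x. chart_map d (chart_inv c x))"

text \<open>The atlas need not be maximal. The parameter \<open>k\<close> is the coordinate that cuts out the model
  half space, and the boundary may be empty.\<close>

locale smooth_manifold_with_boundary =
  fixes X :: "'a topology"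
    and A :: "('a, 'n::finite) chart set"
    and k :: 'n
  assumes Hausdorff: "Hausdorff_space X"
    and second_countable: "second_countable X"
    and charts_cover: "topspace X = (\<Union>c\<in>A. chart_dom c)"
    and chart_dom_open: "c \<in> A \<Longrightarrow> openin X (chart_dom c)"
    and chart_image_open: "c \<in> A \<Longrightarrow> openin (top_of_set (half_space k)) (chart_image c)"
    and chart_homeomorphism:
      "c \<in> A \<Longrightarrow>
        homeomorphic_map (subtopology X (chart_dom c)) (top_of_set (chart_image c)) (chart_map c)"
    and transition_smooth:
      "c \<in> A \<Longrightarrow> d \<in> A \<Longrightarrow>
        smooth_on (chart_map c ` (chart_dom c \<inter> chart_dom d)) (\<lambda>x. transition c d x $ i)"

definition manifold_boundary :: "('a, 'n::finite) chart set \<Rightarrow> 'n \<Rightarrow> 'a set" where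
  "manifold_boundary A k = {p. \<exists>c\<in>A. p \<in> chart_dom c \<and> chart_map c p $ k = 0}"

definition smooth_function :: "('a, 'n::finite) chart set \<Rightarrow> ('a \<Rightarrow> real) \<Rightarrow> bool" where
  "smooth_function A u \<longleftrightarrow> (\<forall>c\<in>A. smooth_on (chart_image c) (\<lambda>x. u (chart_inv c x)))"

text \<open>A metric assigns to a chart \<open>c\<close> and a point \<open>p\<close> of its domain the matrix \<open>g c p\<close> of the
  components \<open>g\<^sub>i\<^sub>j\<close> at \<open>p\<close> in the coordinates \<open>c\<close>. Compatibility is the transformation law of a
  covariant 2-tensor.\<close>

type_synonym ('a, 'n) metric = "('a, 'n) chart \<Rightarrow> 'a \<Rightarrow> real^'n^'n"

locale compact_riemannian_manifold_with_boundary = smooth_manifold_with_boundary X A k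
  for X :: "'a topology" and A :: "('a, 'n::finite) chart set" and k :: 'n +
  fixes g :: "('a, 'n) metric"
  assumes compact: "compact_space X"
    and metric_symmetric: "c \<in> A \<Longrightarrow> p \<in> chart_dom c \<Longrightarrow> transpose (g c p) = g c p"
    and metric_positive:
      "c \<in> A \<Longrightarrow> p \<in> chart_dom c \<Longrightarrow> v \<noteq> 0 \<Longrightarrow> v \<bullet> (g c p *v v) > 0"
    and metric_smooth:
      "c \<in> A \<Longrightarrow> smooth_on (chart_image c) (\<lambda>x. g c (chart_inv c x) $ i $ j)"
    and metric_compatible:
      "c \<in> A \<Longrightarrow> d \<in> A \<Longrightarrow> p \<in> chart_dom c \<inter> chart_dom d \<Longrightarrow>
        J = jacobian (transition c d)
              (at (chart_map c p) within chart_map c ` (chart_dom c \<inter> chart_dom d)) \<Longrightarrow>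
        g c p = transpose J ** g d p ** J"

definition partial_in_chart ::
    "('a, 'n::finite) chart \<Rightarrow> 'n \<Rightarrow> ('a \<Rightarrow> real) \<Rightarrow> 'a \<Rightarrow> real" where
  "partial_in_chart c i u p =
     pderiv_within (chart_image c) i (\<lambda>x. u (chart_inv c x)) (chart_map c p)"

definition gradient_in_chart ::
    "('a, 'n::finite) metric \<Rightarrow> ('a, 'n) chart \<Rightarrow> ('a \<Rightarrow> real) \<Rightarrow> 'a \<Rightarrow> real^'n" where
  "gradient_in_chart g c u p =
     (\<chi> i. \<Sum>j\<in>UNIV. matrix_inv (g c p) $ i $ j * partial_in_chart c j u p)"

definition length_in_chart ::
    "('a, 'n::finite) metric \<Rightarrow> ('a, 'n) chart \<Rightarrow> 'a \<Rightarrow> real^'n \<Rightarrow> real" where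
  "length_in_chart g c p v = sqrt (\<Sum>i\<in>UNIV. \<Sum>j\<in>UNIV. g c p $ i $ j * v $ i * v $ j)"

text \<open>The length of the gradient does not depend on the chart in which it is computed, so one chart
  around each point is chosen.\<close>

definition gradient_length ::
    "('a, 'n::finite) chart set \<Rightarrow> ('a, 'n) metric \<Rightarrow> ('a \<Rightarrow> real) \<Rightarrow> 'a \<Rightarrow> real" where
  "gradient_length A g u p =
     (let c = (SOME c. c \<in> A \<and> p \<in> chart_dom c)
      in length_in_chart g c p (gradient_in_chart g c u p))"

lemma (in compact_riemannian_manifold_with_boundary) length_gradient_squared:
  assumes c: "c \<in> A" and p: "p \<in> chart_dom c"
  shows "(length_in_chart g c p (gradient_in_chart g c u p))\<^sup>2 =
    (\<Sum>i\<in>UNIV. \<Sum>j\<in>UNIV.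
       matrix_inv (g c p) $ i $ j * partial_in_chart c i u p * partial_in_chart c j u p)"
proof -
  let ?G = "g c p" and ?d = "(\<chi> i. partial_in_chart c i u p) :: real^'n"
  let ?v = "matrix_inv ?G *v ?d"
  have pos: "w \<bullet> (?G *v w) > 0" if "w \<noteq> 0" for w
    using metric_positive[OF c p that] .
  have "\<exists>B. B ** ?G = mat 1"
    unfolding matrix_left_invertible_ker using pos by (metis inner_zero_right less_irrefl)
  then have "invertible ?G"
    by (simp add: invertible_left_inverse)
  then have inv: "?G ** matrix_inv ?G = mat 1"
    unfolding invertible_def matrix_inv_def by (rule someI2_ex) simp
  have grad: "gradient_in_chart g c u p = ?v"
    by (simp add: gradient_in_chart_def vec_eq_iff matrix_vector_mult_def)
  have quad: "(\<Sum>i\<in>UNIV. \<Sum>j\<in>UNIV. M $ i $ j * w $ i * w $ j) = w \<bullet> (M *v w)"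
    for M :: "real^'n^'n" and w
    by (simp add: inner_vec_def matrix_vector_mult_def sum_distrib_left mult_ac)
  have nonneg: "0 \<le> ?v \<bullet> (?G *v ?v)"
    using pos[of ?v] by (cases "?v = 0") auto
  have Gv: "?G *v ?v = ?d"
    by (simp add: matrix_vector_mul_assoc inv)
  have "(length_in_chart g c p (gradient_in_chart g c u p))\<^sup>2 = ?v \<bullet> (?G *v ?v)"
    using nonneg by (simp add: length_in_chart_def grad quad)
  also have "\<dots> = ?d \<bullet> (matrix_inv ?G *v ?d)"
    by (simp only: Gv inner_commute)
  finally show ?thesis
    by (simp add: quad[symmetric])
qed

definition laplacian_in_chart ::
    "('a, 'n::finite) metric \<Rightarrow> ('a, 'n) chart \<Rightarrow> ('a \<Rightarrow> real) \<Rightarrow> 'a \<Rightarrow> real" where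
  "laplacian_in_chart g c u p =
     - (1 / sqrt (det (g c p))) *
       (\<Sum>i\<in>UNIV. \<Sum>j\<in>UNIV.
          pderiv_within (chart_image c) i
            (\<lambda>x. matrix_inv (g c (chart_inv c x)) $ i $ j * sqrt (det (g c (chart_inv c x))) *
                  partial_in_chart c j u (chart_inv c x))
            (chart_map c p))"

text \<open>The coordinate expression of the Laplacian does not depend on the chart, so the eigenvalue
  equation is required in every chart around every interior point.\<close>

definition dirichlet_eigenfunction ::
    "'a topology \<Rightarrow> ('a, 'n::finite) chart set \<Rightarrow> 'n \<Rightarrow> ('a, 'n) metric \<Rightarrow> real \<Rightarrow>
      ('a \<Rightarrow> real) \<Rightarrow> bool" where
  "dirichlet_eigenfunction X A k g \<mu> u \<longleftrightarrow>
     smooth_function A u \<and>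
     (\<exists>p\<in>topspace X. u p \<noteq> 0) \<and>
     (\<forall>p\<in>topspace X - manifold_boundary A k. \<forall>c\<in>A.
        p \<in> chart_dom c \<longrightarrow> laplacian_in_chart g c u p = \<mu> * u p) \<and>
     (\<forall>p\<in>manifold_boundary A k. u p = 0)"

text \<open>The null sets of the Riemannian volume are the sets that are Lebesgue null in all charts.\<close>

definition manifold_null :: "('a, 'n::finite) chart set \<Rightarrow> 'a set \<Rightarrow> bool" where
  "manifold_null A Z \<longleftrightarrow> (\<forall>c\<in>A. negligible (chart_map c ` (Z \<inter> chart_dom c)))"

text \<open>This is the essential supremum of \<open>\<bar>f\<bar>\<close>. It is meaningful for essentially bounded \<open>f\<close> only,
  in particular for continuous functions on a compact manifold.\<close>

definition Linf_norm ::
    "'a topology \<Rightarrow> ('a, 'n::finite) chart set \<Rightarrow> ('a \<Rightarrow> real) \<Rightarrow> real" where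
  "Linf_norm X A f = Inf {M. 0 \<le> M \<and> manifold_null A {p \<in> topspace X. M < \<bar>f p\<bar>}}"

end

theory Submission
  imports Defs
begin

text \<open>
  The proof uses the maximum principle only; nothing is integrated. In a chart the eigenvalue equation
  for \<open>v = e \<circ> chart_inv c\<close> reads \<open>\<Sum>\<^sub>i\<^sub>j \<partial>\<^sub>i (a\<^sub>i\<^sub>j \<partial>\<^sub>j v) = - lam\<^sup>2 r v\<close> with \<open>r = sqrt (det g)\<close> and
  \<open>a = r g\<^sup>-\<^sup>1\<close>, and \<open>v\<close> vanishes on the flat part \<open>x\<^sub>k = 0\<close> of the boundary. Let \<open>M\<close> be a bound of \<open>|v|\<close>.

  \<^item> Bernstein's method (\<open>interior_gradient_bound\<close>). On a ball of radius \<open>s \<le> 1\<close> inside the domain,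
    with a cutoff \<open>\<eta>\<close> and \<open>\<Lambda> = lam\<^sup>2 + 1 / s\<^sup>2\<close>, the elliptic operator is applied to
    \<open>\<eta>\<^sup>2 |\<nabla>v|\<^sup>2 + A \<Lambda> v\<^sup>2\<close> at a maximum. The squares of the second derivatives of \<open>v\<close> absorb all terms
    that are linear in them, and for large \<open>A\<close> the inequality at the maximum gives
    \<open>|\<nabla>v|\<^sup>2 \<le> C \<Lambda> sup v\<^sup>2\<close> at the centre.

  \<^item> A barrier (\<open>boundary_barrier\<close>). Comparison with a concave quadratic function of \<open>lam x\<^sub>k\<close>, localised by a
    quadratic term, gives
    \<open>|v(x)| \<le> \<alpha> lam M x\<^sub>k\<close> for \<open>x\<^sub>k \<le> \<delta> / lam\<close>.

  \<^item> Combination (\<open>half_ball_gradient_bound\<close>). At points whose distance to the boundary is small compared to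
    \<open>1 / lam\<close>, Bernstein's estimate is used on a ball whose radius is comparable to that distance,
    where the barrier gives the missing smallness of \<open>v\<close>; at all other points it is used with a radius
    comparable to \<open>1 / lam\<close>. In both cases \<open>|\<nabla>v|\<^sup>2 \<le> C (lam M)\<^sup>2\<close>.

  The coefficients extend smoothly across the boundary (\<open>metric_extension\<close>), so that the constant is
  uniform near each point of the manifold, and compactness makes it global. The length of the gradient
  does not depend on the chart (\<open>gradient_length_chart_independent\<close>). It is enough to bound it at
  interior points, because the boundary is a null set; that boundary points are boundary points in
  every chart follows from invariance of domain (\<open>interior_coordinate_invariant\<close>).
\<close>

section \<open>Gradients and partial derivatives\<close>

text \<open>\<open>has_grad f D x\<close>: the function \<open>f\<close> is differentiable at \<open>x\<close> with partial derivatives \<open>D i\<close>.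
  Keeping the gradient as a function of the index makes the product rule a pointwise identity.\<close>

definition has_grad :: "(real^'n::finite \<Rightarrow> real) \<Rightarrow> ('n \<Rightarrow> real) \<Rightarrow> real^'n \<Rightarrow> bool" where
  "has_grad f D x \<longleftrightarrow> (f has_derivative (\<lambda>h. \<Sum>i\<in>UNIV. D i * h $ i)) (at x)"

text \<open>The \<open>i\<close>-th partial derivative, without reference to a set. On open sets it agrees with
  \<open>pderiv_within\<close>.\<close>

definition pd :: "'n \<Rightarrow> (real^'n::finite \<Rightarrow> real) \<Rightarrow> real^'n \<Rightarrow> real" where
  "pd i f x = frechet_derivative f (at x) (axis i 1)"

lemma has_grad_const: "has_grad (\<lambda>x. c) (\<lambda>i. 0) x"
  by (simp add: has_grad_def)

lemma has_grad_coord: "has_grad (\<lambda>x. x $ k) (\<lambda>i. if i = k then 1 else 0) x"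
proof -
  have "(\<lambda>h::real^'a. \<Sum>i\<in>UNIV. (if i = k then 1 else 0) * h $ i) = (\<lambda>h. h $ k)"
    by (simp add: if_distrib[of "\<lambda>z. z * _"] cong: if_cong)
  then show ?thesis
    unfolding has_grad_def
    by (simp only: bounded_linear_imp_has_derivative[OF bounded_linear_vec_nth])
qed

lemma has_grad_add:
  "has_grad f D x \<Longrightarrow> has_grad g E x \<Longrightarrow> has_grad (\<lambda>x. f x + g x) (\<lambda>i. D i + E i) x"
  unfolding has_grad_def
  by (drule (1) has_derivative_add) (simp add: sum.distrib distrib_right)

lemma has_grad_diff:
  "has_grad f D x \<Longrightarrow> has_grad g E x \<Longrightarrow> has_grad (\<lambda>x. f x - g x) (\<lambda>i. D i - E i) x"
  unfolding has_grad_def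
  by (drule (1) has_derivative_diff) (simp add: sum_subtractf left_diff_distrib)

lemma has_grad_mult:
  "has_grad f D x \<Longrightarrow> has_grad g E x \<Longrightarrow> has_grad (\<lambda>x. f x * g x) (\<lambda>i. f x * E i + D i * g x) x"
  unfolding has_grad_def
  by (drule (1) has_derivative_mult)
    (simp add: sum.distrib sum_distrib_left sum_distrib_right algebra_simps)

lemma has_grad_cmult: "has_grad f D x \<Longrightarrow> has_grad (\<lambda>x. c * f x) (\<lambda>i. c * D i) x"
  using has_grad_mult[OF has_grad_const, of f D x c] by simp

lemma has_grad_power2: "has_grad f D x \<Longrightarrow> has_grad (\<lambda>x. (f x)\<^sup>2) (\<lambda>i. 2 * f x * D i) x"
  using has_grad_mult[of f D x f D] by (simp add: power2_eq_square algebra_simps)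

lemma has_grad_sum:
  assumes "\<And>a. a \<in> S \<Longrightarrow> has_grad (f a) (D a) x"
  shows "has_grad (\<lambda>x. \<Sum>a\<in>S. f a x) (\<lambda>i. \<Sum>a\<in>S. D a i) x"
proof (cases "finite S")
  case True
  then show ?thesis using assms
  proof (induction S)
    case empty
    then show ?case by (simp add: has_grad_const)
  next
    case (insert a S)
    then show ?case using has_grad_add[of "f a" "D a" x] by simp
  qed
qed (simp add: has_grad_const)

lemma has_grad_DERIV_compose:
  assumes "has_grad f D x" and "(\<phi> has_real_derivative \<phi>') (at (f x))"
  shows "has_grad (\<lambda>x. \<phi> (f x)) (\<lambda>i. \<phi>' * D i) x"
proof -
  have "(\<phi> has_derivative (\<lambda>h. \<phi>' * h)) (at (f x))"
    using assms(2) by (simp add: has_field_derivative_def)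
  from has_derivative_compose[OF assms(1)[unfolded has_grad_def] this]
  show ?thesis unfolding has_grad_def by (simp add: sum_distrib_left mult_ac)
qed

lemma has_grad_cong_open:
  assumes "has_grad f D x" "open W" "x \<in> W" "\<And>y. y \<in> W \<Longrightarrow> g y = f y"
  shows "has_grad g D x"
  unfolding has_grad_def
  by (rule has_derivative_transform_within_open[OF assms(1)[unfolded has_grad_def] assms(2,3)])
    (simp add: assms(4))

lemma has_grad_eq: "has_grad f D x \<Longrightarrow> (\<And>i. D i = E i) \<Longrightarrow> has_grad f E x"
  by (simp add: has_grad_def)

lemma has_grad_imp_pd:
  assumes "has_grad f D x"
  shows "pd i f x = D i"
proof -
  have "pd i f x = (\<Sum>j\<in>UNIV. D j * axis i 1 $ j)"
    using frechet_derivative_at[OF assms[unfolded has_grad_def]] by (simp add: pd_def fun_eq_iff)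
  also have "\<dots> = D i"
    by (simp add: axis_def if_distrib[of "\<lambda>z. _ * z"] cong: if_cong)
  finally show ?thesis .
qed

lemma differentiable_imp_has_grad:
  assumes "f differentiable (at x)"
  shows "has_grad f (\<lambda>i. pd i f x) x"
proof -
  let ?F = "frechet_derivative f (at x)"
  have d: "(f has_derivative ?F) (at x)"
    using assms by (simp add: frechet_derivative_works)
  then have lin: "linear ?F" by (rule has_derivative_linear)
  have "?F h = (\<Sum>i\<in>UNIV. pd i f x * h $ i)" for h
  proof -
    have "?F h = ?F (\<Sum>i\<in>UNIV. h $ i *\<^sub>R axis i 1)"
      by (simp add: basis_expansion flip: scalar_mult_eq_scaleR)
    also have "\<dots> = (\<Sum>i\<in>UNIV. h $ i * ?F (axis i 1))"
      by (simp add: linear_sum[OF lin] linear_scale[OF lin])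
    finally show ?thesis by (simp add: pd_def mult.commute)
  qed
  then have "?F = (\<lambda>h. \<Sum>i\<in>UNIV. pd i f x * h $ i)" by (simp add: fun_eq_iff)
  then show ?thesis using d by (simp only: has_grad_def)
qed

lemma has_grad_differentiable: "has_grad f D x \<Longrightarrow> f differentiable (at x)"
  unfolding has_grad_def differentiable_def by blast

lemma has_grad_isCont: "has_grad f D x \<Longrightarrow> isCont f x"
  unfolding has_grad_def by (rule has_derivative_continuous)

lemma has_grad_line:
  assumes "has_grad f D (x + t *\<^sub>R w)"
  shows "((\<lambda>t. f (x + t *\<^sub>R w)) has_real_derivative (\<Sum>i\<in>UNIV. D i * w $ i)) (at t)"
proof -
  have "((\<lambda>t. x + t *\<^sub>R w) has_derivative (\<lambda>h. h *\<^sub>R w)) (at t)"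
    by (auto intro!: derivative_eq_intros)
  from has_derivative_compose[OF this assms[unfolded has_grad_def]]
  show ?thesis
    unfolding has_field_derivative_def
    by (rule has_derivative_eq_rhs) (simp add: fun_eq_iff sum_distrib_left mult_ac)
qed

section \<open>Functions with continuous derivatives on open sets\<close>

lemma pderiv_within_open: "open W \<Longrightarrow> x \<in> W \<Longrightarrow> pderiv_within W i f x = pd i f x"
  unfolding pderiv_within_def pd_def by (simp only: at_within_open)

lemma pd_cong_open:
  assumes "open W" "x \<in> W" "\<And>y. y \<in> W \<Longrightarrow> f y = g y"
  shows "pd i f x = pd i g x"
proof -
  have "(f has_derivative F) (at x) \<longleftrightarrow> (g has_derivative F) (at x)" for F
    using has_derivative_transform_within_open[of f F x UNIV W g]
      has_derivative_transform_within_open[of g F x UNIV W f] assms by auto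
  then show ?thesis by (simp add: pd_def frechet_derivative_def)
qed

lemma Ck_cong:
  assumes "open W" "\<And>x. x \<in> W \<Longrightarrow> f x = g x"
  shows "Ck_on_open k W f \<longleftrightarrow> Ck_on_open k W g"
  using assms
proof (induction k arbitrary: f g)
  case 0
  then show ?case by (simp cong: continuous_on_cong)
next
  case (Suc k)
  have "f differentiable_on W \<longleftrightarrow> g differentiable_on W"
    using Suc.prems(2) by (auto simp: differentiable_on_def intro: differentiable_transform_within[where d=1])
  moreover have "Ck_on_open k W (pderiv_within W i f) \<longleftrightarrow> Ck_on_open k W (pderiv_within W i g)" for i
    by (rule Suc.IH[OF Suc.prems(1)])
      (metis Suc.prems pd_cong_open pderiv_within_open)
  ultimately show ?case by simp
qed

lemma Ck_Suc_iff:
  assumes "open W"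
  shows "Ck_on_open (Suc k) W f \<longleftrightarrow> f differentiable_on W \<and> (\<forall>i. Ck_on_open k W (pd i f))"
  using Ck_cong[OF assms, of "pderiv_within W _ f" "pd _ f"] pderiv_within_open[OF assms]
  by simp

lemma Ck_SucI:
  assumes "open W" "\<And>x. x \<in> W \<Longrightarrow> has_grad f (\<lambda>i. D i x) x" "\<And>i. Ck_on_open k W (D i)"
  shows "Ck_on_open (Suc k) W f"
proof -
  have "f differentiable_on W"
    using assms(1,2) has_grad_differentiable
    by (auto simp: differentiable_on_eq_differentiable_at)
  moreover have "Ck_on_open k W (pd i f)" for i
    using Ck_cong[OF assms(1), of "pd i f" "D i"] has_grad_imp_pd[OF assms(2)] assms(3) by simp
  ultimately show ?thesis unfolding Ck_Suc_iff[OF assms(1)] by blast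
qed

lemma Ck_has_grad:
  assumes "Ck_on_open (Suc k) W f" "open W" "x \<in> W"
  shows "has_grad f (\<lambda>i. pd i f x) x"
  using assms by (auto simp: differentiable_on_eq_differentiable_at intro!: differentiable_imp_has_grad)

lemma Ck_pd: "Ck_on_open (Suc k) W f \<Longrightarrow> open W \<Longrightarrow> Ck_on_open k W (pd i f)"
  by (simp add: Ck_Suc_iff del: Ck_on_open.simps)

lemma Ck_Suc_imp: "Ck_on_open (Suc k) W f \<Longrightarrow> Ck_on_open k W f"
proof (induction k arbitrary: f)
  case 0
  then show ?case by (simp add: differentiable_imp_continuous_on)
next
  case (Suc k)
  then show ?case by simp
qed

lemma Ck_mono: "Ck_on_open m W f \<Longrightarrow> k \<le> m \<Longrightarrow> Ck_on_open k W f"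
  by (induction m) (auto simp: le_Suc_eq simp del: Ck_on_open.simps dest: Ck_Suc_imp)

lemma Ck_continuous: "Ck_on_open k W f \<Longrightarrow> continuous_on W f"
  using Ck_mono[of k W f 0] by simp

text \<open>Being \<open>C\<^sup>k\<close> on an open set is a local property. This turns the local extensions in the definition of
  \<open>smooth_on\<close> into \<open>C\<^sup>k\<close> functions on open subsets.\<close>

lemma Ck_local:
  assumes "open W" "\<And>x. x \<in> W \<Longrightarrow> \<exists>V F. open V \<and> x \<in> V \<and> Ck_on_open k V F \<and> (\<forall>y\<in>W \<inter> V. F y = f y)"
  shows "Ck_on_open k W f"
  using assms(2)
proof (induction k arbitrary: f)
  case 0
  have "isCont f x" if x: "x \<in> W" for x
  proof -
    obtain V F where V: "open V" "x \<in> V" "continuous_on V F" "\<forall>y\<in>W \<inter> V. F y = f y"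
      using 0[OF x] by auto
    then have "continuous_on (W \<inter> V) F"
      by (meson continuous_on_subset inf_le2)
    then have "continuous_on (W \<inter> V) f"
      using continuous_on_cong[of "W \<inter> V" "W \<inter> V" F f] V(4) by simp
    then show ?thesis using V x assms(1)
      by (simp add: continuous_on_eq_continuous_at open_Int)
  qed
  then show ?case by (simp add: continuous_at_imp_continuous_on)
next
  case (Suc k)
  have "has_grad f (\<lambda>i. pd i f x) x" if x: "x \<in> W" for x
  proof -
    obtain V F where V: "open V" "x \<in> V" "Ck_on_open (Suc k) V F" "\<forall>y\<in>W \<inter> V. F y = f y"
      using Suc.prems[OF x] by blast
    have "has_grad f (\<lambda>i. pd i F x) x"
      by (rule has_grad_cong_open[OF Ck_has_grad[OF V(3,1,2)], of "W \<inter> V"])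
        (use V x assms(1) in auto)
    then show ?thesis by (rule has_grad_eq) (metis has_grad_imp_pd[OF \<open>has_grad f _ x\<close>])
  qed
  moreover have "Ck_on_open k W (pd i f)" for i
  proof (rule Suc.IH)
    fix x assume x: "x \<in> W"
    obtain V F where V: "open V" "x \<in> V" "Ck_on_open (Suc k) V F" "\<forall>y\<in>W \<inter> V. F y = f y"
      using Suc.prems[OF x] by blast
    have "pd i F y = pd i f y" if "y \<in> W \<inter> V" for y
      by (rule pd_cong_open[of "W \<inter> V"]) (use V assms(1) that in auto)
    then show "\<exists>V F. open V \<and> x \<in> V \<and> Ck_on_open k V F \<and> (\<forall>y\<in>W \<inter> V. F y = pd i f y)"
      using V(1,2) Ck_pd[OF V(3,1), of i] by auto
  qed
  ultimately show ?case
    by (rule Ck_SucI[OF assms(1)])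
qed

lemma Ck_subset:
  assumes "Ck_on_open k W f" "open W" "open V" "V \<subseteq> W"
  shows "Ck_on_open k V f"
proof (rule Ck_local[OF assms(3)])
  fix x assume "x \<in> V"
  then show "\<exists>U F. open U \<and> x \<in> U \<and> Ck_on_open k U F \<and> (\<forall>y\<in>V \<inter> U. F y = f y)"
    using assms by (intro exI[of _ W] exI[of _ f]) auto
qed

lemma Ck_const: "open W \<Longrightarrow> Ck_on_open k W (\<lambda>x. c)"
  by (induction k arbitrary: c) (auto simp del: Ck_on_open.simps(2) intro!: Ck_SucI has_grad_const)

lemma Ck_add:
  assumes W: "open W"
  shows "Ck_on_open k W f \<Longrightarrow> Ck_on_open k W g \<Longrightarrow> Ck_on_open k W (\<lambda>x. f x + g x)"
proof (induction k arbitrary: f g)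
  case 0
  then show ?case by (auto intro!: continuous_intros)
next
  case (Suc k)
  show ?case
    by (rule Ck_SucI[OF W, where D="\<lambda>i x. pd i f x + pd i g x"])
      (use Suc W in \<open>auto intro!: has_grad_add Ck_has_grad Ck_pd simp del: Ck_on_open.simps\<close>)
qed

lemma Ck_mult:
  assumes W: "open W"
  shows "Ck_on_open k W f \<Longrightarrow> Ck_on_open k W g \<Longrightarrow> Ck_on_open k W (\<lambda>x. f x * g x)"
proof (induction k arbitrary: f g)
  case 0
  then show ?case by (auto intro!: continuous_intros)
next
  case (Suc k)
  show ?case
    by (rule Ck_SucI[OF W, where D="\<lambda>i x. f x * pd i g x + pd i f x * g x"])
      (use Suc W in \<open>auto intro!: has_grad_mult Ck_has_grad Ck_add Ck_pd dest: Ck_Suc_imp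
         simp del: Ck_on_open.simps\<close>)
qed

lemma Ck_sum:
  assumes W: "open W" and "\<And>a. a \<in> S \<Longrightarrow> Ck_on_open k W (f a)"
  shows "Ck_on_open k W (\<lambda>x. \<Sum>a\<in>S. f a x)"
  using assms(2) by (induction S rule: infinite_finite_induct) (auto intro!: Ck_add[OF W] Ck_const[OF W])

lemma Ck_prod:
  assumes W: "open W" and "\<And>a. a \<in> S \<Longrightarrow> Ck_on_open k W (f a)"
  shows "Ck_on_open k W (\<lambda>x. \<Prod>a\<in>S. f a x)"
  using assms(2) by (induction S rule: infinite_finite_induct) (auto intro!: Ck_mult[OF W] Ck_const[OF W])

lemma Ck_inverse:
  assumes W: "open W"
  shows "Ck_on_open k W f \<Longrightarrow> (\<And>x. x \<in> W \<Longrightarrow> f x \<noteq> 0) \<Longrightarrow> Ck_on_open k W (\<lambda>x. inverse (f x))"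
proof (induction k)
  case 0
  then show ?case by (auto intro!: continuous_intros)
next
  case (Suc k)
  have 1: "Ck_on_open k W (\<lambda>x. inverse (f x))" using Suc Ck_Suc_imp by blast
  show ?case
  proof (rule Ck_SucI[OF W, where D="\<lambda>i x. (- 1) * (inverse (f x) * inverse (f x)) * pd i f x"])
    fix x assume x: "x \<in> W"
    show "has_grad (\<lambda>x. inverse (f x)) (\<lambda>i. (- 1) * (inverse (f x) * inverse (f x)) * pd i f x) x"
      by (rule has_grad_DERIV_compose[OF Ck_has_grad[OF Suc.prems(1) W x]])
        (use Suc.prems(2)[OF x] in \<open>auto intro!: derivative_eq_intros\<close>)
  qed (intro Ck_mult[OF W] Ck_const[OF W] 1 Ck_pd[OF Suc.prems(1) W])
qed

lemma Ck_sqrt: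
  assumes W: "open W"
  shows "Ck_on_open k W f \<Longrightarrow> (\<And>x. x \<in> W \<Longrightarrow> f x > 0) \<Longrightarrow> Ck_on_open k W (\<lambda>x. sqrt (f x))"
proof (induction k)
  case 0
  then show ?case by (auto intro!: continuous_intros)
next
  case (Suc k)
  have 1: "Ck_on_open k W (\<lambda>x. inverse (sqrt (f x)))"
    by (rule Ck_inverse[OF W]) (use Suc Ck_Suc_imp in \<open>force simp del: Ck_on_open.simps\<close>)+
  show ?case
  proof (rule Ck_SucI[OF W, where D="\<lambda>i x. (inverse (sqrt (f x)) * (1/2)) * pd i f x"])
    fix x assume x: "x \<in> W"
    show "has_grad (\<lambda>x. sqrt (f x)) (\<lambda>i. (inverse (sqrt (f x)) * (1/2)) * pd i f x) x"
      by (rule has_grad_DERIV_compose[OF Ck_has_grad[OF Suc.prems(1) W x]])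
        (use Suc.prems(2)[OF x] in \<open>auto intro!: derivative_eq_intros\<close>)
  qed (intro Ck_mult[OF W] Ck_const[OF W] 1 Ck_pd[OF Suc.prems(1) W])
qed

lemma Ck_det:
  fixes M :: "real^'n::finite \<Rightarrow> real^'m^'m::finite"
  assumes W: "open W" and "\<And>i j. Ck_on_open k W (\<lambda>x. M x $ i $ j)"
  shows "Ck_on_open k W (\<lambda>x. det (M x))"
  unfolding det_def by (intro Ck_sum[OF W] Ck_mult[OF W] Ck_const[OF W] Ck_prod[OF W] assms(2))

section \<open>Symmetry of second derivatives\<close>

text \<open>The second difference of \<open>f\<close> over a small square is symmetric in the two directions; the mean value
  theorem, applied in one direction and then in the other, identifies it with a mixed second derivative.\<close>

lemma mixed_difference_mean_value:
  fixes f :: "real^'n::finite \<Rightarrow> real"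
  assumes f: "\<And>y. y \<in> ball x \<delta> \<Longrightarrow> has_grad f (\<lambda>i. f1 i y) y"
    and f1: "\<And>y. y \<in> ball x \<delta> \<Longrightarrow> has_grad (f1 i) (\<lambda>j. f2 i j y) y"
    and t: "0 < t" "2 * t < \<delta>"
  shows "\<exists>z\<in>ball x \<delta>. f (x + t *\<^sub>R axis i 1 + t *\<^sub>R axis j 1) - f (x + t *\<^sub>R axis i 1)
           - f (x + t *\<^sub>R axis j 1) + f x = t * (t * f2 i j z)"
proof -
  let ?p = "\<lambda>s r. x + s *\<^sub>R axis i 1 + r *\<^sub>R axis j 1"
  have axsum: "(\<Sum>l\<in>UNIV. D l * axis m 1 $ l) = D m" for D :: "'n \<Rightarrow> real" and m
    by (simp add: axis_def if_distrib[of "\<lambda>z. _ * z"] cong: if_cong)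
  have inb: "?p s r \<in> ball x \<delta>" if "0 \<le> s" "s \<le> t" "0 \<le> r" "r \<le> t" for s r
  proof -
    have "dist x (?p s r) = norm (s *\<^sub>R axis i 1 + r *\<^sub>R axis j (1::real))"
      by (metis add.assoc add_diff_cancel_left' dist_commute dist_norm)
    also have "\<dots> \<le> s + r"
      using that by (intro norm_triangle_le) simp
    finally show ?thesis using that t by simp
  qed
  let ?\<phi> = "\<lambda>s. f (?p s t) - f (?p s 0)"
  have "\<exists>z>0. z < t \<and> ?\<phi> t - ?\<phi> 0 = (t - 0) * (f1 i (?p z t) - f1 i (?p z 0))"
  proof (rule MVT2)
    fix s assume s: "0 \<le> s" "s \<le> t"
    have "((\<lambda>s. f (?p s r)) has_real_derivative f1 i (?p s r)) (at s)" if "0 \<le> r" "r \<le> t" for r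
    proof -
      have e: "?p s r = (x + r *\<^sub>R axis j 1) + s *\<^sub>R axis i 1" for s by simp
      have "has_grad f (\<lambda>l. f1 l (?p s r)) (?p s r)" using f inb s that by blast
      then show ?thesis
        unfolding e using has_grad_line by (fastforce simp: axsum)
    qed
    from DERIV_diff[OF this[of t] this[of 0]]
    show "(?\<phi> has_real_derivative f1 i (?p s t) - f1 i (?p s 0)) (at s)"
      using t by simp
  qed (use t in auto)
  then obtain z where z: "0 < z" "z < t" "?\<phi> t - ?\<phi> 0 = t * (f1 i (?p z t) - f1 i (?p z 0))"
    by auto
  have "\<exists>y>0. y < t \<and> f1 i (?p z t) - f1 i (?p z 0) = (t - 0) * f2 i j (?p z y)"
  proof (rule MVT2)
    fix r assume r: "0 \<le> r" "r \<le> t"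
    have "has_grad (f1 i) (\<lambda>l. f2 i l (?p z r)) (?p z r)" using f1 inb r z by auto
    then show "((\<lambda>r. f1 i (?p z r)) has_real_derivative f2 i j (?p z r)) (at r)"
      using has_grad_line by (fastforce simp: axsum)
  qed (use t in auto)
  then obtain y where y: "0 < y" "y < t" "f1 i (?p z t) - f1 i (?p z 0) = t * f2 i j (?p z y)"
    by auto
  have "?\<phi> t - ?\<phi> 0 = t * (t * f2 i j (?p z y))"
    using y(3) z(3) by simp
  then show ?thesis
    by (intro bexI[of _ "?p z y"]) (use inb y z in auto)
qed

lemma Ck_pd_commute:
  fixes f :: "real^'n::finite \<Rightarrow> real"
  assumes f: "Ck_on_open (Suc (Suc k)) W f" and W: "open W" and x: "x \<in> W"
  shows "pd j (pd i f) x = pd i (pd j f) x"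
proof (rule ccontr)
  let ?g = "\<lambda>i j. pd j (pd i f)"
  assume ne: "?g i j x \<noteq> ?g j i x"
  define e where "e = \<bar>?g i j x - ?g j i x\<bar> / 2"
  have e: "e > 0" using ne by (simp add: e_def)
  have f1: "Ck_on_open (Suc k) W (pd i f)" for i using Ck_pd[OF f W] .
  have cont: "isCont (?g i j) x" for i j
    using Ck_continuous[OF Ck_pd[OF f1 W]] W x by (simp add: continuous_on_eq_continuous_at)
  obtain d1 where d1: "d1 > 0" "\<And>y. dist y x < d1 \<Longrightarrow> dist (?g i j y) (?g i j x) < e"
    using cont[of j i] e unfolding continuous_at_eps_delta by blast
  obtain d2 where d2: "d2 > 0" "\<And>y. dist y x < d2 \<Longrightarrow> dist (?g j i y) (?g j i x) < e"
    using cont[of i j] e unfolding continuous_at_eps_delta by blast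
  obtain d3 where d3: "d3 > 0" "ball x d3 \<subseteq> W" using W x open_contains_ball by metis
  define d where "d = min d1 (min d2 d3)"
  have d: "d > 0" "d \<le> d1" "d \<le> d2" "ball x d \<subseteq> W"
    using d1(1) d2(1) d3 by (auto simp: d_def)
  have h0: "has_grad f (\<lambda>i. pd i f y) y" if "y \<in> ball x d" for y
    using Ck_has_grad[OF f W] that d by blast
  have h1: "has_grad (pd i f) (\<lambda>j. pd j (pd i f) y) y" if "y \<in> ball x d" for y i
    using Ck_has_grad[OF f1 W] that d by blast
  have t: "0 < d/3" "2 * (d/3) < d" using d by auto
  obtain z where z: "z \<in> ball x d"
    "f (x + (d/3) *\<^sub>R axis i 1 + (d/3) *\<^sub>R axis j 1) - f (x + (d/3) *\<^sub>R axis i 1)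
           - f (x + (d/3) *\<^sub>R axis j 1) + f x = (d/3) * ((d/3) * ?g i j z)"
    using mixed_difference_mean_value[of x d f "\<lambda>i. pd i f" i ?g "d/3" j, OF h0 h1 t] by blast
  obtain y where y: "y \<in> ball x d"
    "f (x + (d/3) *\<^sub>R axis j 1 + (d/3) *\<^sub>R axis i 1) - f (x + (d/3) *\<^sub>R axis j 1)
           - f (x + (d/3) *\<^sub>R axis i 1) + f x = (d/3) * ((d/3) * ?g j i y)"
    using mixed_difference_mean_value[of x d f "\<lambda>i. pd i f" j ?g "d/3" i, OF h0 h1 t] by blast
  have "x + (d/3) *\<^sub>R axis j 1 + (d/3) *\<^sub>R axis i 1 = x + (d/3) *\<^sub>R axis i 1 + (d/3) *\<^sub>R axis j 1"
    by simp
  then have "(d/3) * ((d/3) * ?g i j z) = (d/3) * ((d/3) * ?g j i y)"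
    unfolding z(2)[symmetric] y(2)[symmetric] by (simp add: add_ac)
  then have "?g i j z = ?g j i y" using d(1) by simp
  moreover have "dist (?g i j z) (?g i j x) < e" "dist (?g j i y) (?g j i x) < e"
    using d1(2)[of z] d2(2)[of y] y(1) z(1) d by (auto simp: dist_commute)
  ultimately show False unfolding e_def dist_real_def by (smt (verit) field_sum_of_halves)
qed

section \<open>The maximum principle\<close>

lemma quadratic_form_shift:
  fixes a :: "'n::finite \<Rightarrow> 'n \<Rightarrow> real"
  assumes sym: "\<And>i j. a i j = a j i"
  shows "(\<Sum>i\<in>UNIV. \<Sum>j\<in>UNIV. a i j * (\<xi> i + (if i = p then s else 0)) * (\<xi> j + (if j = p then s else 0)))
    = (\<Sum>i\<in>UNIV. \<Sum>j\<in>UNIV. a i j * \<xi> i * \<xi> j) + 2 * s * (\<Sum>j\<in>UNIV. a p j * \<xi> j) + s\<^sup>2 * a p p"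
proof -
  let ?d = "\<lambda>i. if i = p then s else 0"
  have 1: "(\<Sum>i\<in>UNIV. \<Sum>j\<in>UNIV. a i j * \<xi> i * ?d j) = s * (\<Sum>j\<in>UNIV. a p j * \<xi> j)"
    using sym by (simp add: if_distrib[of "\<lambda>z. _ * z"] sum_distrib_left mult_ac cong: if_cong)
  have 2: "(\<Sum>i\<in>UNIV. \<Sum>j\<in>UNIV. a i j * ?d i * \<xi> j) = s * (\<Sum>j\<in>UNIV. a p j * \<xi> j)"
    by (subst sum.swap)
      (simp add: if_distrib[of "\<lambda>z. _ * z"] if_distrib[of "\<lambda>z. z * _"] sum_distrib_left mult_ac cong: if_cong)
  have 3: "(\<Sum>i\<in>UNIV. \<Sum>j\<in>UNIV. a i j * ?d i * ?d j) = s\<^sup>2 * a p p"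
    by (simp add: if_distrib[of "\<lambda>z. _ * z"] if_distrib[of "\<lambda>z. z * _"] power2_eq_square cong: if_cong)
  have "(\<Sum>i\<in>UNIV. \<Sum>j\<in>UNIV. a i j * (\<xi> i + ?d i) * (\<xi> j + ?d j)) =
     (\<Sum>i\<in>UNIV. \<Sum>j\<in>UNIV. a i j * \<xi> i * \<xi> j) + (\<Sum>i\<in>UNIV. \<Sum>j\<in>UNIV. a i j * \<xi> i * ?d j)
     + (\<Sum>i\<in>UNIV. \<Sum>j\<in>UNIV. a i j * ?d i * \<xi> j) + (\<Sum>i\<in>UNIV. \<Sum>j\<in>UNIV. a i j * ?d i * ?d j)"
    unfolding sum.distrib[symmetric] by (intro sum.cong refl) (simp only: algebra_simps)
  then show ?thesis unfolding 1 2 3 by simp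
qed

text \<open>The Cholesky decomposition of a positive semidefinite matrix, by eliminating one index of the
  support at a time.\<close>

lemma psd_sum_of_rank_ones:
  fixes a :: "'n::finite \<Rightarrow> 'n \<Rightarrow> real"
  assumes "finite I" "\<And>i j. a i j = a j i"
    and "\<And>\<xi>. 0 \<le> (\<Sum>i\<in>UNIV. \<Sum>j\<in>UNIV. a i j * \<xi> i * \<xi> j)"
    and "\<And>i j. a i j \<noteq> 0 \<Longrightarrow> i \<in> I"
  shows "\<exists>ws. \<forall>i j. a i j = (\<Sum>w\<leftarrow>ws. w i * w j)"
  using assms
proof (induction I arbitrary: a)
  case empty
  then show ?case by (intro exI[of _ "[]"]) force
next
  case (insert p I)
  note sym = insert.prems(1) and psd = insert.prems(2)
  have app: "a p p \<ge> 0"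
    using psd[of "\<lambda>i. 0 + (if i = p then 1 else 0)"]
    unfolding quadratic_form_shift[of a, OF sym] by simp
  show ?case
  proof (cases "a p p = 0")
    case True
    have zero: "a p j = 0" for j
    proof -
      have q: "0 \<le> a j j + 2 * t * a p j" for t
      proof -
        have "(\<Sum>i\<in>UNIV. \<Sum>l\<in>UNIV. a i l * (0 + (if i = j then 1 else 0)) * (0 + (if l = j then 1 else 0))) = a j j"
          by (simp add: if_distrib[of "\<lambda>z. _ * z"] if_distrib[of "\<lambda>z. z * _"] cong: if_cong)
        moreover have "(\<Sum>l\<in>UNIV. a p l * (if l = j then 1 else 0)) = a p j"
          by (simp add: if_distrib[of "\<lambda>z. _ * z"] cong: if_cong)
        ultimately show ?thesis
          using psd[of "\<lambda>i. (0 + (if i = j then 1 else 0)) + (if i = p then t else 0)"] True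
          unfolding quadratic_form_shift[of a "\<lambda>i. 0 + (if i = j then 1 else 0)", OF sym] by simp
      qed
      show ?thesis
      proof (rule ccontr)
        assume "a p j \<noteq> 0"
        then show False using q[of "- (a j j + 1) / (2 * a p j)"] by (simp add: field_simps)
      qed
    qed
    show ?thesis
    proof (rule insert.IH[OF sym psd])
      fix i j assume "a i j \<noteq> 0"
      then show "i \<in> I" using insert.prems(3)[of i j] zero by auto
    qed
  next
    case False
    define a' where "a' i j = a i j - a p i * a p j / a p p" for i j
    have "\<exists>ws. \<forall>i j. a' i j = (\<Sum>w\<leftarrow>ws. w i * w j)"
    proof (rule insert.IH)
      show "a' i j = a' j i" for i j using sym by (simp add: a'_def mult.commute)
      show "0 \<le> (\<Sum>i\<in>UNIV. \<Sum>j\<in>UNIV. a' i j * \<xi> i * \<xi> j)" for \<xi>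
      proof -
        define L where "L = (\<Sum>j\<in>UNIV. a p j * \<xi> j)"
        have "(\<Sum>i\<in>UNIV. \<Sum>j\<in>UNIV. a' i j * \<xi> i * \<xi> j) =
          (\<Sum>i\<in>UNIV. \<Sum>j\<in>UNIV. a i j * \<xi> i * \<xi> j) - (\<Sum>i\<in>UNIV. \<Sum>j\<in>UNIV. (a p i * \<xi> i) * (a p j * \<xi> j) / a p p)"
          unfolding a'_def sum_subtractf[symmetric]
          by (intro sum.cong refl) (simp add: field_simps False)
        also have "(\<Sum>i\<in>UNIV. \<Sum>j\<in>UNIV. (a p i * \<xi> i) * (a p j * \<xi> j) / a p p) = L * L / a p p"
          by (simp add: L_def sum_product sum_divide_distrib)
        \<comment> \<open>the form of \<open>a\<close> at \<open>\<xi>\<close>, minimised over the \<open>p\<close>-th coordinate\<close>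
        also have "(\<Sum>i\<in>UNIV. \<Sum>j\<in>UNIV. a i j * \<xi> i * \<xi> j) - L * L / a p p
           = (\<Sum>i\<in>UNIV. \<Sum>j\<in>UNIV. a i j * \<xi> i * \<xi> j) + 2 * (- L / a p p) * L + (- L / a p p)\<^sup>2 * a p p"
          using False by (simp add: field_simps power2_eq_square)
        also have "\<dots> \<ge> 0"
          unfolding L_def quadratic_form_shift[of a, OF sym, symmetric] by (rule psd)
        finally show ?thesis .
      qed
      show "i \<in> I" if "a' i j \<noteq> 0" for i j
        using that insert.prems(3)[of i j] insert.prems(3)[of p i] sym[of p i] insert.prems(3)[of i p] False
        by (cases "i = p"; cases "a i j = 0"; cases "a i p = 0") (auto simp: a'_def)
    qed
    then obtain ws where ws: "\<forall>i j. a' i j = (\<Sum>w\<leftarrow>ws. w i * w j)" by blast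
    show ?thesis
    proof (intro exI allI)
      fix i j
      show "a i j = (\<Sum>w\<leftarrow>(\<lambda>i. a p i / sqrt (a p p)) # ws. w i * w j)"
        using ws[rule_format, of i j] app False by (simp add: a'_def)
    qed
  qed
qed

lemma second_derivative_at_max:
  fixes \<phi> :: "real \<Rightarrow> real"
  assumes \<delta>: "\<delta> > 0"
    and d1: "\<And>t. \<bar>t\<bar> < \<delta> \<Longrightarrow> (\<phi> has_real_derivative \<phi>' t) (at t)"
    and d2: "(\<phi>' has_real_derivative c) (at 0)"
    and max: "\<And>t. \<bar>t\<bar> < \<delta> \<Longrightarrow> \<phi> t \<le> \<phi> 0"
  shows "\<phi>' 0 = 0" "c \<le> 0"
proof -
  show z: "\<phi>' 0 = 0"
    by (rule DERIV_local_max[OF d1[of 0] \<delta>]) (use \<delta> max in auto)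
  show "c \<le> 0"
  proof (rule ccontr)
    assume "\<not> c \<le> 0"
    then obtain d where d: "d > 0" "\<And>h. 0 < h \<Longrightarrow> h < d \<Longrightarrow> \<phi>' 0 < \<phi>' (0 + h)"
      using DERIV_pos_inc_right[OF d2] by auto
    define t where "t = min d \<delta> / 2"
    have t: "0 < t" "t < d" "t < \<delta>" using d(1) \<delta> by (auto simp: t_def)
    obtain s where s: "0 < s" "s < t" "\<phi> t - \<phi> 0 = (t - 0) * \<phi>' s"
      using MVT2[of 0 t \<phi> \<phi>'] t d1 by auto
    have "\<phi> t - \<phi> 0 > 0"
      using s(3) d(2)[of s] s(1,2) t z by simp
    then show False using max[of t] t by simp
  qed
qed

text \<open>At an interior maximum the Hessian is negative semidefinite. The coefficient matrix is a sum of
  matrices \<open>w w\<^sup>T\<close>, so its pairing with the Hessian is a sum of second derivatives in the directions \<open>w\<close>.\<close>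

lemma interior_max_elliptic:
  fixes Z :: "real^'n::finite \<Rightarrow> real" and a :: "'n \<Rightarrow> 'n \<Rightarrow> real"
  assumes W: "open W" "x \<in> W"
    and d1: "\<And>y. y \<in> W \<Longrightarrow> has_grad Z (\<lambda>i. Z1 i y) y"
    and d2: "\<And>i. has_grad (Z1 i) (\<lambda>j. Z2 i j) x"
    and max: "\<And>y. y \<in> W \<Longrightarrow> Z y \<le> Z x"
    and sym: "\<And>i j. a i j = a j i"
    and psd: "\<And>\<xi>. 0 \<le> (\<Sum>i\<in>UNIV. \<Sum>j\<in>UNIV. a i j * \<xi> i * \<xi> j)"
  shows "Z1 i x = 0" "(\<Sum>i\<in>UNIV. \<Sum>j\<in>UNIV. a i j * Z2 i j) \<le> 0"
proof -
  obtain d where d: "d > 0" "ball x d \<subseteq> W" using W open_contains_ball by metis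
  have dir: "(\<Sum>i\<in>UNIV. Z1 i x * w $ i) = 0 \<and> (\<Sum>i\<in>UNIV. \<Sum>j\<in>UNIV. Z2 i j * w $ j * w $ i) \<le> 0"
    for w :: "real^'n"
  proof -
    define \<delta> where "\<delta> = d / (norm w + 1)"
    have nw: "norm w + 1 > 0" by (smt (verit) norm_ge_zero)
    have \<delta>: "\<delta> > 0" using d nw by (simp add: \<delta>_def)
    have inW: "x + t *\<^sub>R w \<in> W" if "\<bar>t\<bar> < \<delta>" for t
    proof -
      have "norm (t *\<^sub>R w) \<le> \<bar>t\<bar> * (norm w + 1)" by (simp add: mult_left_mono)
      also have "\<dots> < d" using that nw by (simp add: \<delta>_def pos_less_divide_eq)
      finally show ?thesis using d by (intro subsetD[OF d(2)]) (simp add: dist_norm)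
    qed
    let ?\<phi> = "\<lambda>t. Z (x + t *\<^sub>R w)" and ?\<phi>' = "\<lambda>t. \<Sum>i\<in>UNIV. Z1 i (x + t *\<^sub>R w) * w $ i"
    have 1: "(?\<phi> has_real_derivative ?\<phi>' t) (at t)" if "\<bar>t\<bar> < \<delta>" for t
      by (rule has_grad_line[OF d1[OF inW[OF that]]])
    have 2: "(?\<phi>' has_real_derivative (\<Sum>i\<in>UNIV. (\<Sum>j\<in>UNIV. Z2 i j * w $ j) * w $ i)) (at 0)"
    proof (rule DERIV_sum)
      fix i
      have "((\<lambda>t. Z1 i (x + t *\<^sub>R w)) has_real_derivative (\<Sum>j\<in>UNIV. Z2 i j * w $ j)) (at 0)"
        by (rule has_grad_line) (simp add: d2)
      then show "((\<lambda>t. Z1 i (x + t *\<^sub>R w) * w $ i) has_real_derivative (\<Sum>j\<in>UNIV. Z2 i j * w $ j) * w $ i) (at 0)"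
        by (rule DERIV_cmult_right)
    qed
    have 3: "?\<phi> t \<le> ?\<phi> 0" if "\<bar>t\<bar> < \<delta>" for t
      using max[OF inW[OF that]] by simp
    from second_derivative_at_max[OF \<delta> 1 2 3] show ?thesis
      by (simp add: sum_distrib_right)
  qed
  show "Z1 i x = 0"
    using dir[of "axis i 1"]
    by (simp add: axis_def if_distrib[of "\<lambda>z. _ * z"] cong: if_cong)
  obtain ws where ws: "\<forall>i j. a i j = (\<Sum>w\<leftarrow>ws. w i * w j)"
    using psd_sum_of_rank_ones[of UNIV a] sym psd by auto
  have "(\<Sum>i\<in>UNIV. \<Sum>j\<in>UNIV. (\<Sum>w\<leftarrow>ws. w i * w j) * Z2 i j) \<le> 0"
  proof (induction ws)
    case (Cons w ws)
    have "(\<Sum>i\<in>UNIV. \<Sum>j\<in>UNIV. w i * w j * Z2 i j) \<le> 0"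
      using conjunct2[OF dir[of "\<chi> i. w i"]] by (simp add: mult_ac)
    with Cons show ?case by (simp add: distrib_right sum.distrib)
  qed simp
  then show "(\<Sum>i\<in>UNIV. \<Sum>j\<in>UNIV. a i j * Z2 i j) \<le> 0" by (simp add: ws)
qed

section \<open>Elliptic operators\<close>

text \<open>The operator \<open>v \<mapsto> \<Sum>\<^sub>i\<^sub>j a\<^sub>i\<^sub>j \<partial>\<^sub>j\<partial>\<^sub>i v + \<Sum>\<^sub>j b\<^sub>j \<partial>\<^sub>j v\<close> on an open set \<open>\<Omega>\<close>, with ellipticity constant \<open>\<theta>\<close>, together
  with the density \<open>r\<close> on the right hand side of the eigenvalue equation. One constant \<open>K\<close> bounds
  all coefficients and their first derivatives.\<close>

locale elliptic_operator =
  fixes \<Omega> :: "(real^'n::finite) set"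
    and a :: "'n \<Rightarrow> 'n \<Rightarrow> real^'n \<Rightarrow> real" and b :: "'n \<Rightarrow> real^'n \<Rightarrow> real"
    and r :: "real^'n \<Rightarrow> real" and \<theta> K :: real
  assumes a_C1: "\<And>i j. Ck_on_open (Suc 0) \<Omega> (a i j)"
    and b_C1: "\<And>i. Ck_on_open (Suc 0) \<Omega> (b i)"
    and r_C1: "Ck_on_open (Suc 0) \<Omega> r"
    and open_dom: "open \<Omega>"
    and sym: "\<And>x i j. x \<in> \<Omega> \<Longrightarrow> a i j x = a j i x"
    and elliptic: "\<And>x \<xi>. x \<in> \<Omega> \<Longrightarrow>
      \<theta> * (\<Sum>i\<in>UNIV. (\<xi> i)\<^sup>2) \<le> (\<Sum>i\<in>UNIV. \<Sum>j\<in>UNIV. a i j x * \<xi> i * \<xi> j)"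
    and theta_pos: "\<theta> > 0"
    and a_bound: "\<And>x i j. x \<in> \<Omega> \<Longrightarrow> \<bar>a i j x\<bar> \<le> K"
    and da_bound: "\<And>x i j k. x \<in> \<Omega> \<Longrightarrow> \<bar>pd k (a i j) x\<bar> \<le> K"
    and b_bound: "\<And>x i. x \<in> \<Omega> \<Longrightarrow> \<bar>b i x\<bar> \<le> K"
    and db_bound: "\<And>x i k. x \<in> \<Omega> \<Longrightarrow> \<bar>pd k (b i) x\<bar> \<le> K"
    and r_bound: "\<And>x. x \<in> \<Omega> \<Longrightarrow> \<bar>r x\<bar> \<le> K"
    and dr_bound: "\<And>x k. x \<in> \<Omega> \<Longrightarrow> \<bar>pd k r x\<bar> \<le> K"
    and K_nonneg: "0 \<le> K"
begin

lemma psd: "x \<in> \<Omega> \<Longrightarrow> 0 \<le> (\<Sum>i\<in>UNIV. \<Sum>j\<in>UNIV. a i j x * \<xi> i * \<xi> j)"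
  by (rule order_trans[OF _ elliptic]) (use theta_pos in \<open>auto intro!: mult_nonneg_nonneg sum_nonneg\<close>)

text \<open>\<open>v\<close> is \<open>C\<^sup>3\<close> on the open set \<open>U\<close> and solves \<open>\<Sum>\<^sub>i\<^sub>j a\<^sub>i\<^sub>j \<partial>\<^sub>j\<partial>\<^sub>i v + \<Sum>\<^sub>j b\<^sub>j \<partial>\<^sub>j v = - lam\<^sup>2 r v\<close> there.\<close>

definition eigen_eq :: "real \<Rightarrow> (real^'n) set \<Rightarrow> (real^'n \<Rightarrow> real) \<Rightarrow> bool" where
  "eigen_eq lam U v \<longleftrightarrow> open U \<and> U \<subseteq> \<Omega> \<and> Ck_on_open (Suc (Suc (Suc 0))) U v \<and>
     (\<forall>x\<in>U. (\<Sum>i\<in>UNIV. \<Sum>j\<in>UNIV. a i j x * pd j (pd i v) x) + (\<Sum>j\<in>UNIV. b j x * pd j v x)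
        = - (lam\<^sup>2) * (r x * v x))"

text \<open>The equation satisfied by \<open>\<partial>\<^sub>k v\<close>, from differentiating the equation of \<open>v\<close> and commuting derivatives.\<close>

lemma eigen_eq_differentiated:
  assumes eq: "eigen_eq lam U v" and x: "x \<in> U"
  shows "(\<Sum>i\<in>UNIV. \<Sum>j\<in>UNIV. a i j x * pd j (pd i (pd k v)) x) + (\<Sum>j\<in>UNIV. b j x * pd j (pd k v) x)
    = - (lam\<^sup>2) * (r x * pd k v x + pd k r x * v x)
      - (\<Sum>i\<in>UNIV. \<Sum>j\<in>UNIV. pd k (a i j) x * pd j (pd i v) x) - (\<Sum>j\<in>UNIV. pd k (b j) x * pd j v x)"
proof -
  have U: "open U" "U \<subseteq> \<Omega>" and v: "Ck_on_open (Suc (Suc (Suc 0))) U v"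
    using eq by (auto simp: eigen_eq_def)
  note v1 = Ck_pd[OF v U(1)] note v2 = Ck_pd[OF v1 U(1)]
  have xO: "x \<in> \<Omega>" using x U by blast
  let ?L = "\<lambda>x. (\<Sum>i\<in>UNIV. \<Sum>j\<in>UNIV. a i j x * pd j (pd i v) x) + (\<Sum>j\<in>UNIV. b j x * pd j v x)"
  have L: "has_grad ?L (\<lambda>k. (\<Sum>i\<in>UNIV. \<Sum>j\<in>UNIV. a i j x * pd k (pd j (pd i v)) x + pd k (a i j) x * pd j (pd i v) x)
     + (\<Sum>j\<in>UNIV. b j x * pd k (pd j v) x + pd k (b j) x * pd j v x)) x"
    by (intro has_grad_add has_grad_sum has_grad_mult Ck_has_grad[OF a_C1 open_dom xO]
        Ck_has_grad[OF b_C1 open_dom xO] Ck_has_grad[OF v2 U(1) x] Ck_has_grad[OF v1 U(1) x])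
  have R: "has_grad (\<lambda>x. - (lam\<^sup>2) * (r x * v x)) (\<lambda>k. - (lam\<^sup>2) * (r x * pd k v x + pd k r x * v x)) x"
    by (intro has_grad_cmult has_grad_mult Ck_has_grad[OF r_C1 open_dom xO] Ck_has_grad[OF v U(1) x])
  have "pd k ?L x = pd k (\<lambda>x. - (lam\<^sup>2) * (r x * v x)) x"
    by (rule pd_cong_open[OF U(1) x]) (use eq in \<open>simp add: eigen_eq_def\<close>)
  then have eq2: "(\<Sum>i\<in>UNIV. \<Sum>j\<in>UNIV. a i j x * pd k (pd j (pd i v)) x + pd k (a i j) x * pd j (pd i v) x)
     + (\<Sum>j\<in>UNIV. b j x * pd k (pd j v) x + pd k (b j) x * pd j v x)
     = - (lam\<^sup>2) * (r x * pd k v x + pd k r x * v x)"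
    unfolding has_grad_imp_pd[OF L] has_grad_imp_pd[OF R] .
  have c2: "pd k (pd j v) y = pd j (pd k v) y" if "y \<in> U" for y j
    by (rule Ck_pd_commute[OF v U(1) that])
  have c3: "pd k (pd j (pd i v)) x = pd j (pd i (pd k v)) x" for i j
    using Ck_pd_commute[OF v1 U(1) x, where i=j and j=k]
      pd_cong_open[OF U(1) x, of "pd k (pd i v)" "pd i (pd k v)" j] c2 by simp
  show ?thesis
    using eq2 unfolding c3 c2[OF x] by (simp add: sum.distrib)
qed

end

section \<open>The interior gradient estimate\<close>

text \<open>\<open>bernstein_c\<close> collects the coefficients of the terms bounded by \<open>\<Lambda> |\<nabla>v|\<^sup>2\<close> in dimension \<open>n\<close>, and \<open>bernstein_A\<close>
  is the weight of \<open>\<Lambda> v\<^sup>2\<close> for which \<open>2 A \<theta> \<Lambda> |\<nabla>v|\<^sup>2\<close> exceeds them by \<open>\<Lambda> |\<nabla>v|\<^sup>2\<close>.\<close>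

definition bernstein_c :: "real \<Rightarrow> real \<Rightarrow> real \<Rightarrow> real" where
  "bernstein_c n \<theta> K = 8 * n * K + 64 * n\<^sup>2 * K\<^sup>2 / \<theta> + n ^ 3 * K\<^sup>2 / \<theta> + 3 * K + 2 * n * K"

definition bernstein_A :: "real \<Rightarrow> real \<Rightarrow> real \<Rightarrow> real" where
  "bernstein_A n \<theta> K = (bernstein_c n \<theta> K + 1) / (2 * \<theta>)"

lemma abs_mult_le_weighted:
  fixes x y e :: real
  assumes "e > 0"
  shows "2 * \<bar>x * y\<bar> \<le> e * x\<^sup>2 + y\<^sup>2 / e"
proof -
  have "0 \<le> (sqrt e * \<bar>x\<bar> - \<bar>y\<bar> / sqrt e)\<^sup>2" by simp
  also have "\<dots> = e * x\<^sup>2 + y\<^sup>2 / e - 2 * \<bar>x * y\<bar>"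
    using assms by (simp add: power2_diff power_mult_distrib power_divide abs_mult)
  finally show ?thesis by simp
qed

text \<open>The computation at an interior maximum of \<open>\<eta>\<^sup>2 |\<nabla>v|\<^sup>2 + A \<Lambda> v\<^sup>2\<close>, in which \<open>v1\<close>, \<open>v2\<close>, \<open>v3\<close>
  are the derivatives of \<open>v\<close> and \<open>e1\<close>, \<open>e2\<close> those of the cutoff \<open>\<eta>\<close>.
  The squares of the second derivatives of \<open>v\<close>, which come from differentiating \<open>|\<nabla>v|\<^sup>2\<close> twice,
  absorb all mixed terms.\<close>

lemma bernstein_algebra:
  fixes a :: "'n::finite \<Rightarrow> 'n \<Rightarrow> real" and v1 :: "'n \<Rightarrow> real" and v2 :: "'n \<Rightarrow> 'n \<Rightarrow> real"
    and v3 da :: "'n \<Rightarrow> 'n \<Rightarrow> 'n \<Rightarrow> real" and e1 b dr :: "'n \<Rightarrow> real" and e2 db :: "'n \<Rightarrow> 'n \<Rightarrow> real"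
    and h r v L l2 \<theta> K A c :: real
  defines "n \<equiv> real CARD('n)"
  defines "A \<equiv> bernstein_A n \<theta> K"
  defines "q \<equiv> \<Sum>k\<in>UNIV. (v1 k)\<^sup>2"
  defines "Q1 \<equiv> \<lambda>j. \<Sum>k\<in>UNIV. 2 * v1 k * v2 k j"
  defines "Q2 \<equiv> \<lambda>i j. \<Sum>k\<in>UNIV. 2 * (v2 k j * v2 k i + v1 k * v3 k i j)"
  defines "Z1 \<equiv> \<lambda>i. 2 * h * e1 i * q + h\<^sup>2 * Q1 i + 2 * (A * L) * v * v1 i"
  defines "Z2 \<equiv> \<lambda>i j. 2 * (e1 j * e1 i + h * e2 i j) * q + 2 * h * e1 i * Q1 j + 2 * h * e1 j * Q1 i
     + h\<^sup>2 * Q2 i j + 2 * (A * L) * (v1 j * v1 i + v * v2 i j)"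
  assumes eq0: "(\<Sum>i\<in>UNIV. \<Sum>j\<in>UNIV. a i j * v2 i j) + (\<Sum>j\<in>UNIV. b j * v1 j) = - l2 * (r * v)"
    and eq1: "\<And>k. (\<Sum>i\<in>UNIV. \<Sum>j\<in>UNIV. a i j * v3 k i j) + (\<Sum>j\<in>UNIV. b j * v2 k j)
      = - l2 * (r * v1 k + dr k * v) - (\<Sum>i\<in>UNIV. \<Sum>j\<in>UNIV. da k i j * v2 i j) - (\<Sum>j\<in>UNIV. db k j * v1 j)"
    and ell: "\<And>\<xi>. \<theta> * (\<Sum>i\<in>UNIV. (\<xi> i)\<^sup>2) \<le> (\<Sum>i\<in>UNIV. \<Sum>j\<in>UNIV. a i j * \<xi> i * \<xi> j)"
    and bounds: "\<theta> > 0" "0 \<le> K" "\<And>i j. \<bar>a i j\<bar> \<le> K" "\<And>k i j. \<bar>da k i j\<bar> \<le> K" "\<And>j. \<bar>b j\<bar> \<le> K"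
      "\<And>k j. \<bar>db k j\<bar> \<le> K" "\<bar>r\<bar> \<le> K" "\<And>k. \<bar>dr k\<bar> \<le> K"
    and L: "1 \<le> L" "0 \<le> l2" "l2 \<le> L"
    and h: "0 \<le> h" "h \<le> 1"
    and e1: "\<And>i. \<bar>e1 i\<bar> \<le> 2 * L" "(\<Sum>i\<in>UNIV. (e1 i)\<^sup>2) \<le> 4 * L"
    and e2: "\<And>i j. e2 i j = (if i = j then c else 0)" "\<bar>c\<bar> \<le> 2 * L"
    and max1: "\<And>i. Z1 i = 0"
    and max2: "(\<Sum>i\<in>UNIV. \<Sum>j\<in>UNIV. a i j * Z2 i j) \<le> 0"
  shows "q \<le> (n * K + 2 * A * K) * L * v\<^sup>2"
proof -
  define S where "S = (\<Sum>k\<in>UNIV. \<Sum>j\<in>UNIV. (v2 k j)\<^sup>2)"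
  \<comment> \<open>This weight makes the terms absorbed in \<open>cross\<close> (used twice) and \<open>T4\<close> add up to \<open>2 \<theta> h\<^sup>2 S\<close>.\<close>
  define \<epsilon> where "\<epsilon> = \<theta> / n"
  have n: "n \<ge> 1" unfolding n_def by (simp add: Suc_leI)
  have \<epsilon>: "\<epsilon> > 0" using bounds n by (simp add: \<epsilon>_def)
  have q0: "q \<ge> 0" unfolding q_def by (simp add: sum_nonneg)
  have S0: "S \<ge> 0" unfolding S_def by (simp add: sum_nonneg)
  have h2: "0 \<le> h\<^sup>2" "h\<^sup>2 \<le> 1" using h by (auto simp: power_le_one)
  have ee: "0 \<le> (\<Sum>i\<in>UNIV. \<Sum>j\<in>UNIV. a i j * e1 i * e1 j)"
    by (rule order_trans[OF _ ell]) (use bounds in \<open>auto intro!: mult_nonneg_nonneg sum_nonneg\<close>)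
  have KL: "0 \<le> K * (2 * L)" using bounds L by simp
  have ae2: "- (n * (K * (2 * L))) \<le> (\<Sum>i\<in>UNIV. \<Sum>j\<in>UNIV. a i j * e2 i j)"
  proof -
    have "(\<Sum>i\<in>UNIV. \<Sum>j\<in>UNIV. a i j * e2 i j) = (\<Sum>i\<in>UNIV. a i i * c)"
      by (simp add: e2(1) if_distrib[of "\<lambda>z. _ * z"] cong: if_cong)
    moreover have "- (K * (2 * L)) \<le> a i i * c" for i
    proof -
      have "\<bar>a i i * c\<bar> \<le> K * (2 * L)"
        unfolding abs_mult by (intro mult_mono bounds e2) (use bounds in auto)
      then show ?thesis by linarith
    qed
    then have "(\<Sum>i\<in>(UNIV::'n set). - (K * (2 * L))) \<le> (\<Sum>i\<in>UNIV. a i i * c)" by (intro sum_mono)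
    ultimately show ?thesis by (simp add: n_def)
  qed
  have be1: "- (n * (K * (2 * L))) \<le> (\<Sum>i\<in>UNIV. b i * e1 i)"
  proof -
    have "- (K * (2 * L)) \<le> b i * e1 i" for i
    proof -
      have "\<bar>b i * e1 i\<bar> \<le> K * (2 * L)"
        unfolding abs_mult by (intro mult_mono bounds e1) (use bounds in auto)
      then show ?thesis by linarith
    qed
    then have "(\<Sum>i\<in>(UNIV::'n set). - (K * (2 * L))) \<le> (\<Sum>i\<in>UNIV. b i * e1 i)" by (intro sum_mono)
    then show ?thesis by (simp add: n_def)
  qed
  \<comment> \<open>the factor of \<open>|\<nabla>v|\<^sup>2\<close> that comes from the derivatives of the cutoff\<close>
  have T1: "- (8 * n * K) * L * q \<le> q * (2 * (\<Sum>i\<in>UNIV. \<Sum>j\<in>UNIV. a i j * e1 i * e1 j)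
      + 2 * h * (\<Sum>i\<in>UNIV. \<Sum>j\<in>UNIV. a i j * e2 i j) + 2 * h * (\<Sum>i\<in>UNIV. b i * e1 i))"
  proof -
    have hX: "- X \<le> h * Y" if "- X \<le> Y" "0 \<le> X" for X Y
    proof -
      have "h * (- X) \<le> h * Y" using that h by (intro mult_left_mono) auto
      moreover have "h * X \<le> 1 * X" using that h by (intro mult_right_mono) auto
      ultimately show ?thesis by linarith
    qed
    have p: "0 \<le> n * (K * (2 * L))" using KL n by simp
    have "q * (- (8 * n * K * L)) \<le> q * (2 * (\<Sum>i\<in>UNIV. \<Sum>j\<in>UNIV. a i j * e1 i * e1 j)
      + 2 * h * (\<Sum>i\<in>UNIV. \<Sum>j\<in>UNIV. a i j * e2 i j) + 2 * h * (\<Sum>i\<in>UNIV. b i * e1 i))"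
      using hX[OF ae2 p] hX[OF be1 p] ee by (intro mult_left_mono q0) linarith
    then show ?thesis by (simp add: mult_ac)
  qed
  \<comment> \<open>products of first derivatives of the cutoff and second derivatives of \<open>v\<close>\<close>
  have cross: "- (\<epsilon> / 2 * n * h\<^sup>2 * S + 32 * n\<^sup>2 * K\<^sup>2 / \<theta> * L * q)
      \<le> 2 * h * (\<Sum>i\<in>UNIV. \<Sum>j\<in>UNIV. m i j * e1 i * Q1 j)"
    if m: "\<And>i j. \<bar>m i j\<bar> \<le> K" for m
  proof -
    have el: "- (\<epsilon> / 2 * h\<^sup>2 * (v2 k j)\<^sup>2 + 8 * K\<^sup>2 / \<epsilon> * ((e1 i)\<^sup>2 * (v1 k)\<^sup>2))
        \<le> 2 * h * (m i j * e1 i * (2 * v1 k * v2 k j))" for i j k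
    proof -
      have "2 * \<bar>(h * v2 k j) * (2 * m i j * e1 i * v1 k)\<bar>
          \<le> \<epsilon> / 2 * (h * v2 k j)\<^sup>2 + (2 * m i j * e1 i * v1 k)\<^sup>2 / (\<epsilon> / 2)"
        by (rule abs_mult_le_weighted) (use \<epsilon> in simp)
      also have "(2 * m i j * e1 i * v1 k)\<^sup>2 / (\<epsilon> / 2) \<le> (4 * K\<^sup>2 * ((e1 i)\<^sup>2 * (v1 k)\<^sup>2)) / (\<epsilon> / 2)"
      proof (rule divide_right_mono)
        have "(m i j)\<^sup>2 \<le> K\<^sup>2" using m[of i j] bounds(2) by (simp add: abs_le_square_iff[symmetric])
        then have "(m i j)\<^sup>2 * (4 * (e1 i)\<^sup>2 * (v1 k)\<^sup>2) \<le> K\<^sup>2 * (4 * (e1 i)\<^sup>2 * (v1 k)\<^sup>2)"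
          by (rule mult_right_mono) simp
        then show "(2 * m i j * e1 i * v1 k)\<^sup>2 \<le> 4 * K\<^sup>2 * ((e1 i)\<^sup>2 * (v1 k)\<^sup>2)"
          by (simp add: power_mult_distrib mult_ac)
      qed (use \<epsilon> in simp)
      finally have "2 * \<bar>(h * v2 k j) * (2 * m i j * e1 i * v1 k)\<bar>
        \<le> \<epsilon> / 2 * (h * v2 k j)\<^sup>2 + (4 * K\<^sup>2 * ((e1 i)\<^sup>2 * (v1 k)\<^sup>2)) / (\<epsilon> / 2)" by simp
      moreover have "- (2 * \<bar>(h * v2 k j) * (2 * m i j * e1 i * v1 k)\<bar>) \<le> 2 * ((h * v2 k j) * (2 * m i j * e1 i * v1 k))"
        by linarith
      moreover have "2 * ((h * v2 k j) * (2 * m i j * e1 i * v1 k)) = 2 * h * (m i j * e1 i * (2 * v1 k * v2 k j))"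
        by simp
      moreover have "\<epsilon> / 2 * (h * v2 k j)\<^sup>2 + (4 * K\<^sup>2 * ((e1 i)\<^sup>2 * (v1 k)\<^sup>2)) / (\<epsilon> / 2)
        = \<epsilon> / 2 * h\<^sup>2 * (v2 k j)\<^sup>2 + 8 * K\<^sup>2 / \<epsilon> * ((e1 i)\<^sup>2 * (v1 k)\<^sup>2)"
        by (simp add: power_mult_distrib)
      ultimately show ?thesis by linarith
    qed
    have "(\<Sum>i\<in>UNIV. \<Sum>j\<in>UNIV. \<Sum>k\<in>UNIV. - (\<epsilon> / 2 * h\<^sup>2 * (v2 k j)\<^sup>2 + 8 * K\<^sup>2 / \<epsilon> * ((e1 i)\<^sup>2 * (v1 k)\<^sup>2)))
      \<le> (\<Sum>i\<in>UNIV. \<Sum>j\<in>UNIV. \<Sum>k\<in>UNIV. 2 * h * (m i j * e1 i * (2 * v1 k * v2 k j)))"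
      by (intro sum_mono el)
    also have "\<dots> = 2 * h * (\<Sum>i\<in>UNIV. \<Sum>j\<in>UNIV. m i j * e1 i * Q1 j)"
      unfolding Q1_def by (simp only: sum_distrib_left)
    finally have 0: "(\<Sum>i\<in>UNIV. \<Sum>j\<in>UNIV. \<Sum>k\<in>UNIV. - (\<epsilon> / 2 * h\<^sup>2 * (v2 k j)\<^sup>2 + 8 * K\<^sup>2 / \<epsilon> * ((e1 i)\<^sup>2 * (v1 k)\<^sup>2)))
      \<le> 2 * h * (\<Sum>i\<in>UNIV. \<Sum>j\<in>UNIV. m i j * e1 i * Q1 j)" .
    have swp: "(\<Sum>j\<in>UNIV. \<Sum>k\<in>UNIV. (v2 k j)\<^sup>2) = S" unfolding S_def by (rule sum.swap)
    have "(\<Sum>i\<in>UNIV. \<Sum>j\<in>UNIV. \<Sum>k\<in>UNIV. - (X * (v2 k j)\<^sup>2 + Y * ((e1 i)\<^sup>2 * (v1 k)\<^sup>2)))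
       = - (X * (n * S) + Y * (n * ((\<Sum>i\<in>UNIV. (e1 i)\<^sup>2) * q)))" for X Y
      unfolding swp[symmetric]
      by (simp add: sum_negf sum.distrib sum_distrib_left[symmetric] sum_distrib_right[symmetric] q_def n_def
          sum_subtractf)
    from 0[unfolded this] have 1: "- (\<epsilon> / 2 * h\<^sup>2 * (n * S) + 8 * K\<^sup>2 / \<epsilon> * (n * ((\<Sum>i\<in>UNIV. (e1 i)\<^sup>2) * q)))
      \<le> 2 * h * (\<Sum>i\<in>UNIV. \<Sum>j\<in>UNIV. m i j * e1 i * Q1 j)" .
    have "8 * K\<^sup>2 / \<epsilon> * (n * ((\<Sum>i\<in>UNIV. (e1 i)\<^sup>2) * q)) \<le> 8 * K\<^sup>2 / \<epsilon> * (n * ((4 * L) * q))"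
      using \<epsilon> n by (intro mult_left_mono mult_right_mono e1 q0) auto
    also have "\<dots> = 32 * n\<^sup>2 * K\<^sup>2 / \<theta> * L * q" by (simp add: \<epsilon>_def power2_eq_square)
    finally show ?thesis using 1 by (simp add: mult_ac)
  qed
  have c1: "- (\<epsilon> / 2 * n * h\<^sup>2 * S + 32 * n\<^sup>2 * K\<^sup>2 / \<theta> * L * q)
      \<le> 2 * h * (\<Sum>i\<in>UNIV. \<Sum>j\<in>UNIV. a i j * e1 i * Q1 j)"
    by (rule cross) (rule bounds)
  have c2: "- (\<epsilon> / 2 * n * h\<^sup>2 * S + 32 * n\<^sup>2 * K\<^sup>2 / \<theta> * L * q)
      \<le> 2 * h * (\<Sum>i\<in>UNIV. \<Sum>j\<in>UNIV. a i j * e1 j * Q1 i)"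
    by (subst sum.swap, rule cross) (rule bounds)
  \<comment> \<open>ellipticity bounds the squares of the second derivatives from below\<close>
  have T3: "\<theta> * S \<le> (\<Sum>k\<in>UNIV. \<Sum>i\<in>UNIV. \<Sum>j\<in>UNIV. a i j * v2 k i * v2 k j)"
    unfolding S_def sum_distrib_left by (rule sum_mono) (use ell in \<open>simp add: sum_distrib_left\<close>)
  \<comment> \<open>terms with derivatives of the leading coefficients and second derivatives of \<open>v\<close>\<close>
  have T4: "2 * (\<Sum>k\<in>UNIV. v1 k * (\<Sum>i\<in>UNIV. \<Sum>j\<in>UNIV. da k i j * v2 i j)) \<le> \<epsilon> * n * S + n ^ 3 * K\<^sup>2 / \<theta> * q"
  proof -
    have el: "2 * (v1 k * (da k i j * v2 i j)) \<le> \<epsilon> * (v2 i j)\<^sup>2 + K\<^sup>2 / \<epsilon> * (v1 k)\<^sup>2" for i j k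
    proof -
      have "2 * (v1 k * (da k i j * v2 i j)) \<le> 2 * \<bar>v2 i j * (da k i j * v1 k)\<bar>"
        by (simp add: mult_ac)
      also have "\<dots> \<le> \<epsilon> * (v2 i j)\<^sup>2 + (da k i j * v1 k)\<^sup>2 / \<epsilon>"
        by (rule abs_mult_le_weighted[OF \<epsilon>])
      also have "(da k i j * v1 k)\<^sup>2 / \<epsilon> \<le> (K\<^sup>2 * (v1 k)\<^sup>2) / \<epsilon>"
      proof (rule divide_right_mono)
        have "(da k i j)\<^sup>2 \<le> K\<^sup>2" using bounds(4)[of k i j] bounds(2) by (simp add: abs_le_square_iff[symmetric])
        then show "(da k i j * v1 k)\<^sup>2 \<le> K\<^sup>2 * (v1 k)\<^sup>2"
          by (simp add: power_mult_distrib mult_right_mono)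
      qed (use \<epsilon> in simp)
      finally show ?thesis by simp
    qed
    have "2 * (\<Sum>k\<in>UNIV. v1 k * (\<Sum>i\<in>UNIV. \<Sum>j\<in>UNIV. da k i j * v2 i j)) =
        (\<Sum>k\<in>UNIV. \<Sum>i\<in>UNIV. \<Sum>j\<in>UNIV. 2 * (v1 k * (da k i j * v2 i j)))"
      by (simp only: sum_distrib_left)
    also have "\<dots> \<le> (\<Sum>k\<in>(UNIV::'n set). \<Sum>i\<in>UNIV. \<Sum>j\<in>UNIV. \<epsilon> * (v2 i j)\<^sup>2 + K\<^sup>2 / \<epsilon> * (v1 k)\<^sup>2)"
      by (intro sum_mono el)
    also have "(\<Sum>k\<in>(UNIV::'n set). \<Sum>i\<in>UNIV. \<Sum>j\<in>UNIV. \<epsilon> * (v2 i j)\<^sup>2 + Y * (v1 k)\<^sup>2)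
        = \<epsilon> * n * S + n * (n * (Y * q))" for Y
      by (simp add: sum.distrib sum_distrib_left[symmetric] q_def n_def S_def mult_ac)
    also have "n * (n * (K\<^sup>2 / \<epsilon> * q)) = n ^ 3 * K\<^sup>2 / \<theta> * q"
      by (simp add: \<epsilon>_def power3_eq_cube)
    finally show ?thesis .
  qed
  have T5: "(\<Sum>k\<in>UNIV. v1 k * (r * v1 k + dr k * v)) * 2 \<le> 3 * K * q + n * K * v\<^sup>2"
  proof -
    have "v1 k * (r * v1 k + dr k * v) * 2 \<le> 3 * K * (v1 k)\<^sup>2 + K * v\<^sup>2" for k
    proof -
      have "r * (v1 k)\<^sup>2 \<le> K * (v1 k)\<^sup>2" using bounds(7) by (intro mult_right_mono) auto
      moreover have "2 * (dr k * (v1 k * v)) \<le> K * ((v1 k)\<^sup>2 + v\<^sup>2)"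
      proof -
        have "2 * (dr k * (v1 k * v)) \<le> \<bar>dr k\<bar> * \<bar>2 * v1 k * v\<bar>"
          using abs_ge_self[of "dr k * (2 * v1 k * v)"] by (simp add: abs_mult mult_ac)
        also have "\<dots> \<le> K * ((v1 k)\<^sup>2 + v\<^sup>2)"
        proof (intro mult_mono bounds)
          show "\<bar>2 * v1 k * v\<bar> \<le> (v1 k)\<^sup>2 + v\<^sup>2"
            using abs_mult_le_weighted[of 1 "v1 k" v] by (simp add: abs_mult)
        qed (use bounds in auto)
        finally show ?thesis .
      qed
      ultimately show ?thesis by (simp add: algebra_simps power2_eq_square)
    qed
    then have "(\<Sum>k\<in>UNIV. v1 k * (r * v1 k + dr k * v) * 2) \<le> (\<Sum>k\<in>UNIV. 3 * K * (v1 k)\<^sup>2 + K * v\<^sup>2)"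
      by (rule sum_mono)
    then show ?thesis
      by (simp add: sum_distrib_right sum.distrib sum_distrib_left q_def n_def mult_ac)
  qed
  have T6: "2 * (\<Sum>k\<in>UNIV. v1 k * (\<Sum>j\<in>UNIV. db k j * v1 j)) \<le> 2 * n * K * q"
  proof -
    have el: "2 * (v1 k * (db k j * v1 j)) \<le> K * (v1 k)\<^sup>2 + K * (v1 j)\<^sup>2" for k j
    proof -
      have "2 * (v1 k * (db k j * v1 j)) \<le> \<bar>db k j\<bar> * \<bar>2 * v1 k * v1 j\<bar>"
        using abs_ge_self[of "db k j * (2 * v1 k * v1 j)"] by (simp add: abs_mult mult_ac)
      also have "\<dots> \<le> K * ((v1 k)\<^sup>2 + (v1 j)\<^sup>2)"
      proof (intro mult_mono bounds)
        show "\<bar>2 * v1 k * v1 j\<bar> \<le> (v1 k)\<^sup>2 + (v1 j)\<^sup>2"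
          using abs_mult_le_weighted[of 1 "v1 k" "v1 j"] by (simp add: abs_mult)
      qed (use bounds in auto)
      finally show ?thesis by (simp add: distrib_left)
    qed
    have "2 * (\<Sum>k\<in>UNIV. v1 k * (\<Sum>j\<in>UNIV. db k j * v1 j)) = (\<Sum>k\<in>UNIV. \<Sum>j\<in>UNIV. 2 * (v1 k * (db k j * v1 j)))"
      by (simp only: sum_distrib_left)
    also have "\<dots> \<le> (\<Sum>k\<in>UNIV. \<Sum>j\<in>UNIV. K * (v1 k)\<^sup>2 + K * (v1 j)\<^sup>2)"
      by (intro sum_mono el)
    also have "\<dots> = 2 * n * K * q"
      by (simp add: sum.distrib sum_distrib_left[symmetric] q_def n_def)
    finally show ?thesis .
  qed
  have aQ2: "(\<Sum>i\<in>UNIV. \<Sum>j\<in>UNIV. a i j * Q2 i j) + (\<Sum>j\<in>UNIV. b j * Q1 j)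
     = 2 * (\<Sum>k\<in>UNIV. \<Sum>i\<in>UNIV. \<Sum>j\<in>UNIV. a i j * v2 k i * v2 k j)
       + 2 * (\<Sum>k\<in>UNIV. v1 k * ((\<Sum>i\<in>UNIV. \<Sum>j\<in>UNIV. a i j * v3 k i j) + (\<Sum>j\<in>UNIV. b j * v2 k j)))"
  proof -
    have "(\<Sum>i\<in>UNIV. \<Sum>j\<in>UNIV. a i j * Q2 i j) = (\<Sum>i\<in>UNIV. \<Sum>k\<in>UNIV. \<Sum>j\<in>UNIV. a i j * (2 * (v2 k j * v2 k i + v1 k * v3 k i j)))"
      unfolding Q2_def sum_distrib_left by (intro sum.cong refl sum.swap)
    also have "\<dots> = (\<Sum>k\<in>UNIV. \<Sum>i\<in>UNIV. \<Sum>j\<in>UNIV. a i j * (2 * (v2 k j * v2 k i + v1 k * v3 k i j)))"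
      by (rule sum.swap)
    also have "\<dots> = (\<Sum>k\<in>UNIV. \<Sum>i\<in>UNIV. \<Sum>j\<in>UNIV. 2 * (a i j * v2 k i * v2 k j) + 2 * (v1 k * (a i j * v3 k i j)))"
      by (intro sum.cong refl) (simp add: algebra_simps)
    finally have 1: "(\<Sum>i\<in>UNIV. \<Sum>j\<in>UNIV. a i j * Q2 i j) = \<dots>" .
    have "(\<Sum>j\<in>UNIV. b j * Q1 j) = (\<Sum>k\<in>UNIV. \<Sum>j\<in>UNIV. b j * (2 * v1 k * v2 k j))"
      unfolding Q1_def sum_distrib_left by (rule sum.swap)
    also have "\<dots> = (\<Sum>k\<in>UNIV. \<Sum>j\<in>UNIV. 2 * (v1 k * (b j * v2 k j)))"
      by (intro sum.cong refl) simp
    finally have 2: "(\<Sum>j\<in>UNIV. b j * Q1 j) = \<dots>" .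
    show ?thesis unfolding 1 2
      by (simp only: sum.distrib distrib_left sum_distrib_left)
  qed
  have aQ2': "(\<Sum>i\<in>UNIV. \<Sum>j\<in>UNIV. a i j * Q2 i j) + (\<Sum>j\<in>UNIV. b j * Q1 j)
     = 2 * (\<Sum>k\<in>UNIV. \<Sum>i\<in>UNIV. \<Sum>j\<in>UNIV. a i j * v2 k i * v2 k j)
       - l2 * ((\<Sum>k\<in>UNIV. v1 k * (r * v1 k + dr k * v)) * 2)
       - 2 * (\<Sum>k\<in>UNIV. v1 k * (\<Sum>i\<in>UNIV. \<Sum>j\<in>UNIV. da k i j * v2 i j))
       - 2 * (\<Sum>k\<in>UNIV. v1 k * (\<Sum>j\<in>UNIV. db k j * v1 j))"
  proof -
    have "(\<Sum>k\<in>UNIV. v1 k * ((\<Sum>i\<in>UNIV. \<Sum>j\<in>UNIV. a i j * v3 k i j) + (\<Sum>j\<in>UNIV. b j * v2 k j)))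
      = (\<Sum>k\<in>UNIV. (- l2) * (v1 k * (r * v1 k + dr k * v)) - v1 k * (\<Sum>i\<in>UNIV. \<Sum>j\<in>UNIV. da k i j * v2 i j)
          - v1 k * (\<Sum>j\<in>UNIV. db k j * v1 j))"
      unfolding eq1 by (intro sum.cong refl) (simp only: algebra_simps)
    also have "\<dots> = (- l2) * (\<Sum>k\<in>UNIV. v1 k * (r * v1 k + dr k * v)) - (\<Sum>k\<in>UNIV. v1 k * (\<Sum>i\<in>UNIV. \<Sum>j\<in>UNIV. da k i j * v2 i j))
          - (\<Sum>k\<in>UNIV. v1 k * (\<Sum>j\<in>UNIV. db k j * v1 j))"
      by (simp only: sum_subtractf sum_distrib_left)
    finally show ?thesis unfolding aQ2 by simp
  qed
  have LQ: "2 * \<theta> * S - L * (3 * K * q + n * K * v\<^sup>2) - (\<epsilon> * n * S + n ^ 3 * K\<^sup>2 / \<theta> * q) - 2 * n * K * q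
     \<le> (\<Sum>i\<in>UNIV. \<Sum>j\<in>UNIV. a i j * Q2 i j) + (\<Sum>j\<in>UNIV. b j * Q1 j)"
  proof -
    have p: "0 \<le> 3 * K * q + n * K * v\<^sup>2" using bounds(2) q0 n by simp
    have "l2 * ((\<Sum>k\<in>UNIV. v1 k * (r * v1 k + dr k * v)) * 2) \<le> l2 * (3 * K * q + n * K * v\<^sup>2)"
      by (rule mult_left_mono[OF T5 L(2)])
    also have "\<dots> \<le> L * (3 * K * q + n * K * v\<^sup>2)" by (rule mult_right_mono[OF L(3) p])
    finally show ?thesis unfolding aQ2' using T3 T4 T6 by linarith
  qed
  have en: "\<epsilon> * n = \<theta>" using n by (simp add: \<epsilon>_def)
  have main: "(\<Sum>i\<in>UNIV. \<Sum>j\<in>UNIV. a i j * Z2 i j) + (\<Sum>i\<in>UNIV. b i * Z1 i) =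
      q * (2 * (\<Sum>i\<in>UNIV. \<Sum>j\<in>UNIV. a i j * e1 i * e1 j)
      + 2 * h * (\<Sum>i\<in>UNIV. \<Sum>j\<in>UNIV. a i j * e2 i j) + 2 * h * (\<Sum>i\<in>UNIV. b i * e1 i))
      + 2 * h * (\<Sum>i\<in>UNIV. \<Sum>j\<in>UNIV. a i j * e1 i * Q1 j) + 2 * h * (\<Sum>i\<in>UNIV. \<Sum>j\<in>UNIV. a i j * e1 j * Q1 i)
      + h\<^sup>2 * ((\<Sum>i\<in>UNIV. \<Sum>j\<in>UNIV. a i j * Q2 i j) + (\<Sum>j\<in>UNIV. b j * Q1 j))
      + 2 * (A * L) * ((\<Sum>i\<in>UNIV. \<Sum>j\<in>UNIV. a i j * v1 i * v1 j)
          + v * ((\<Sum>i\<in>UNIV. \<Sum>j\<in>UNIV. a i j * v2 i j) + (\<Sum>j\<in>UNIV. b j * v1 j)))"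
    unfolding Z1_def Z2_def
    by (simp add: algebra_simps sum.distrib sum_distrib_left)
  have crs: "\<epsilon> / 2 * n * h\<^sup>2 * S = \<theta> * h\<^sup>2 * S / 2" using en by (simp add: mult_ac)
  define c' where "c' = L * (3 * K * q + n * K * v\<^sup>2) + n ^ 3 * K\<^sup>2 / \<theta> * q + 2 * n * K * q"
  have c'0: "0 \<le> c'" unfolding c'_def using bounds n q0 L by (intro add_nonneg_nonneg mult_nonneg_nonneg) auto
  have hLQ: "\<theta> * h\<^sup>2 * S - c' \<le> h\<^sup>2 * ((\<Sum>i\<in>UNIV. \<Sum>j\<in>UNIV. a i j * Q2 i j) + (\<Sum>j\<in>UNIV. b j * Q1 j))"
  proof -
    have "h\<^sup>2 * (\<theta> * S - c') \<le> h\<^sup>2 * ((\<Sum>i\<in>UNIV. \<Sum>j\<in>UNIV. a i j * Q2 i j) + (\<Sum>j\<in>UNIV. b j * Q1 j))"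
      by (rule mult_left_mono[OF _ h2(1)]) (use LQ[unfolded en] in \<open>unfold c'_def, linarith\<close>)
    moreover have "h\<^sup>2 * c' \<le> c'" using mult_right_mono[OF h2(2) c'0] by simp
    moreover have "h\<^sup>2 * (\<theta> * S - c') = \<theta> * h\<^sup>2 * S - h\<^sup>2 * c'" by (simp add: right_diff_distrib)
    ultimately show ?thesis by linarith
  qed
  have c0: "0 \<le> bernstein_c n \<theta> K"
    unfolding bernstein_c_def using bounds n by (intro add_nonneg_nonneg) auto
  have A0: "0 \<le> A" unfolding A_def bernstein_A_def using c0 bounds by simp
  have A\<theta>: "2 * A * \<theta> = bernstein_c n \<theta> K + 1" using bounds by (simp add: A_def bernstein_A_def)
  have TB: "2 * (A * L) * (\<theta> * q - K * L * v\<^sup>2) \<le> 2 * (A * L) * ((\<Sum>i\<in>UNIV. \<Sum>j\<in>UNIV. a i j * v1 i * v1 j)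
          + v * ((\<Sum>i\<in>UNIV. \<Sum>j\<in>UNIV. a i j * v2 i j) + (\<Sum>j\<in>UNIV. b j * v1 j)))"
  proof (rule mult_left_mono)
    have "l2 * (r * v\<^sup>2) \<le> L * (K * v\<^sup>2)"
    proof -
      have "l2 * (r * v\<^sup>2) \<le> l2 * (K * v\<^sup>2)" using bounds(7) L by (intro mult_left_mono mult_right_mono) auto
      also have "\<dots> \<le> L * (K * v\<^sup>2)" using bounds(2) L by (intro mult_right_mono) auto
      finally show ?thesis .
    qed
    then show "\<theta> * q - K * L * v\<^sup>2 \<le> (\<Sum>i\<in>UNIV. \<Sum>j\<in>UNIV. a i j * v1 i * v1 j)
          + v * ((\<Sum>i\<in>UNIV. \<Sum>j\<in>UNIV. a i j * v2 i j) + (\<Sum>j\<in>UNIV. b j * v1 j))"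
      unfolding eq0 using ell[of v1] by (simp add: q_def power2_eq_square mult_ac)
  qed (use A0 L in simp)
  have Z10: "(\<Sum>i\<in>UNIV. b i * Z1 i) = 0" using max1 by simp
  have qL: "q \<le> L * q" using mult_right_mono[OF L(1) q0] by simp
  have cc: "n ^ 3 * K\<^sup>2 / \<theta> * q + 2 * n * K * q \<le> (n ^ 3 * K\<^sup>2 / \<theta> + 2 * n * K) * (L * q)"
    unfolding distrib_right using bounds n by (intro add_mono mult_left_mono qL) auto
  define Y where "Y = n\<^sup>2 * K\<^sup>2 / \<theta> * L * q"
  have Y: "32 * n\<^sup>2 * K\<^sup>2 / \<theta> * L * q = 32 * Y" by (simp add: Y_def)
  have add5: "p1 + p2 + p3 + p4 + p5 \<le> 0" if "P1 + P2 + P3 + P4 + P5 \<le> 0" "p1 \<le> P1" "p2 \<le> P2" "p3 \<le> P3"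
    "p4 \<le> P4" "p5 \<le> P5" for p1 p2 p3 p4 p5 P1 P2 P3 P4 P5 :: real
    using that by linarith
  from max2 have "(\<Sum>i\<in>UNIV. \<Sum>j\<in>UNIV. a i j * Z2 i j) + (\<Sum>i\<in>UNIV. b i * Z1 i) \<le> 0"
    unfolding Z10 by simp
  from add5[OF this[unfolded main] T1 c1 c2 hLQ TB]
  have "0 \<ge> - (8 * n * K) * L * q - 64 * Y - c' + 2 * (A * L) * (\<theta> * q - K * L * v\<^sup>2)"
    unfolding crs Y by simp
  then have "2 * A * \<theta> * (L * q) \<le> 8 * n * K * (L * q) + 64 * n\<^sup>2 * K\<^sup>2 / \<theta> * (L * q)
      + (L * (3 * K * q + n * K * v\<^sup>2) + (n ^ 3 * K\<^sup>2 / \<theta> + 2 * n * K) * (L * q)) + 2 * A * K * L * L * v\<^sup>2"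
    using cc unfolding c'_def Y_def by (simp add: algebra_simps)
  then have "L * q \<le> n * K * L * v\<^sup>2 + 2 * A * K * L * L * v\<^sup>2"
    unfolding A\<theta> bernstein_c_def by (simp add: algebra_simps)
  also have "n * K * L * v\<^sup>2 \<le> n * K * L * v\<^sup>2 * L"
    using mult_left_mono[OF L(1), of "n * K * L * v\<^sup>2"] bounds n L by simp
  finally have "L * q \<le> L * ((n * K + 2 * A * K) * L * v\<^sup>2)" by (simp add: algebra_simps)
  then show ?thesis using L by (simp add: mult_le_cancel_left)
qed


definition bernstein_C :: "real \<Rightarrow> real \<Rightarrow> real \<Rightarrow> real" where
  "bernstein_C n \<theta> K = n * K + 2 * bernstein_A n \<theta> K * K + bernstein_A n \<theta> K"

lemma bernstein_A_nonneg: "0 < \<theta> \<Longrightarrow> 0 \<le> K \<Longrightarrow> 0 \<le> n \<Longrightarrow> 0 \<le> bernstein_A n \<theta> K"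
  unfolding bernstein_A_def bernstein_c_def
  by (intro divide_nonneg_nonneg add_nonneg_nonneg) auto

lemma bernstein_C_nonneg: "0 < \<theta> \<Longrightarrow> 0 \<le> K \<Longrightarrow> 0 \<le> n \<Longrightarrow> 0 \<le> bernstein_C n \<theta> K"
  unfolding bernstein_C_def
  by (intro add_nonneg_nonneg mult_nonneg_nonneg bernstein_A_nonneg) auto

lemma sum_squares_eq_dist:
  fixes x y :: "real^'n::finite"
  shows "(\<Sum>i\<in>UNIV. (x $ i - y $ i)\<^sup>2) = (dist y x)\<^sup>2"
  by (simp add: dist_norm norm_vec_def L2_set_def sum_nonneg power2_commute)

lemma abs_component_le_dist:
  fixes x y :: "real^'n::finite"
  shows "\<bar>x $ i - y $ i\<bar> \<le> dist y x"
  using component_le_norm_cart[of "x - y" i] by (simp add: dist_norm norm_minus_commute)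

context elliptic_operator
begin

text \<open>Bernstein's estimate, by the maximum principle for \<open>Z = \<eta>\<^sup>2 |\<nabla>v|\<^sup>2 + A \<Lambda> v\<^sup>2\<close> on the ball. The cutoff \<open>\<eta>\<close>, here
  \<open>h\<close>, is \<open>1 - |x - y|\<^sup>2 / s\<^sup>2\<close>.\<close>

lemma interior_gradient_bound:
  fixes v :: "real^'n \<Rightarrow> real"
  assumes eq: "eigen_eq lam U v" and ball: "cball y s \<subseteq> U" and s: "0 < s" "s \<le> 1"
    and m: "\<And>x. x \<in> cball y s \<Longrightarrow> \<bar>v x\<bar> \<le> m"
  shows "(\<Sum>i\<in>UNIV. (pd i v y)\<^sup>2) \<le> bernstein_C (real CARD('n)) \<theta> K * (lam\<^sup>2 + 1 / s\<^sup>2) * m\<^sup>2"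
proof -
  define n where "n = real CARD('n)"
  define A where "A = bernstein_A n \<theta> K"
  define L where "L = lam\<^sup>2 + 1 / s\<^sup>2"
  have s2: "1 \<le> 1 / s\<^sup>2" using s by (simp add: power_le_one)
  have L: "1 \<le> L" "0 \<le> lam\<^sup>2" "lam\<^sup>2 \<le> L" "1 / s\<^sup>2 \<le> L" "0 \<le> L"
    using s2 unfolding L_def by (auto intro: add_nonneg_nonneg add_increasing)
  have A0: "0 \<le> A" unfolding A_def n_def using theta_pos K_nonneg by (simp add: bernstein_A_nonneg)
  have U: "open U" "U \<subseteq> \<Omega>" and v: "Ck_on_open (Suc (Suc (Suc 0))) U v"
    using eq by (auto simp: eigen_eq_def)
  note v1 = Ck_pd[OF v U(1)] note v2 = Ck_pd[OF v1 U(1)]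
  define h where "h x = 1 - (1 / s\<^sup>2) * (\<Sum>i\<in>UNIV. (x $ i - y $ i)\<^sup>2)" for x :: "real^'n"
  define e1 where "e1 i x = (- 2 / s\<^sup>2) * (x $ i - y $ i)" for i and x :: "real^'n"
  define e2 where "e2 i j = (if i = j then - 2 / s\<^sup>2 else 0)" for i j :: 'n
  define q where "q x = (\<Sum>k\<in>UNIV. (pd k v x)\<^sup>2)" for x
  define Q1 where "Q1 j x = (\<Sum>k\<in>UNIV. 2 * pd k v x * pd j (pd k v) x)" for j x
  define Z where "Z x = (h x)\<^sup>2 * q x + (A * L) * (v x)\<^sup>2" for x
  define Z1 where "Z1 i x = 2 * h x * e1 i x * q x + (h x)\<^sup>2 * Q1 i x + 2 * (A * L) * v x * pd i v x" for i x
  have hd: "h x = 1 - (1 / s\<^sup>2) * (dist y x)\<^sup>2" for x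
    unfolding h_def sum_squares_eq_dist ..
  have h01: "0 \<le> h x" "h x \<le> 1" if "x \<in> cball y s" for x
  proof -
    have "(dist y x)\<^sup>2 \<le> s\<^sup>2" using that by (intro power_mono) auto
    then show "0 \<le> h x" "h x \<le> 1" using s by (auto simp: hd)
  qed
  have coord: "has_grad (\<lambda>x. x $ i - y $ i) (\<lambda>j. if j = i then 1 else 0) x" for i and x :: "real^'n"
    using has_grad_diff[OF has_grad_coord[of i x] has_grad_const[of "y $ i" x]] by simp
  have hg: "has_grad h (\<lambda>i. e1 i x) x" for x
  proof -
    have "has_grad h (\<lambda>j. 0 - (1 / s\<^sup>2) * (\<Sum>i\<in>UNIV. 2 * (x $ i - y $ i) * (if j = i then 1 else 0))) x"
      unfolding h_def
      by (intro has_grad_diff has_grad_cmult has_grad_sum has_grad_power2 has_grad_const coord)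
    then show ?thesis
      by (rule has_grad_eq) (simp add: e1_def if_distrib[of "\<lambda>z. _ * z"] cong: if_cong)
  qed
  have e1g: "has_grad (e1 i) (\<lambda>j. e2 i j) x" for i x
    unfolding e1_def
    by (rule has_grad_eq[OF has_grad_cmult[OF coord]]) (auto simp: e2_def)
  have vg: "has_grad v (\<lambda>i. pd i v x) x" if "x \<in> U" for x by (rule Ck_has_grad[OF v U(1) that])
  have vg1: "has_grad (pd k v) (\<lambda>i. pd i (pd k v) x) x" if "x \<in> U" for x k
    by (rule Ck_has_grad[OF v1 U(1) that])
  have vg2: "has_grad (pd j (pd k v)) (\<lambda>i. pd i (pd j (pd k v)) x) x" if "x \<in> U" for x j k
    by (rule Ck_has_grad[OF v2 U(1) that])
  have qg: "has_grad q (\<lambda>j. Q1 j x) x" if "x \<in> U" for x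
    unfolding q_def Q1_def by (intro has_grad_sum has_grad_power2 vg1 that)
  have Zg: "has_grad Z (\<lambda>i. Z1 i x) x" if "x \<in> U" for x
    unfolding Z_def
    by (rule has_grad_eq[OF has_grad_add[OF has_grad_mult[OF has_grad_power2[OF hg] qg]
          has_grad_cmult[OF has_grad_power2[OF vg]]]])
      (simp_all add: that Z1_def mult_ac)
  define v3 where "v3 k i j x = pd j (pd i (pd k v)) x" for k i j x
  define Q2 where "Q2 i j x = (\<Sum>k\<in>UNIV. 2 * (pd j (pd k v) x * pd i (pd k v) x + pd k v x * v3 k i j x))" for i j x
  define Z2 where "Z2 i j x = 2 * (e1 j x * e1 i x + h x * e2 i j) * q x + 2 * h x * e1 i x * Q1 j x + 2 * h x * e1 j x * Q1 i x
     + (h x)\<^sup>2 * Q2 i j x + 2 * (A * L) * (pd j v x * pd i v x + v x * pd j (pd i v) x)" for i j x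
  have Q1g: "has_grad (Q1 i) (\<lambda>j. Q2 i j x) x" if x: "x \<in> U" for x i
  proof -
    have "has_grad (Q1 i) (\<lambda>j. \<Sum>k\<in>UNIV. (2 * pd k v x) * pd j (pd i (pd k v)) x + (2 * pd j (pd k v) x) * pd i (pd k v) x) x"
      unfolding Q1_def by (intro has_grad_sum has_grad_mult has_grad_cmult vg1 vg2 x)
    then show ?thesis
      by (rule has_grad_eq) (simp add: Q2_def v3_def algebra_simps)
  qed
  have Z1g: "has_grad (Z1 i) (\<lambda>j. Z2 i j x) x" if x: "x \<in> U" for x i
    unfolding Z1_def
    by (rule has_grad_eq[OF has_grad_add[OF has_grad_add[OF
            has_grad_mult[OF has_grad_mult[OF has_grad_cmult[OF hg] e1g] qg[OF x]]
            has_grad_mult[OF has_grad_power2[OF hg] Q1g[OF x]]]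
          has_grad_mult[OF has_grad_cmult[OF vg[OF x]] vg1[OF x]]]])
      (simp add: Z2_def algebra_simps)
  have contZ: "continuous_on (cball y s) Z"
    using has_grad_isCont[OF Zg] ball by (intro continuous_at_imp_continuous_on) blast
  have "\<exists>x\<in>cball y s. \<forall>z\<in>cball y s. Z z \<le> Z x"
    by (rule continuous_attains_sup) (use s contZ in auto)
  then obtain x where x: "x \<in> cball y s" "\<And>z. z \<in> cball y s \<Longrightarrow> Z z \<le> Z x" by blast
  have vm: "(v x)\<^sup>2 \<le> m\<^sup>2"
    using m[OF x(1)] by (simp add: abs_le_square_iff[symmetric])
  have y: "y \<in> cball y s" using s by simp
  have "q y \<le> Z y" using A0 L by (simp add: Z_def hd)
  also have "\<dots> \<le> Z x" by (rule x(2)[OF y])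
  also have "Z x \<le> bernstein_C n \<theta> K * L * m\<^sup>2"
  proof (cases "dist y x = s")
    case True
    \<comment> \<open>The cutoff vanishes on the sphere.\<close>
    then have "Z x = A * L * (v x)\<^sup>2" using s by (simp add: Z_def hd)
    also have "\<dots> \<le> bernstein_C n \<theta> K * L * m\<^sup>2"
      using A0 K_nonneg L vm theta_pos
      by (intro mult_mono) (auto simp: bernstein_C_def A_def n_def intro!: bernstein_C_nonneg add_nonneg_nonneg mult_nonneg_nonneg)
    finally show ?thesis .
  next
    case False
    with x have xb: "x \<in> ball y s" by auto
    have bU: "ball y s \<subseteq> U" using ball by auto
    have xU: "x \<in> U" and xO: "x \<in> \<Omega>" using xb bU U by auto
    have mx: "Z1 i x = 0" "(\<Sum>i\<in>UNIV. \<Sum>j\<in>UNIV. a i j x * Z2 i j x) \<le> 0" for i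
    proof -
      have 1: "\<And>z. z \<in> ball y s \<Longrightarrow> has_grad Z (\<lambda>i. Z1 i z) z" using Zg bU by blast
      have 2: "\<And>z. z \<in> ball y s \<Longrightarrow> Z z \<le> Z x" using x(2) by simp
      show "Z1 i x = 0" "(\<Sum>i\<in>UNIV. \<Sum>j\<in>UNIV. a i j x * Z2 i j x) \<le> 0"
        using interior_max_elliptic[where W="ball y s" and a="\<lambda>i j. a i j x",
            OF open_ball xb 1 Z1g[OF xU] 2 sym[OF xO] psd[OF xO]] by auto
    qed
    have e1b: "\<bar>e1 i x\<bar> \<le> 2 * L" for i
    proof -
      have "\<bar>e1 i x\<bar> = 2 / s\<^sup>2 * \<bar>x $ i - y $ i\<bar>" by (simp only: e1_def abs_mult) simp
      also have "\<dots> \<le> 2 / s\<^sup>2 * 1"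
        using abs_component_le_dist[of x i y] x(1) s by (intro mult_left_mono) auto
      finally show ?thesis using L(4) by simp
    qed
    have e1s: "(\<Sum>i\<in>UNIV. (e1 i x)\<^sup>2) \<le> 4 * L"
    proof -
      have "(\<Sum>i\<in>UNIV. (e1 i x)\<^sup>2) = 4 / s\<^sup>2 * (1 / s\<^sup>2 * (dist y x)\<^sup>2)"
        unfolding e1_def power_mult_distrib sum_distrib_left[symmetric] sum_squares_eq_dist
        by (simp add: power2_eq_square)
      also have "\<dots> \<le> 4 / s\<^sup>2 * 1"
        using h01[OF x(1)] by (intro mult_left_mono) (auto simp: hd)
      finally show ?thesis using L(4) by simp
    qed
    have "q x \<le> (n * K + 2 * A * K) * L * (v x)\<^sup>2"
      unfolding q_def n_def A_def
    proof (rule bernstein_algebra[where a="\<lambda>i j. a i j x" and b="\<lambda>j. b j x" and ?v2.0="\<lambda>k j. pd j (pd k v) x"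
          and ?v3.0="\<lambda>k i j. v3 k i j x" and da="\<lambda>k i j. pd k (a i j) x" and ?e1.0="\<lambda>i. e1 i x" and dr="\<lambda>k. pd k r x"
          and ?e2.0=e2 and db="\<lambda>k j. pd k (b j) x" and h="h x" and r="r x" and ?l2.0="lam\<^sup>2" and c="- 2 / s\<^sup>2"])
      show "(\<Sum>i\<in>UNIV. \<Sum>j\<in>UNIV. a i j x * pd j (pd i v) x) + (\<Sum>j\<in>UNIV. b j x * pd j v x) = - (lam\<^sup>2) * (r x * v x)"
        using eq xU by (simp add: eigen_eq_def)
      show "(\<Sum>i\<in>UNIV. \<Sum>j\<in>UNIV. a i j x * v3 k i j x) + (\<Sum>j\<in>UNIV. b j x * pd j (pd k v) x) =
         - (lam\<^sup>2) * (r x * pd k v x + pd k r x * v x)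
      - (\<Sum>i\<in>UNIV. \<Sum>j\<in>UNIV. pd k (a i j) x * pd j (pd i v) x) - (\<Sum>j\<in>UNIV. pd k (b j) x * pd j v x)" for k
        unfolding v3_def by (rule eigen_eq_differentiated[OF eq xU])
      show "e2 i j = (if i = j then - 2 / s\<^sup>2 else 0)" for i j by (simp add: e2_def)
      show "2 * h x * e1 i x * (\<Sum>k\<in>UNIV. (pd k v x)\<^sup>2) + (h x)\<^sup>2 * (\<Sum>k\<in>UNIV. 2 * pd k v x * pd i (pd k v) x)
         + 2 * (bernstein_A (real CARD('n)) \<theta> K * L) * v x * pd i v x = 0" for i
        using mx(1)[of i] by (simp add: Z1_def q_def Q1_def A_def n_def)
      show "(\<Sum>i\<in>UNIV. \<Sum>j\<in>UNIV. a i j x * (2 * (e1 j x * e1 i x + h x * e2 i j) * (\<Sum>k\<in>UNIV. (pd k v x)\<^sup>2)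
        + 2 * h x * e1 i x * (\<Sum>k\<in>UNIV. 2 * pd k v x * pd j (pd k v) x)
        + 2 * h x * e1 j x * (\<Sum>k\<in>UNIV. 2 * pd k v x * pd i (pd k v) x)
        + (h x)\<^sup>2 * (\<Sum>k\<in>UNIV. 2 * (pd j (pd k v) x * pd i (pd k v) x + pd k v x * v3 k i j x))
        + 2 * (bernstein_A (real CARD('n)) \<theta> K * L) * (pd j v x * pd i v x + v x * pd j (pd i v) x))) \<le> 0"
        using mx(2) by (simp add: Z2_def q_def Q1_def Q2_def A_def n_def)
    qed (use elliptic[OF xO] theta_pos K_nonneg a_bound[OF xO] b_bound[OF xO] da_bound[OF xO] db_bound[OF xO]
          r_bound[OF xO] dr_bound[OF xO] L h01[OF x(1)] e1b e1s in auto)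
    moreover have "Z x \<le> q x + A * L * (v x)\<^sup>2"
    proof -
      have "(h x)\<^sup>2 \<le> 1" using h01[OF x(1)] by (simp add: power_le_one)
      moreover have "0 \<le> q x" unfolding q_def by (simp add: sum_nonneg)
      ultimately have "(h x)\<^sup>2 * q x \<le> 1 * q x" by (intro mult_right_mono)
      then show ?thesis by (simp add: Z_def)
    qed
    ultimately have "Z x \<le> bernstein_C n \<theta> K * L * (v x)\<^sup>2"
      by (simp add: bernstein_C_def A_def algebra_simps)
    also have "\<dots> \<le> bernstein_C n \<theta> K * L * m\<^sup>2"
      using vm L theta_pos K_nonneg by (intro mult_left_mono) (auto simp: n_def intro!: bernstein_C_nonneg mult_nonneg_nonneg)
    finally show ?thesis .
  qed
  finally show ?thesis by (simp add: q_def n_def L_def)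
qed

end


section \<open>The boundary barrier\<close>

text \<open>Up to the factor \<open>M\<close>, the barrier is \<open>\<alpha> lam x\<^sub>k - \<beta> lam\<^sup>2 x\<^sub>k\<^sup>2\<close> plus a quadratic term, on the strip
  \<open>0 \<le> x\<^sub>k \<le> \<delta> / lam\<close>. The constant \<open>\<delta>\<close> is so small that \<open>3 \<delta> K \<le> \<theta>\<close>, then \<open>\<beta>\<close> is so large that the concave part
  dominates the right hand side of the equation, and \<open>\<alpha>\<close> makes the barrier at least \<open>M\<close> on the inner
  side \<open>x\<^sub>k = \<delta> / lam\<close> of the strip.\<close>

definition barrier_delta :: "real \<Rightarrow> real \<Rightarrow> real \<Rightarrow> real" where
  "barrier_delta \<theta> K R = min (R / 4) (\<theta> / (3 * (K + 1)))"

definition barrier_beta :: "real \<Rightarrow> real \<Rightarrow> real \<Rightarrow> real \<Rightarrow> real" where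
  "barrier_beta n \<theta> K R = (K / barrier_delta \<theta> K R + 4 * n * K / (R / 4)\<^sup>2 + K + 1) / \<theta>"

definition barrier_alpha :: "real \<Rightarrow> real \<Rightarrow> real \<Rightarrow> real \<Rightarrow> real" where
  "barrier_alpha n \<theta> K R = barrier_beta n \<theta> K R * barrier_delta \<theta> K R + 1 / barrier_delta \<theta> K R"

context elliptic_operator
begin

lemma barrier_delta_bounds:
  assumes "0 < R"
  shows "0 < barrier_delta \<theta> K R" "barrier_delta \<theta> K R \<le> R / 4" "3 * barrier_delta \<theta> K R * K \<le> \<theta>"
proof -
  show d: "0 < barrier_delta \<theta> K R"
    unfolding barrier_delta_def using assms theta_pos K_nonneg by simp
  show "barrier_delta \<theta> K R \<le> R / 4"
    unfolding barrier_delta_def by (rule min.cobounded1)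
  have "barrier_delta \<theta> K R \<le> \<theta> / (3 * (K + 1))" by (simp add: barrier_delta_def)
  then have "barrier_delta \<theta> K R * (3 * (K + 1)) \<le> \<theta>"
    using K_nonneg by (simp add: pos_le_divide_eq)
  then show "3 * barrier_delta \<theta> K R * K \<le> \<theta>" using d by (simp add: algebra_simps)
qed

lemma barrier_beta_nonneg: "0 < R \<Longrightarrow> 0 \<le> n \<Longrightarrow> 0 \<le> barrier_beta n \<theta> K R"
  unfolding barrier_beta_def using theta_pos K_nonneg barrier_delta_bounds[of R]
  by (intro divide_nonneg_nonneg add_nonneg_nonneg mult_nonneg_nonneg) auto

lemma barrier_alpha_pos: "0 < R \<Longrightarrow> 0 \<le> n \<Longrightarrow> 0 < barrier_alpha n \<theta> K R"
  unfolding barrier_alpha_def using barrier_beta_nonneg[of R n] barrier_delta_bounds[of R]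
  by (intro add_nonneg_pos) auto

lemma diagonal_ge_theta: "x \<in> \<Omega> \<Longrightarrow> \<theta> \<le> a k k x"
  using elliptic[of x "\<lambda>i. if i = k then 1 else 0"]
  by (simp add: if_distrib[of "\<lambda>z. z\<^sup>2"] if_distrib[of "\<lambda>z. _ * z"] if_distrib[of "\<lambda>z. z * _"] cong: if_cong)

text \<open>A solution that vanishes on \<open>x\<^sub>k = 0\<close> grows at most linearly away from it, with slope \<open>\<alpha> lam M\<close>. The
  term \<open>|z - x|\<^sup>2 / \<rho>\<^sup>2\<close> in the barrier \<open>\<phi>\<close>, centred at the point \<open>x\<close> of interest, makes the comparison local
  and vanishes at \<open>x\<close>.\<close>

lemma boundary_barrier:
  fixes v :: "real^'n \<Rightarrow> real"
  defines "n \<equiv> real CARD('n)"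
  assumes R: "0 < R" "R \<le> 1" "ball x0 R \<subseteq> \<Omega>" and lam: "1 \<le> lam"
    and eq: "eigen_eq lam (ball x0 R \<inter> {x. 0 < x $ k}) v"
    and cont: "continuous_on (ball x0 R \<inter> half_space k) v"
    and zero: "\<And>x. x \<in> ball x0 R \<Longrightarrow> x $ k = 0 \<Longrightarrow> v x = 0"
    and bound: "\<And>x. x \<in> ball x0 R \<inter> half_space k \<Longrightarrow> \<bar>v x\<bar> \<le> M"
    and M: "0 < M"
    and x: "x \<in> ball x0 (R / 2)" "0 < x $ k" "x $ k \<le> barrier_delta \<theta> K R / lam"
  shows "\<bar>v x\<bar> \<le> barrier_alpha n \<theta> K R * lam * M * x $ k"
proof -
  define \<delta> where "\<delta> = barrier_delta \<theta> K R"
  define \<beta> where "\<beta> = barrier_beta n \<theta> K R"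
  define \<alpha> where "\<alpha> = barrier_alpha n \<theta> K R"
  define \<rho> where "\<rho> = R / 4"
  have \<delta>: "0 < \<delta>" "\<delta> \<le> \<rho>" "3 * \<delta> * K \<le> \<theta>"
    using barrier_delta_bounds[OF R(1)] by (auto simp: \<delta>_def \<rho>_def)
  have \<rho>: "0 < \<rho>" "\<rho> \<le> 1" using R by (auto simp: \<rho>_def)
  have n: "0 \<le> n" by (simp add: n_def)
  have \<beta>0: "0 \<le> \<beta>" unfolding \<beta>_def by (rule barrier_beta_nonneg[OF R(1) n])
  have \<alpha>0: "0 < \<alpha>" unfolding \<alpha>_def by (rule barrier_alpha_pos[OF R(1) n])
  have \<alpha>: "\<alpha> = \<beta> * \<delta> + 1 / \<delta>" by (simp add: \<alpha>_def \<beta>_def \<delta>_def barrier_alpha_def)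
  have \<beta>\<theta>: "\<beta> * \<theta> = K / \<delta> + 4 * n * K / \<rho>\<^sup>2 + K + 1"
    using theta_pos by (simp add: \<beta>_def \<delta>_def \<rho>_def barrier_beta_def)
  define U where "U = ball x0 R \<inter> {x. 0 < x $ k}"
  have U: "open U" "U \<subseteq> \<Omega>" and v: "Ck_on_open (Suc (Suc (Suc 0))) U v"
    using eq unfolding eigen_eq_def U_def by auto
  note v1 = Ck_pd[OF v U(1)]
  \<comment> \<open>The sign \<open>\<sigma>\<close> treats \<open>v\<close> and \<open>- v\<close> at the same time.\<close>
  have main: "\<sigma> * v x \<le> \<alpha> * lam * M * x $ k" if \<sigma>: "\<bar>\<sigma>\<bar> = 1" for \<sigma> :: real
  proof -
    define \<phi> where "\<phi> z = M * ((\<alpha> * lam * z $ k - \<beta> * lam\<^sup>2 * (z $ k)\<^sup>2) + (1 / \<rho>\<^sup>2) * (\<Sum>i\<in>UNIV. (z $ i - x $ i)\<^sup>2))"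
      for z :: "real^'n"
    define \<phi>1 where "\<phi>1 i z = M * ((\<alpha> * lam * (if i = k then 1 else 0)
        - \<beta> * lam\<^sup>2 * (2 * z $ k * (if i = k then 1 else 0))) + (2 / \<rho>\<^sup>2) * (z $ i - x $ i))"
      for i and z :: "real^'n"
    define \<phi>2 where "\<phi>2 i j = M * ((0 - 2 * \<beta> * lam\<^sup>2 * ((if i = k then 1 else 0) * (if j = k then 1 else 0)))
         + (2 / \<rho>\<^sup>2) * (if j = i then 1 else 0))"
      for i j :: 'n
    have \<phi>d: "\<phi> z = M * ((\<alpha> * lam * z $ k - \<beta> * lam\<^sup>2 * (z $ k)\<^sup>2) + (1 / \<rho>\<^sup>2) * (dist x z)\<^sup>2)" for z
      unfolding \<phi>_def sum_squares_eq_dist ..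
    have coord: "has_grad (\<lambda>z. z $ i - x $ i) (\<lambda>j. if j = i then 1 else 0) z" for i z
      using has_grad_diff[OF has_grad_coord[of i z] has_grad_const[of "x $ i" z]] by simp
    have \<phi>g: "has_grad \<phi> (\<lambda>i. \<phi>1 i z) z" for z
    proof -
      have "has_grad \<phi> (\<lambda>j. M * ((\<alpha> * lam * (if j = k then 1 else 0) - \<beta> * lam\<^sup>2 * (2 * z $ k * (if j = k then 1 else 0)))
          + (1 / \<rho>\<^sup>2) * (\<Sum>i\<in>UNIV. 2 * (z $ i - x $ i) * (if j = i then 1 else 0)))) z"
        unfolding \<phi>_def
        by (intro has_grad_diff has_grad_add has_grad_cmult has_grad_sum has_grad_power2 has_grad_coord coord)
      then show ?thesis
        by (rule has_grad_eq) (simp add: \<phi>1_def if_distrib[of "\<lambda>z. _ * z"] cong: if_cong)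
    qed
    have \<phi>1g: "has_grad (\<phi>1 i) (\<lambda>j. \<phi>2 i j) z" for i z
    proof -
      have eq': "\<phi>1 i = (\<lambda>z. M * ((\<alpha> * lam * (if i = k then 1 else 0)
        - (2 * \<beta> * lam\<^sup>2 * (if i = k then 1 else 0)) * z $ k) + (2 / \<rho>\<^sup>2) * (z $ i - x $ i)))"
        by (rule ext) (simp add: \<phi>1_def)
      have "has_grad (\<phi>1 i) (\<lambda>j. M * ((0 - (2 * \<beta> * lam\<^sup>2 * (if i = k then 1 else 0)) * (if j = k then 1 else 0))
         + (2 / \<rho>\<^sup>2) * (if j = i then 1 else 0))) z"
        unfolding eq'
        by (intro has_grad_diff has_grad_add has_grad_cmult has_grad_const has_grad_coord coord)
      then show ?thesis
        by (rule has_grad_eq) (simp add: \<phi>2_def)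
    qed
    define f where "f z = \<sigma> * v z - \<phi> z" for z
    define D where "D = cball x \<rho> \<inter> {z. 0 \<le> z $ k} \<inter> {z. z $ k \<le> \<delta> / lam}"
    have Dsub: "D \<subseteq> ball x0 R \<inter> half_space k"
    proof
      fix z assume z: "z \<in> D"
      have "dist x0 z \<le> dist x0 x + dist x z" by (rule dist_triangle)
      also have "\<dots> < R" using z x(1) R by (simp add: D_def \<rho>_def)
      finally show "z \<in> ball x0 R \<inter> half_space k" using z by (simp add: D_def half_space_def)
    qed
    have "compact D"
      unfolding D_def
      by (intro compact_Int_closed compact_cball closed_Collect_le continuous_intros)
    moreover have xD: "x \<in> D" using x \<rho> by (simp add: D_def \<delta>_def)
    moreover have "continuous_on D f"
    proof -
      have "continuous_on D \<phi>"
        using has_grad_isCont[OF \<phi>g] by (intro continuous_at_imp_continuous_on) blast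
      then show ?thesis
        unfolding f_def by (intro continuous_intros continuous_on_subset[OF cont Dsub])
    qed
    ultimately obtain z where z: "z \<in> D" "\<And>y. y \<in> D \<Longrightarrow> f y \<le> f z"
      using continuous_attains_sup[of D f] by blast
    have zb: "z \<in> ball x0 R" "z \<in> half_space k" using z(1) Dsub by auto
    have "\<bar>\<sigma> * v z\<bar> \<le> M" using bound[of z] zb \<sigma> by (simp add: abs_mult)
    then have vz: "\<sigma> * v z \<le> M" by linarith
    have zk: "0 \<le> z $ k" "z $ k \<le> \<delta> / lam" "dist x z \<le> \<rho>" using z(1) by (auto simp: D_def)
    have lz: "0 \<le> lam * z $ k" "lam * z $ k \<le> \<delta>"
      using zk lam by (auto simp: pos_le_divide_eq mult_ac)
    have quad: "0 \<le> \<alpha> * lam * z $ k - \<beta> * lam\<^sup>2 * (z $ k)\<^sup>2"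
    proof -
      have "\<beta> * (lam * z $ k) * (lam * z $ k) \<le> \<beta> * (lam * z $ k) * \<delta>"
        using lz \<beta>0 by (intro mult_left_mono) auto
      also have "\<dots> = (\<beta> * \<delta>) * (lam * z $ k)" by simp
      also have "\<dots> \<le> \<alpha> * (lam * z $ k)"
        using lz \<delta> unfolding \<alpha> by (intro mult_right_mono) auto
      finally show ?thesis by (simp add: power2_eq_square mult_ac)
    qed
    have "f z \<le> 0"
    proof (rule ccontr)
      assume "\<not> f z \<le> 0"
      then have fz: "\<phi> z < \<sigma> * v z" by (simp add: f_def)
      \<comment> \<open>A positive maximum of \<open>\<sigma> v - \<phi>\<close> is not attained on any of the three parts of the boundary of \<open>D\<close>.\<close>
      have nz: "z $ k \<noteq> 0"
      proof
        assume "z $ k = 0"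
        moreover have "0 \<le> \<phi> z" unfolding \<phi>d using quad M by (intro mult_nonneg_nonneg add_nonneg_nonneg) auto
        ultimately show False using fz zero[OF zb(1)] by simp
      qed
      have nk: "z $ k \<noteq> \<delta> / lam"
      proof
        assume "z $ k = \<delta> / lam"
        then have e: "lam * z $ k = \<delta>" using lam by simp
        have "\<alpha> * lam * z $ k - \<beta> * lam\<^sup>2 * (z $ k)\<^sup>2 = \<alpha> * (lam * z $ k) - \<beta> * (lam * z $ k)\<^sup>2"
          by (simp add: power_mult_distrib)
        also have "\<dots> = 1"
          unfolding e \<alpha> using \<delta> by (simp add: field_simps power2_eq_square)
        finally have "M * 1 \<le> \<phi> z" unfolding \<phi>d using M by (intro mult_left_mono) auto
        then show False using fz vz by simp
      qed
      have nd: "dist x z \<noteq> \<rho>"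
      proof
        assume "dist x z = \<rho>"
        then have "M * 1 \<le> \<phi> z" unfolding \<phi>d using M quad \<rho> by (intro mult_left_mono) auto
        then show False using fz vz by simp
      qed
      define W where "W = ball x \<rho> \<inter> {z. 0 < z $ k} \<inter> {z. z $ k < \<delta> / lam}"
      have W: "open W" "z \<in> W" "W \<subseteq> D" "W \<subseteq> U"
      proof -
        show "open W" unfolding W_def
          by (intro open_Int open_ball open_Collect_less continuous_intros)
        show "z \<in> W" using zk nz nk nd by (auto simp: W_def)
        show "W \<subseteq> D" by (auto simp: W_def D_def)
        then show "W \<subseteq> U" using Dsub by (auto simp: W_def U_def)
      qed
      have zU: "z \<in> U" and zO: "z \<in> \<Omega>" using W U by auto
      have f1: "has_grad f (\<lambda>i. \<sigma> * pd i v y - \<phi>1 i y) y" if "y \<in> W" for y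
        unfolding f_def
        by (intro has_grad_diff has_grad_cmult \<phi>g Ck_has_grad[OF v U(1)]) (use that W in blast)
      have f2: "has_grad (\<lambda>y. \<sigma> * pd i v y - \<phi>1 i y) (\<lambda>j. \<sigma> * pd j (pd i v) z - \<phi>2 i j) z" for i
        by (intro has_grad_diff has_grad_cmult \<phi>1g Ck_has_grad[OF v1 U(1) zU])
      have mx: "f y \<le> f z" if "y \<in> W" for y using z(2) that W by blast
      note M1 = interior_max_elliptic[where W=W and a="\<lambda>i j. a i j z",
            OF W(1,2) f1 f2 mx sym[OF zO] psd[OF zO]]
      have m1: "\<sigma> * pd i v z = \<phi>1 i z" for i using M1(1)[of i] by simp
      have "(\<Sum>i\<in>UNIV. \<Sum>j\<in>UNIV. a i j z * (\<sigma> * pd j (pd i v) z)) - (\<Sum>i\<in>UNIV. \<Sum>j\<in>UNIV. a i j z * \<phi>2 i j) \<le> 0"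
        using M1(2) by (simp add: right_diff_distrib sum_subtractf)
      moreover have "(\<Sum>i\<in>UNIV. \<Sum>j\<in>UNIV. a i j z * (\<sigma> * pd j (pd i v) z)) + (\<Sum>j\<in>UNIV. b j z * (\<sigma> * pd j v z))
        = \<sigma> * ((\<Sum>i\<in>UNIV. \<Sum>j\<in>UNIV. a i j z * pd j (pd i v) z) + (\<Sum>j\<in>UNIV. b j z * pd j v z))"
        by (simp add: distrib_left sum_distrib_left mult_ac)
      moreover have "(\<Sum>i\<in>UNIV. \<Sum>j\<in>UNIV. a i j z * pd j (pd i v) z) + (\<Sum>j\<in>UNIV. b j z * pd j v z) = - (lam\<^sup>2) * (r z * v z)"
        using eq zU unfolding eigen_eq_def U_def by blast
      ultimately have "\<sigma> * (- (lam\<^sup>2) * (r z * v z)) \<le> (\<Sum>i\<in>UNIV. \<Sum>j\<in>UNIV. a i j z * \<phi>2 i j) + (\<Sum>j\<in>UNIV. b j z * \<phi>1 j z)"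
        unfolding m1 by simp
      moreover have "- (lam\<^sup>2 * (K * M)) \<le> \<sigma> * (- (lam\<^sup>2) * (r z * v z))"
      proof -
        have "\<bar>\<sigma> * (lam\<^sup>2 * (r z * v z))\<bar> = lam\<^sup>2 * (\<bar>r z\<bar> * \<bar>v z\<bar>)"
          using \<sigma> by (simp add: abs_mult)
        also have "\<dots> \<le> lam\<^sup>2 * (K * M)"
          using bound[of z] zb r_bound[OF zO] K_nonneg by (intro mult_left_mono mult_mono) auto
        finally show ?thesis by (simp add: abs_le_iff)
      qed
      moreover have "(\<Sum>i\<in>UNIV. \<Sum>j\<in>UNIV. a i j z * \<phi>2 i j)
         = M * (- (2 * \<beta> * lam\<^sup>2 * a k k z) + 2 / \<rho>\<^sup>2 * (\<Sum>i\<in>UNIV. a i i z))"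
      proof -
        have "(\<Sum>i\<in>UNIV. \<Sum>j\<in>UNIV. a i j z * \<phi>2 i j)
          = (\<Sum>i\<in>UNIV. \<Sum>j\<in>UNIV. (- (M * 2 * \<beta> * lam\<^sup>2)) * (a i j z * ((if i = k then 1 else 0) * (if j = k then 1 else 0)))
              + (M * 2 / \<rho>\<^sup>2) * (a i j z * (if j = i then 1 else 0)))"
          unfolding \<phi>2_def by (intro sum.cong refl) (simp add: algebra_simps)
        also have "\<dots> = (- (M * 2 * \<beta> * lam\<^sup>2)) * a k k z + (M * 2 / \<rho>\<^sup>2) * (\<Sum>i\<in>UNIV. a i i z)"
          unfolding sum.distrib sum_distrib_left[symmetric]
          by (simp add: if_distrib[of "\<lambda>z. _ * z"] if_distrib[of "\<lambda>z. z * _"] cong: if_cong)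
        finally show ?thesis by (simp add: algebra_simps)
      qed
      moreover have "(\<Sum>j\<in>UNIV. b j z * \<phi>1 j z)
         = M * (\<alpha> * lam * b k z - 2 * \<beta> * lam\<^sup>2 * z $ k * b k z + 2 / \<rho>\<^sup>2 * (\<Sum>j\<in>UNIV. b j z * (z $ j - x $ j)))"
      proof -
        have alg: "bb * (M * ((A * d - B * (2 * zz * d)) + (2 / \<rho>\<^sup>2) * w))
            = (M * (A - 2 * B * zz)) * (bb * d) + (M * 2 / \<rho>\<^sup>2) * (bb * w)" for bb A d B zz w
          by (simp add: algebra_simps)
        have "(\<Sum>j\<in>UNIV. b j z * \<phi>1 j z)
          = (\<Sum>j\<in>UNIV. (M * (\<alpha> * lam - 2 * (\<beta> * lam\<^sup>2) * z $ k)) * (b j z * (if j = k then 1 else 0))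
              + (M * 2 / \<rho>\<^sup>2) * (b j z * (z $ j - x $ j)))"
          unfolding \<phi>1_def by (intro sum.cong refl alg)
        also have "\<dots> = (M * (\<alpha> * lam - 2 * (\<beta> * lam\<^sup>2) * z $ k)) * b k z + (M * 2 / \<rho>\<^sup>2) * (\<Sum>j\<in>UNIV. b j z * (z $ j - x $ j))"
          unfolding sum.distrib sum_distrib_left[symmetric]
          by (simp add: if_distrib[of "\<lambda>z. _ * z"] cong: if_cong)
        finally show ?thesis by (simp add: algebra_simps)
      qed
      ultimately have "M * (- (lam\<^sup>2 * K)) \<le> M * ((- (2 * \<beta> * lam\<^sup>2 * a k k z) + 2 / \<rho>\<^sup>2 * (\<Sum>i\<in>UNIV. a i i z))
         + (\<alpha> * lam * b k z - 2 * \<beta> * lam\<^sup>2 * z $ k * b k z + 2 / \<rho>\<^sup>2 * (\<Sum>j\<in>UNIV. b j z * (z $ j - x $ j))))"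
        unfolding distrib_left[of M "- _ + _"] by (simp add: mult_ac)
      then have fin: "- (lam\<^sup>2 * K) \<le> (- (2 * \<beta> * lam\<^sup>2 * a k k z) + 2 / \<rho>\<^sup>2 * (\<Sum>i\<in>UNIV. a i i z))
         + (\<alpha> * lam * b k z - 2 * \<beta> * lam\<^sup>2 * z $ k * b k z + 2 / \<rho>\<^sup>2 * (\<Sum>j\<in>UNIV. b j z * (z $ j - x $ j)))"
        using M by (simp only: mult_le_cancel_left_pos)
      have l2: "lam \<le> lam\<^sup>2" "1 \<le> lam\<^sup>2" "0 \<le> lam\<^sup>2"
        using lam self_le_power[of lam 2] one_le_power[of lam 2] by auto
      have E1: "2 * \<beta> * lam\<^sup>2 * \<theta> \<le> 2 * \<beta> * lam\<^sup>2 * a k k z"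
        using diagonal_ge_theta[OF zO] \<beta>0 by (intro mult_left_mono) auto
      have E2: "2 / \<rho>\<^sup>2 * (\<Sum>i\<in>UNIV. a i i z) \<le> 2 / \<rho>\<^sup>2 * (n * K)"
      proof (rule mult_left_mono)
        have "(\<Sum>i\<in>UNIV. a i i z) \<le> (\<Sum>i\<in>(UNIV::'n set). K)"
          using a_bound[OF zO] by (intro sum_mono) (simp add: abs_le_iff)
        then show "(\<Sum>i\<in>UNIV. a i i z) \<le> n * K" by (simp add: n_def)
      qed simp
      have E3: "2 / \<rho>\<^sup>2 * (\<Sum>j\<in>UNIV. b j z * (z $ j - x $ j)) \<le> 2 / \<rho>\<^sup>2 * (n * K)"
      proof (rule mult_left_mono)
        have "b j z * (z $ j - x $ j) \<le> K" for j
        proof -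
          have "\<bar>b j z * (z $ j - x $ j)\<bar> \<le> K * 1"
            unfolding abs_mult using b_bound[OF zO] abs_component_le_dist[of z j x] zk(3) \<rho> K_nonneg
            by (intro mult_mono) auto
          then show ?thesis by simp
        qed
        then have "(\<Sum>j\<in>UNIV. b j z * (z $ j - x $ j)) \<le> (\<Sum>j\<in>(UNIV::'n set). K)"
          by (intro sum_mono)
        then show "(\<Sum>j\<in>UNIV. b j z * (z $ j - x $ j)) \<le> n * K" by (simp add: n_def)
      qed simp
      have bk: "b k z \<le> K" "- b k z \<le> K" using b_bound[OF zO, of k] by auto
      have E4: "\<alpha> * lam * b k z \<le> \<alpha> * lam\<^sup>2 * K"
      proof -
        have "\<alpha> * lam * b k z \<le> \<alpha> * lam * K" using \<alpha>0 lam bk by (intro mult_left_mono) auto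
        also have "\<dots> \<le> \<alpha> * lam\<^sup>2 * K" using \<alpha>0 l2 K_nonneg by (intro mult_right_mono mult_left_mono) auto
        finally show ?thesis .
      qed
      have E5: "- (2 * \<beta> * lam\<^sup>2 * z $ k * b k z) \<le> 2 * \<beta> * lam\<^sup>2 * \<delta> * K"
      proof -
        have "z $ k * (- b k z) \<le> \<delta> * K"
        proof -
          have "z $ k \<le> \<delta>" using lz zk lam mult_right_mono[of 1 lam "z $ k"] by linarith
          have "z $ k * (- b k z) \<le> z $ k * K" using zk bk by (intro mult_left_mono) auto
          also have "\<dots> \<le> \<delta> * K" using \<open>z $ k \<le> \<delta>\<close> K_nonneg by (intro mult_right_mono)
          finally show ?thesis .
        qed
        then have "(2 * \<beta> * lam\<^sup>2) * (z $ k * (- b k z)) \<le> (2 * \<beta> * lam\<^sup>2) * (\<delta> * K)"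
          using \<beta>0 by (intro mult_left_mono) auto
        then show ?thesis by (simp add: mult_ac)
      qed
      have "4 * n * K / \<rho>\<^sup>2 \<le> lam\<^sup>2 * (4 * n * K / \<rho>\<^sup>2)"
        using mult_right_mono[OF l2(2), of "4 * n * K / \<rho>\<^sup>2"] K_nonneg n by simp
      moreover have "2 / \<rho>\<^sup>2 * (n * K) + 2 / \<rho>\<^sup>2 * (n * K) = 4 * n * K / \<rho>\<^sup>2" by simp
      ultimately have "- (lam\<^sup>2 * K) \<le> - (2 * \<beta> * lam\<^sup>2 * \<theta>) + lam\<^sup>2 * (4 * n * K / \<rho>\<^sup>2) + \<alpha> * lam\<^sup>2 * K + 2 * \<beta> * lam\<^sup>2 * \<delta> * K"
        using fin E1 E2 E3 E4 E5 by linarith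
      then have "lam\<^sup>2 * (- K) \<le> lam\<^sup>2 * (- (2 * \<beta> * \<theta>) + 4 * n * K / \<rho>\<^sup>2 + \<alpha> * K + 2 * \<beta> * \<delta> * K)"
        by (simp add: algebra_simps)
      then have "- K \<le> - (2 * \<beta> * \<theta>) + 4 * n * K / \<rho>\<^sup>2 + \<alpha> * K + 2 * \<beta> * \<delta> * K"
        by (rule mult_left_le_imp_le) (use l2 in linarith)
      moreover have "\<alpha> * K = \<beta> * \<delta> * K + K / \<delta>" unfolding \<alpha> by (simp add: distrib_right)
      moreover have "\<beta> * (3 * \<delta> * K) \<le> \<beta> * \<theta>" by (rule mult_left_mono[OF \<delta>(3) \<beta>0])
      ultimately show False using \<beta>\<theta> by (simp add: algebra_simps)
    qed
    then have "f x \<le> 0" using z(2)[OF xD] by simp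
    then have "\<sigma> * v x \<le> M * (\<alpha> * lam * x $ k - \<beta> * lam\<^sup>2 * (x $ k)\<^sup>2)"
      by (simp add: f_def \<phi>d)
    also have "\<dots> \<le> M * (\<alpha> * lam * x $ k)"
      using M \<beta>0 by (intro mult_left_mono) auto
    finally show ?thesis by (simp add: mult_ac)
  qed
  show ?thesis
    using main[of 1] main[of "-1"] unfolding \<alpha>_def by (simp add: abs_le_iff)
qed

end

section \<open>The local estimate up to the boundary\<close>

text \<open>The constant of the combined estimate. The first summand comes from points near the boundary, the
  other two from the remaining points.\<close>

definition half_ball_C :: "real \<Rightarrow> real \<Rightarrow> real \<Rightarrow> real \<Rightarrow> real" where
  "half_ball_C n \<theta> K R = bernstein_C n \<theta> K *
     (32 * (barrier_alpha n \<theta> K R)\<^sup>2 + 1 + 16 / (barrier_delta \<theta> K R)\<^sup>2)"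

text \<open>At \<open>y\<close> Bernstein's estimate is applied on a ball of radius \<open>s = y\<^sub>k / 2\<close> if \<open>y\<^sub>k \<le> \<delta> / (2 lam)\<close>; there the barrier gives
  \<open>|v| \<le> 4 \<alpha> lam M s\<close>, which compensates for the factor \<open>1 / s\<^sup>2\<close>. Otherwise the radius is \<open>\<delta> / (4 lam)\<close>.\<close>

lemma (in elliptic_operator) half_ball_gradient_bound:
  fixes v :: "real^'n \<Rightarrow> real"
  assumes R: "0 < R" "R \<le> 1" "ball x0 R \<subseteq> \<Omega>" and lam: "1 \<le> lam"
    and eq: "eigen_eq lam (ball x0 R \<inter> {x. 0 < x $ k}) v"
    and cont: "continuous_on (ball x0 R \<inter> half_space k) v"
    and zero: "\<And>x. x \<in> ball x0 R \<Longrightarrow> x $ k = 0 \<Longrightarrow> v x = 0"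
    and bound: "\<And>x. x \<in> ball x0 R \<inter> half_space k \<Longrightarrow> \<bar>v x\<bar> \<le> M"
    and M: "0 < M"
    and y: "y \<in> ball x0 (R / 4)" "0 < y $ k"
  shows "(\<Sum>i\<in>UNIV. (pd i v y)\<^sup>2) \<le> half_ball_C (real CARD('n)) \<theta> K R * (lam * M)\<^sup>2"
proof -
  define n where "n = real CARD('n)"
  define \<delta> where "\<delta> = barrier_delta \<theta> K R"
  define \<alpha> where "\<alpha> = barrier_alpha n \<theta> K R"
  define B where "B = bernstein_C n \<theta> K"
  have \<delta>: "0 < \<delta>" "\<delta> \<le> R / 4"
    using barrier_delta_bounds[OF R(1)] by (auto simp: \<delta>_def)
  have B0: "0 \<le> B" unfolding B_def n_def using theta_pos K_nonneg by (intro bernstein_C_nonneg) auto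
  have \<alpha>0: "0 < \<alpha>" unfolding \<alpha>_def n_def by (rule barrier_alpha_pos[OF R(1)]) simp
  have dl: "\<delta> / lam \<le> \<delta>" "0 < \<delta> / lam" using \<delta> lam by (auto simp: field_simps)
  have small: "cball y s \<subseteq> ball x0 (R / 2) \<inter> {x. 0 < x $ k}" if s: "s \<le> \<delta> / 4" "s < y $ k" for s
  proof
    fix x assume x: "x \<in> cball y s"
    have "dist x0 x \<le> dist x0 y + dist y x" by (rule dist_triangle)
    also have "\<dots> < R / 2" using x y(1) s \<delta> by simp
    finally have "x \<in> ball x0 (R / 2)" by simp
    moreover have "0 < x $ k" using abs_component_le_dist[of x k y] x s by simp
    ultimately show "x \<in> ball x0 (R / 2) \<inter> {x. 0 < x $ k}" by simp
  qed
  have half: "ball x0 (R / 2) \<subseteq> ball x0 R" using R by (intro subset_ball) simp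
  have "(\<Sum>i\<in>UNIV. (pd i v y)\<^sup>2) \<le> B * (32 * \<alpha>\<^sup>2 + 1 + 16 / \<delta>\<^sup>2) * (lam * M)\<^sup>2"
  proof (cases "y $ k \<le> \<delta> / (2 * lam)")
    case True
    define s where "s = y $ k / 2"
    have s: "0 < s" "s \<le> \<delta> / lam / 4" using y True by (auto simp: s_def)
    have s': "s \<le> \<delta> / 4"
      by (rule order_trans[OF s(2) divide_right_mono[OF dl(1)]]) simp
    define m where "m = 4 * \<alpha> * lam * M * s"
    have sub: "cball y s \<subseteq> ball x0 (R / 2) \<inter> {x. 0 < x $ k}"
      by (rule small) (use s' y in \<open>auto simp: s_def\<close>)
    have "(\<Sum>i\<in>UNIV. (pd i v y)\<^sup>2) \<le> B * (lam\<^sup>2 + 1 / s\<^sup>2) * m\<^sup>2"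
      unfolding B_def n_def
    proof (rule interior_gradient_bound[OF eq])
      show "cball y s \<subseteq> ball x0 R \<inter> {x. 0 < x $ k}" using sub half by blast
      show "0 < s" "s \<le> 1" using s s' \<delta> R by auto
      fix x assume x: "x \<in> cball y s"
      have xk: "x $ k \<le> 3 * s" using abs_component_le_dist[of x k y] x by (simp add: s_def)
      have "\<bar>v x\<bar> \<le> \<alpha> * lam * M * x $ k"
        unfolding \<alpha>_def n_def
      proof (rule boundary_barrier[OF R lam eq cont zero bound M])
        show "x \<in> ball x0 (R / 2)" "0 < x $ k" using sub x by auto
        show "x $ k \<le> barrier_delta \<theta> K R / lam" using xk s unfolding \<delta>_def by simp
      qed auto
      also have "\<dots> \<le> \<alpha> * lam * M * (4 * s)"
        using xk s \<alpha>0 lam M by (intro mult_left_mono) auto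
      finally show "\<bar>v x\<bar> \<le> m" by (simp add: m_def mult_ac)
    qed
    also have "(lam\<^sup>2 + 1 / s\<^sup>2) * m\<^sup>2 = 16 * \<alpha>\<^sup>2 * (lam * M)\<^sup>2 * ((lam * s)\<^sup>2 + 1)"
      using s by (simp add: m_def power_mult_distrib field_simps)
    then have "B * (lam\<^sup>2 + 1 / s\<^sup>2) * m\<^sup>2 = B * (16 * \<alpha>\<^sup>2 * (lam * M)\<^sup>2 * ((lam * s)\<^sup>2 + 1))"
      by (simp add: mult.assoc)
    also have "\<dots> \<le> B * (16 * \<alpha>\<^sup>2 * (lam * M)\<^sup>2 * (1 + 1))"
    proof -
      have "lam * s \<le> 1"
      proof -
        have "lam * s \<le> lam * (\<delta> / lam / 4)" using s lam by (intro mult_left_mono) auto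
        also have "\<dots> = \<delta> / 4" using lam by simp
        finally show ?thesis using \<delta> R by simp
      qed
      then have "(lam * s)\<^sup>2 \<le> 1" using s lam by (simp add: power_le_one)
      then show ?thesis using B0 by (intro mult_left_mono add_right_mono) auto
    qed
    also have "\<dots> \<le> B * (32 * \<alpha>\<^sup>2 + 1 + 16 / \<delta>\<^sup>2) * (lam * M)\<^sup>2"
    proof -
      have "(32 * \<alpha>\<^sup>2) * (lam * M)\<^sup>2 \<le> (32 * \<alpha>\<^sup>2 + 1 + 16 / \<delta>\<^sup>2) * (lam * M)\<^sup>2"
        by (intro mult_right_mono) auto
      from mult_left_mono[OF this B0] show ?thesis by (simp add: mult_ac)
    qed
    finally show ?thesis .
  next
    case False
    define s where "s = \<delta> / (4 * lam)"
    have s: "0 < s" "s \<le> \<delta> / 4" using \<delta> lam dl by (auto simp: s_def field_simps)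
    have sy: "s < y $ k"
    proof -
      have "s \<le> \<delta> / (2 * lam)" unfolding s_def using \<delta> lam by (intro divide_left_mono) auto
      then show ?thesis using False by simp
    qed
    have sub: "cball y s \<subseteq> ball x0 (R / 2) \<inter> {x. 0 < x $ k}"
      by (rule small[OF s(2) sy])
    have "(\<Sum>i\<in>UNIV. (pd i v y)\<^sup>2) \<le> B * (lam\<^sup>2 + 1 / s\<^sup>2) * M\<^sup>2"
      unfolding B_def n_def
    proof (rule interior_gradient_bound[OF eq])
      show "cball y s \<subseteq> ball x0 R \<inter> {x. 0 < x $ k}" using sub half by blast
      show "0 < s" "s \<le> 1" using s \<delta> R by auto
      fix x assume "x \<in> cball y s"
      then have "x \<in> ball x0 R \<inter> {x. 0 < x $ k}" using sub half by blast
      then have "x \<in> ball x0 R \<inter> half_space k" by (auto simp: half_space_def)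
      then show "\<bar>v x\<bar> \<le> M" by (rule bound)
    qed
    also have "\<dots> = B * ((1 + 16 / \<delta>\<^sup>2) * (lam * M)\<^sup>2)"
      using \<delta> lam by (simp add: s_def power_mult_distrib field_simps)
    also have "\<dots> \<le> B * ((32 * \<alpha>\<^sup>2 + 1 + 16 / \<delta>\<^sup>2) * (lam * M)\<^sup>2)"
      using B0 by (intro mult_left_mono mult_right_mono) auto
    finally show ?thesis by (simp only: mult.assoc)
  qed
  then show ?thesis by (simp add: half_ball_C_def B_def \<alpha>_def \<delta>_def n_def)
qed

text \<open>The constant is the minimum of the quadratic forms over \<open>D\<close> times the unit sphere.\<close>

lemma uniform_ellipticity:
  fixes a :: "'n::finite \<Rightarrow> 'n \<Rightarrow> real^'n \<Rightarrow> real"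
  assumes D: "compact D" and cont: "\<And>i j. continuous_on D (a i j)"
    and pos: "\<And>x \<xi>. x \<in> D \<Longrightarrow> \<xi> \<noteq> 0 \<Longrightarrow> 0 < (\<Sum>i\<in>UNIV. \<Sum>j\<in>UNIV. a i j x * \<xi> $ i * \<xi> $ j)"
  shows "\<exists>\<theta>>0. \<forall>x\<in>D. \<forall>\<xi>. \<theta> * (\<Sum>i\<in>UNIV. (\<xi> i)\<^sup>2) \<le> (\<Sum>i\<in>UNIV. \<Sum>j\<in>UNIV. a i j x * \<xi> i * \<xi> j)"
proof (cases "D = {}")
  case False
  let ?S = "D \<times> sphere (0::real^'n) 1"
  let ?q = "\<lambda>p. \<Sum>i\<in>UNIV. \<Sum>j\<in>UNIV. a i j (fst p) * snd p $ i * snd p $ j"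
  have "compact ?S" using D by (intro compact_Times) auto
  moreover have "?S \<noteq> {}"
    using False norm_axis_1[of undefined] by (auto intro!: exI[of _ "axis undefined 1"])
  moreover have "continuous_on ?S ?q"
    by (intro continuous_intros continuous_on_compose2[OF cont]) auto
  ultimately obtain p where p: "p \<in> ?S" "\<And>p'. p' \<in> ?S \<Longrightarrow> ?q p \<le> ?q p'"
    using continuous_attains_inf[of ?S ?q] by blast
  have "snd p \<noteq> 0" using p(1) by (auto simp: mem_Times_iff)
  then have pq: "0 < ?q p" using pos[of "fst p" "snd p"] p(1) by (auto simp: mem_Times_iff)
  have "?q p * (\<Sum>i\<in>UNIV. (\<xi> i)\<^sup>2) \<le> (\<Sum>i\<in>UNIV. \<Sum>j\<in>UNIV. a i j x * \<xi> i * \<xi> j)" if x: "x \<in> D" for x \<xi>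
  proof (cases "(\<chi> i. \<xi> i) = (0::real^'n)")
    case True
    then show ?thesis by (simp add: vec_eq_iff)
  next
    case False
    define w :: "real^'n" where "w = (\<chi> i. \<xi> i)"
    have w: "norm w > 0" using False by (simp add: w_def)
    have nw: "(norm w)\<^sup>2 = (\<Sum>i\<in>UNIV. (\<xi> i)\<^sup>2)"
      by (simp add: w_def norm_vec_def L2_set_def sum_nonneg)
    have "?q p \<le> ?q (x, w /\<^sub>R norm w)" by (rule p(2)) (use x w in auto)
    also have "\<dots> = (\<Sum>i\<in>UNIV. \<Sum>j\<in>UNIV. (inverse (norm w))\<^sup>2 * (a i j x * \<xi> i * \<xi> j))"
      by (simp add: w_def power2_eq_square mult_ac)
    also have "\<dots> = (inverse (norm w))\<^sup>2 * (\<Sum>i\<in>UNIV. \<Sum>j\<in>UNIV. a i j x * \<xi> i * \<xi> j)"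
      by (simp only: sum_distrib_left)
    finally have "?q p * (norm w)\<^sup>2 \<le> (inverse (norm w))\<^sup>2 * (\<Sum>i\<in>UNIV. \<Sum>j\<in>UNIV. a i j x * \<xi> i * \<xi> j) * (norm w)\<^sup>2"
      by (rule mult_right_mono) simp
    also have "\<dots> = (\<Sum>i\<in>UNIV. \<Sum>j\<in>UNIV. a i j x * \<xi> i * \<xi> j)"
      using w by (simp add: field_simps)
    finally show ?thesis by (simp add: nw)
  qed
  then show ?thesis using pq by blast
qed (auto intro: exI[of _ 1])

text \<open>The local estimate for the equation in divergence form. The constants \<open>R\<close> and \<open>C\<close> depend only on the
  coefficients, which are defined on both sides of the hyperplane \<open>x\<^sub>k = 0\<close>; the solution is needed on one side only.\<close>

lemma local_gradient_estimate:
  fixes a :: "'n::finite \<Rightarrow> 'n \<Rightarrow> real^'n \<Rightarrow> real" and r :: "real^'n \<Rightarrow> real"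
  assumes W: "open W" "x0 \<in> W"
    and a: "\<And>i j. Ck_on_open (Suc (Suc 0)) W (a i j)" and r: "Ck_on_open (Suc 0) W r"
    and a_sym: "\<forall>x\<in>W. \<forall>i j. a i j x = a j i x"
    and pos: "\<forall>x\<in>W. \<forall>\<xi>. \<xi> \<noteq> 0 \<longrightarrow> 0 < (\<Sum>i\<in>UNIV. \<Sum>j\<in>UNIV. a i j x * \<xi> $ i * \<xi> $ j)"
  obtains R C where "0 < R" "0 < C" "ball x0 R \<subseteq> W"
    "\<And>lam v M y. \<lbrakk>1 \<le> lam; 0 < M; Ck_on_open (Suc (Suc (Suc 0))) (ball x0 R \<inter> {x. 0 < x $ k}) v;
       continuous_on (ball x0 R \<inter> half_space k) v;
       \<And>x. x \<in> ball x0 R \<Longrightarrow> x $ k = 0 \<Longrightarrow> v x = 0;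
       \<And>x. x \<in> ball x0 R \<inter> half_space k \<Longrightarrow> \<bar>v x\<bar> \<le> M;
       \<And>x. x \<in> ball x0 R \<inter> {x. 0 < x $ k} \<Longrightarrow>
          (\<Sum>i\<in>UNIV. \<Sum>j\<in>UNIV. pd i (\<lambda>x. a i j x * pd j v x) x) = - (lam\<^sup>2) * (r x * v x);
       y \<in> ball x0 (R / 4) \<inter> {x. 0 < x $ k}\<rbrakk> \<Longrightarrow> (\<Sum>i\<in>UNIV. (pd i v y)\<^sup>2) \<le> C * (lam * M)\<^sup>2"
proof -
  obtain R0 where R0: "R0 > 0" "cball x0 R0 \<subseteq> W" using W open_contains_cball by metis
  define R where "R = min R0 1"
  have R: "0 < R" "R \<le> 1" "cball x0 R \<subseteq> W" "ball x0 R \<subseteq> W"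
    using R0 by (auto simp: R_def)
  define b where "b j x = (\<Sum>i\<in>UNIV. pd i (a i j) x)" for j x
  have a1: "Ck_on_open (Suc 0) W (pd l (a i j))" for i j l by (rule Ck_pd[OF a W(1)])
  have a0: "Ck_on_open (Suc 0) W (a i j)" for i j by (rule Ck_Suc_imp[OF a])
  have b1: "Ck_on_open (Suc 0) W (b j)" for j
    unfolding b_def by (intro Ck_sum[OF W(1)] a1)
  \<comment> \<open>One continuous function that dominates all coefficients and their derivatives.\<close>
  define F where "F x = (\<Sum>i\<in>UNIV. \<Sum>j\<in>UNIV. \<bar>a i j x\<bar>) + (\<Sum>i\<in>UNIV. \<Sum>j\<in>UNIV. \<Sum>l\<in>UNIV. \<bar>pd l (a i j) x\<bar>)
     + (\<Sum>i\<in>UNIV. \<bar>b i x\<bar>) + (\<Sum>i\<in>UNIV. \<Sum>l\<in>UNIV. \<bar>pd l (b i) x\<bar>) + \<bar>r x\<bar> + (\<Sum>l\<in>UNIV. \<bar>pd l r x\<bar>)" for x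
  have "continuous_on W F"
    unfolding F_def
    by (intro continuous_intros Ck_continuous[OF a0] Ck_continuous[OF a1] Ck_continuous[OF b1]
        Ck_continuous[OF r] Ck_continuous[OF Ck_pd[OF b1 W(1)]] Ck_continuous[OF Ck_pd[OF r W(1)]])
  then have "compact (F ` cball x0 R)"
    by (meson R(3) compact_cball compact_continuous_image continuous_on_subset)
  then obtain K where K: "\<And>x. x \<in> cball x0 R \<Longrightarrow> norm (F x) \<le> K"
    using compact_imp_bounded by (fastforce simp: bounded_iff)
  have le1: "f i \<le> (\<Sum>i\<in>UNIV. f i)" if "\<And>i. 0 \<le> f i" for f :: "'n \<Rightarrow> real" and i
    using that by (intro member_le_sum) auto
  have le2: "f i j \<le> (\<Sum>i\<in>UNIV. \<Sum>j\<in>UNIV. f i j)" if "\<And>i j. 0 \<le> f i j" for f :: "'n \<Rightarrow> 'n \<Rightarrow> real" and i j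
    by (rule order_trans[OF le1[of "f i" j] le1[of "\<lambda>i. \<Sum>j\<in>UNIV. f i j" i]]) (auto intro: sum_nonneg that)
  have le3: "f i j l \<le> (\<Sum>i\<in>UNIV. \<Sum>j\<in>UNIV. \<Sum>l\<in>UNIV. f i j l)" if "\<And>i j l. 0 \<le> f i j l"
    for f :: "'n \<Rightarrow> 'n \<Rightarrow> 'n \<Rightarrow> real" and i j l
    by (rule order_trans[OF le1[of "f i j" l] le2[of "\<lambda>i j. \<Sum>l\<in>UNIV. f i j l" i j]]) (auto intro: sum_nonneg that)
  have bnds: "\<bar>a i j x\<bar> \<le> K" "\<bar>pd l (a i j) x\<bar> \<le> K" "\<bar>b i x\<bar> \<le> K" "\<bar>pd l (b i) x\<bar> \<le> K" "\<bar>r x\<bar> \<le> K" "\<bar>pd l r x\<bar> \<le> K"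
    if "x \<in> ball x0 R" for x i j l
  proof -
    have xK: "F x \<le> K" using K[of x] that by auto
    have nn: "0 \<le> (\<Sum>i\<in>UNIV. \<Sum>j\<in>UNIV. \<bar>a i j x\<bar>)" "0 \<le> (\<Sum>i\<in>UNIV. \<Sum>j\<in>UNIV. \<Sum>l\<in>UNIV. \<bar>pd l (a i j) x\<bar>)"
      "0 \<le> (\<Sum>i\<in>UNIV. \<bar>b i x\<bar>)" "0 \<le> (\<Sum>i\<in>UNIV. \<Sum>l\<in>UNIV. \<bar>pd l (b i) x\<bar>)" "0 \<le> \<bar>r x\<bar>" "0 \<le> (\<Sum>l\<in>UNIV. \<bar>pd l r x\<bar>)"
      by (intro sum_nonneg abs_ge_zero)+
    show "\<bar>a i j x\<bar> \<le> K" using le2[of "\<lambda>i j. \<bar>a i j x\<bar>" i j] nn xK unfolding F_def by linarith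
    show "\<bar>pd l (a i j) x\<bar> \<le> K" using le3[of "\<lambda>i j l. \<bar>pd l (a i j) x\<bar>" i j l] nn xK unfolding F_def by linarith
    show "\<bar>b i x\<bar> \<le> K" using le1[of "\<lambda>i. \<bar>b i x\<bar>" i] nn xK unfolding F_def by linarith
    show "\<bar>pd l (b i) x\<bar> \<le> K" using le2[of "\<lambda>i l. \<bar>pd l (b i) x\<bar>" i l] nn xK unfolding F_def by linarith
    show "\<bar>r x\<bar> \<le> K" using nn xK unfolding F_def by linarith
    show "\<bar>pd l r x\<bar> \<le> K" using le1[of "\<lambda>l. \<bar>pd l r x\<bar>" l] nn xK unfolding F_def by linarith
  qed
  have K0: "0 \<le> K" using bnds(5)[of x0] R by (smt (verit) abs_ge_zero centre_in_ball)
  have "\<exists>\<theta>>0. \<forall>x\<in>cball x0 R. \<forall>\<xi>. \<theta> * (\<Sum>i\<in>UNIV. (\<xi> i)\<^sup>2) \<le> (\<Sum>i\<in>UNIV. \<Sum>j\<in>UNIV. a i j x * \<xi> i * \<xi> j)"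
    by (rule uniform_ellipticity)
      (use R pos continuous_on_subset[OF Ck_continuous[OF a0] R(3)] in auto)
  then obtain \<theta> where \<theta>: "\<theta> > 0" "\<And>x \<xi>. x \<in> cball x0 R \<Longrightarrow> \<theta> * (\<Sum>i\<in>UNIV. (\<xi> i)\<^sup>2) \<le> (\<Sum>i\<in>UNIV. \<Sum>j\<in>UNIV. a i j x * \<xi> i * \<xi> j)"
    by blast
  interpret elliptic_operator "ball x0 R" a b r \<theta> K
  proof
    show "Ck_on_open (Suc 0) (ball x0 R) (a i j)" for i j by (rule Ck_subset[OF a0 W(1) open_ball R(4)])
    show "Ck_on_open (Suc 0) (ball x0 R) (b i)" for i by (rule Ck_subset[OF b1 W(1) open_ball R(4)])
    show "Ck_on_open (Suc 0) (ball x0 R) r" by (rule Ck_subset[OF r W(1) open_ball R(4)])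
    show "a i j x = a j i x" if "x \<in> ball x0 R" for x i j using a_sym that R by blast
    show "\<theta> * (\<Sum>i\<in>UNIV. (\<xi> i)\<^sup>2) \<le> (\<Sum>i\<in>UNIV. \<Sum>j\<in>UNIV. a i j x * \<xi> i * \<xi> j)" if "x \<in> ball x0 R" for x \<xi>
      using \<theta>(2)[of x \<xi>] that by auto
  qed (use bnds K0 \<theta> in auto)
  define C where "C = half_ball_C (real CARD('n)) \<theta> K R"
  have C: "0 \<le> C" unfolding C_def half_ball_C_def using \<theta> K0
    by (intro mult_nonneg_nonneg bernstein_C_nonneg add_nonneg_nonneg) auto
  have main: "(\<Sum>i\<in>UNIV. (pd i v y)\<^sup>2) \<le> (C + 1) * (lam * M)\<^sup>2"
    if lam: "1 \<le> lam" and M: "0 < M" and v: "Ck_on_open (Suc (Suc (Suc 0))) (ball x0 R \<inter> {x. 0 < x $ k}) v"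
      and cont: "continuous_on (ball x0 R \<inter> half_space k) v"
      and zero: "\<And>x. x \<in> ball x0 R \<Longrightarrow> x $ k = 0 \<Longrightarrow> v x = 0"
      and bound: "\<And>x. x \<in> ball x0 R \<inter> half_space k \<Longrightarrow> \<bar>v x\<bar> \<le> M"
      and eq: "\<And>x. x \<in> ball x0 R \<inter> {x. 0 < x $ k} \<Longrightarrow>
          (\<Sum>i\<in>UNIV. \<Sum>j\<in>UNIV. pd i (\<lambda>x. a i j x * pd j v x) x) = - (lam\<^sup>2) * (r x * v x)"
      and y: "y \<in> ball x0 (R / 4) \<inter> {x. 0 < x $ k}" for lam v M y
  proof -
    let ?U = "ball x0 R \<inter> {x. 0 < x $ k}"
    have U: "open ?U" by (intro open_Int open_ball open_Collect_less continuous_intros)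
    have "eigen_eq lam ?U v"
      unfolding eigen_eq_def
    proof (intro conjI ballI U v)
      fix x assume x: "x \<in> ?U"
      then have xW: "x \<in> W" using R by auto
      have "pd i (\<lambda>x. a i j x * pd j v x) x = a i j x * pd i (pd j v) x + pd i (a i j) x * pd j v x" for i j
        by (rule has_grad_imp_pd, intro has_grad_mult Ck_has_grad[OF a W(1) xW] Ck_has_grad[OF Ck_pd[OF v U] U x])
      then have "- (lam\<^sup>2) * (r x * v x) = (\<Sum>i\<in>UNIV. \<Sum>j\<in>UNIV. a i j x * pd i (pd j v) x)
          + (\<Sum>i\<in>UNIV. \<Sum>j\<in>UNIV. pd i (a i j) x * pd j v x)"
        using eq[OF x] by (simp add: sum.distrib)
      also have "(\<Sum>i\<in>UNIV. \<Sum>j\<in>UNIV. a i j x * pd i (pd j v) x) = (\<Sum>j\<in>UNIV. \<Sum>i\<in>UNIV. a j i x * pd i (pd j v) x)"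
        by (subst sum.swap) (simp add: a_sym[rule_format, OF xW])
      also have "(\<Sum>i\<in>UNIV. \<Sum>j\<in>UNIV. pd i (a i j) x * pd j v x) = (\<Sum>j\<in>UNIV. b j x * pd j v x)"
        unfolding b_def sum_distrib_right by (rule sum.swap)
      finally show "(\<Sum>i\<in>UNIV. \<Sum>j\<in>UNIV. a i j x * pd j (pd i v) x) + (\<Sum>j\<in>UNIV. b j x * pd j v x)
        = - (lam\<^sup>2) * (r x * v x)" by simp
    qed auto
    then have "(\<Sum>i\<in>UNIV. (pd i v y)\<^sup>2) \<le> C * (lam * M)\<^sup>2"
      unfolding C_def using half_ball_gradient_bound[OF R(1,2) subset_refl lam _ cont zero bound M] y by blast
    also have "\<dots> \<le> (C + 1) * (lam * M)\<^sup>2" by (intro mult_right_mono) auto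
    finally show ?thesis .
  qed
  show thesis
  proof (rule that[OF R(1) _ R(4)])
    show "0 < C + 1" using C by simp
  qed (rule main)
qed

section \<open>Positive definite matrices\<close>

text \<open>Symmetric positive definite matrices.\<close>

definition pos_def :: "real^'n^'n::finite \<Rightarrow> bool" where
  "pos_def M \<longleftrightarrow> transpose M = M \<and> (\<forall>v. v \<noteq> 0 \<longrightarrow> 0 < v \<bullet> (M *v v))"

lemma quadratic_form_sum:
  fixes M :: "real^'n^'n::finite"
  shows "v \<bullet> (M *v v) = (\<Sum>i\<in>UNIV. \<Sum>j\<in>UNIV. M $ i $ j * v $ i * v $ j)"
  by (simp add: inner_vec_def matrix_vector_mult_def sum_distrib_left mult_ac)

lemma positive_imp_det_nonzero:
  fixes M :: "real^'n^'n::finite"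
  assumes "\<And>v. v \<noteq> 0 \<Longrightarrow> 0 < v \<bullet> (M *v v)"
  shows "det M \<noteq> 0"
proof -
  have "\<exists>B. B ** M = mat 1"
    unfolding matrix_left_invertible_ker using assms by (metis inner_zero_right less_irrefl)
  then show ?thesis by (simp add: invertible_left_inverse flip: invertible_det_nz)
qed

text \<open>The determinant does not vanish on the segment from the identity to \<open>M\<close>.\<close>

lemma pos_def_det_pos:
  fixes M :: "real^'n^'n::finite"
  assumes "pos_def M"
  shows "0 < det M"
proof (rule ccontr)
  assume "\<not> 0 < det M"
  let ?P = "\<lambda>t::real. (\<chi> i j. (1 - t) * mat 1 $ i $ j + t * M $ i $ j) :: real^'n^'n"
  have P: "?P t *v v = (1 - t) *\<^sub>R v + t *\<^sub>R (M *v v)" for t v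
  proof -
    have "?P t = (1 - t) *\<^sub>R mat 1 + t *\<^sub>R M" by (simp add: vec_eq_iff)
    then show ?thesis by (simp add: matrix_vector_mult_add_rdistrib scaleR_matrix_vector_assoc[symmetric])
  qed
  have nz: "det (?P t) \<noteq> 0" if t: "0 \<le> t" "t \<le> 1" for t
  proof (rule positive_imp_det_nonzero)
    fix v :: "real^'n" assume v: "v \<noteq> 0"
    have 1: "0 < v \<bullet> (M *v v)" and 2: "0 < v \<bullet> v" using assms v by (auto simp: pos_def_def)
    have "0 < (1 - t) * (v \<bullet> v) + t * (v \<bullet> (M *v v))"
    proof (cases "t = 0")
      case False
      then have "0 < t * (v \<bullet> (M *v v))" using t 1 by simp
      moreover have "0 \<le> (1 - t) * (v \<bullet> v)" using t by simp
      ultimately show ?thesis by linarith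
    qed (use 2 in simp)
    then show "0 < v \<bullet> (?P t *v v)" unfolding P by (simp add: inner_add_right)
  qed
  have "continuous_on {0..1} (\<lambda>t. det (?P t))"
    unfolding det_def by (simp, intro continuous_intros)
  moreover have "det (?P 1) \<le> 0" "0 \<le> det (?P 0)"
    using \<open>\<not> 0 < det M\<close> by (simp_all add: vec_lambda_eta flip: mat_def)
  ultimately obtain t where "0 \<le> t" "t \<le> 1" "det (?P t) = 0"
    using IVT2'[of "\<lambda>t. det (?P t)" 1 0 0] by auto
  then show False using nz by blast
qed

lemma matrix_inv_right:
  fixes M :: "real^'n^'n::finite"
  assumes "det M \<noteq> 0"
  shows "M ** matrix_inv M = mat 1"
proof -
  have "invertible M" using assms by (simp add: invertible_det_nz)
  then show ?thesis unfolding invertible_def matrix_inv_def by (rule someI2_ex) simp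
qed

text \<open>The numerator in Cramer's rule for the entry \<open>i, j\<close> of the inverse. It is a polynomial in the entries
  of the matrix, which makes the entries of the inverse of a smooth matrix field smooth.\<close>

definition cramer_det :: "real^'n^'n::finite \<Rightarrow> 'n \<Rightarrow> 'n \<Rightarrow> real" where
  "cramer_det M i j = det ((\<chi> p q. if q = i then axis j 1 $ p else M $ p $ q) :: real^'n^'n)"

lemma matrix_inv_entry:
  fixes M :: "real^'n^'n::finite"
  assumes "det M \<noteq> 0"
  shows "matrix_inv M $ i $ j = cramer_det M i j / det M"
proof -
  have "M *v (matrix_inv M *v axis j 1) = axis j 1"
    by (simp add: matrix_vector_mul_assoc matrix_inv_right[OF assms])
  then have "matrix_inv M *v axis j 1
      = (\<chi> k. det ((\<chi> p q. if q = k then axis j 1 $ p else M $ p $ q) :: real^'n^'n) / det M)"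
    using cramer[OF assms] by blast
  then have "(matrix_inv M *v axis j 1) $ i = cramer_det M i j / det M"
    by (simp add: cramer_det_def)
  moreover have "(matrix_inv M *v axis j 1) $ i = matrix_inv M $ i $ j"
    by (simp add: matrix_vector_mul_component inner_axis)
  ultimately show ?thesis by simp
qed

lemma pos_def_matrix_inv:
  fixes M :: "real^'n^'n::finite"
  assumes "pos_def M"
  shows "pos_def (matrix_inv M)"
  unfolding pos_def_def
proof (intro conjI allI impI)
  have d: "det M \<noteq> 0" using pos_def_det_pos[OF assms] by simp
  have MI: "M ** matrix_inv M = mat 1" by (rule matrix_inv_right[OF d])
  have T: "transpose M = M" using assms by (simp add: pos_def_def)
  have "transpose (matrix_inv M) ** M = mat 1"
    using arg_cong[OF MI, of transpose] by (simp add: matrix_transpose_mul T)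
  then have "transpose (matrix_inv M) ** (M ** matrix_inv M) = matrix_inv M"
    by (simp add: matrix_mul_assoc)
  then show "transpose (matrix_inv M) = matrix_inv M" by (simp add: MI)
  fix v :: "real^'n" assume v: "v \<noteq> 0"
  let ?w = "matrix_inv M *v v"
  have Mw: "M *v ?w = v" by (simp add: matrix_vector_mul_assoc MI)
  then have "?w \<noteq> 0" using v by auto
  then have "0 < ?w \<bullet> (M *v ?w)" using assms by (simp add: pos_def_def)
  then show "0 < v \<bullet> ?w" by (simp only: Mw inner_commute)
qed

section \<open>Charts\<close>

lemma open_subset_half_space_pos:
  fixes y :: "real^'n::finite"
  assumes "open T" "T \<subseteq> half_space k" "y \<in> T"
  shows "0 < y $ k"
proof -
  obtain e where e: "e > 0" "ball y e \<subseteq> T" using assms open_contains_ball by metis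
  have "y - (e/2) *\<^sub>R axis k 1 \<in> ball y e" using e by (simp add: dist_norm)
  then have "y - (e/2) *\<^sub>R axis k 1 \<in> half_space k" using e assms(2) by blast
  then have "0 \<le> (y - (e/2) *\<^sub>R axis k 1) $ k" by (simp add: half_space_def)
  then show ?thesis using e by simp
qed

lemma open_positive_part:
  assumes "openin (top_of_set (half_space k)) S"
  shows "open (S \<inter> {x. 0 < x $ k})"
proof -
  obtain T where T: "open T" "S = half_space k \<inter> T" using assms openin_open by metis
  have "S \<inter> {x. 0 < x $ k} = T \<inter> {x. 0 < x $ k}" by (auto simp: T half_space_def)
  moreover have "open (T \<inter> {x. 0 < x $ k})"
    by (intro open_Int T open_Collect_less continuous_intros)
  ultimately show ?thesis by simp
qed

lemma smooth_on_extension: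
  assumes "smooth_on S f" "x \<in> S"
  obtains W F where "open W" "x \<in> W" "\<And>m. Ck_on_open m W F" "\<And>y. y \<in> S \<Longrightarrow> y \<in> W \<Longrightarrow> F y = f y"
proof -
  from bspec[OF assms(1)[unfolded smooth_on_def] assms(2)]
  obtain W F where "open W \<and> x \<in> W \<and> (\<forall>m. Ck_on_open m W F) \<and> (\<forall>y\<in>S \<inter> W. F y = f y)"
    by (elim exE)
  then show thesis by (intro that[of W F]) (simp_all add: Ball_def)
qed

lemma smooth_on_imp_Ck:
  assumes "smooth_on S f" "open V" "V \<subseteq> S"
  shows "Ck_on_open m V f"
proof (rule Ck_local[OF assms(2)])
  fix x assume "x \<in> V"
  then obtain W F where "open W" "x \<in> W" "\<And>m. Ck_on_open m W F" "\<And>y. y \<in> S \<Longrightarrow> y \<in> W \<Longrightarrow> F y = f y"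
    using smooth_on_extension[OF assms(1) subsetD[OF assms(3)]] by metis
  then show "\<exists>U F. open U \<and> x \<in> U \<and> Ck_on_open m U F \<and> (\<forall>y\<in>V \<inter> U. F y = f y)"
    using assms(3) by (intro exI[of _ W] exI[of _ F]) auto
qed

lemma smooth_on_continuous:
  assumes "smooth_on S f"
  shows "continuous_on S f"
  unfolding continuous_on_eq_continuous_within
proof
  fix x assume x: "x \<in> S"
  then obtain W F where W: "open W" "x \<in> W" "\<And>m. Ck_on_open m W F" "\<And>y. y \<in> S \<Longrightarrow> y \<in> W \<Longrightarrow> F y = f y"
    using smooth_on_extension[OF assms x] by metis
  have "isCont F x"
    using W Ck_continuous[of 0 W F] by (simp add: continuous_on_eq_continuous_at)
  then have "continuous (at x within S) F" by (rule continuous_at_imp_continuous_at_within)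
  moreover obtain d where "d > 0" "ball x d \<subseteq> W" using W open_contains_ball by metis
  ultimately show "continuous (at x within S) f"
    using W x by (intro continuous_transform_within[of x S F d f]) (auto simp: dist_commute subset_iff)
qed

context smooth_manifold_with_boundary
begin

lemma topspace_subtopology_chart:
  assumes "c \<in> A"
  shows "topspace (subtopology X (chart_dom c)) = chart_dom c"
  using openin_subset[OF chart_dom_open[OF assms]] by (simp add: Int_absorb1)

lemma chart_inj: "c \<in> A \<Longrightarrow> inj_on (chart_map c) (chart_dom c)"
  using chart_homeomorphism[of c] topspace_subtopology_chart
  by (simp add: homeomorphic_eq_everything_map)

lemma chart_inv_map: "c \<in> A \<Longrightarrow> p \<in> chart_dom c \<Longrightarrow> chart_inv c (chart_map c p) = p"
  by (simp add: chart_inv_def chart_inj inv_into_f_f)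

lemma chart_map_inv: "x \<in> chart_image c \<Longrightarrow> chart_map c (chart_inv c x) = x"
  by (simp add: chart_inv_def chart_image_def f_inv_into_f)

lemma chart_inv_dom: "x \<in> chart_image c \<Longrightarrow> chart_inv c x \<in> chart_dom c"
  by (simp add: chart_inv_def chart_image_def inv_into_into)

lemma chart_map_image: "p \<in> chart_dom c \<Longrightarrow> chart_map c p \<in> chart_image c"
  by (simp add: chart_image_def)

lemma chart_image_half_space: "c \<in> A \<Longrightarrow> chart_image c \<subseteq> half_space k"
  using openin_subset[OF chart_image_open] by simp

lemma chart_dom_topspace: "c \<in> A \<Longrightarrow> chart_dom c \<subseteq> topspace X"
  using charts_cover by blast

lemma chart_continuous:
  "c \<in> A \<Longrightarrow> continuous_map (subtopology X (chart_dom c)) (top_of_set (chart_image c)) (chart_map c)"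
  using chart_homeomorphism homeomorphic_imp_continuous_map by blast

lemma chart_inv_continuous:
  assumes c: "c \<in> A"
  shows "continuous_map (top_of_set (chart_image c)) (subtopology X (chart_dom c)) (chart_inv c)"
proof -
  obtain f where f: "homeomorphic_maps (subtopology X (chart_dom c)) (top_of_set (chart_image c)) (chart_map c) f"
    using chart_homeomorphism[OF c] homeomorphic_map_maps by blast
  have "f x = chart_inv c x" if x: "x \<in> chart_image c" for x
  proof -
    have "f (chart_map c (chart_inv c x)) = chart_inv c x"
      using f chart_inv_dom[OF x] topspace_subtopology_chart[OF c] by (simp add: homeomorphic_maps_def)
    then show ?thesis by (simp add: chart_map_inv x)
  qed
  moreover have "continuous_map (top_of_set (chart_image c)) (subtopology X (chart_dom c)) f"
    using f by (simp add: homeomorphic_maps_def)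
  ultimately show ?thesis
    by (elim continuous_map_eq) simp
qed

lemma chart_open_image:
  assumes c: "c \<in> A" and V: "openin X V" "V \<subseteq> chart_dom c"
  shows "openin (top_of_set (half_space k)) (chart_map c ` V)"
proof -
  have "openin (subtopology X (chart_dom c)) V"
    using V by (metis inf.absorb1 openin_subtopology_Int)
  then have "openin (top_of_set (chart_image c)) (chart_map c ` V)"
    using homeomorphic_imp_open_map[OF chart_homeomorphism[OF c]] by (simp add: open_map_def)
  then show ?thesis using chart_image_open[OF c] openin_trans by blast
qed

lemma overlap_open_image:
  "c \<in> A \<Longrightarrow> d \<in> A \<Longrightarrow> openin (top_of_set (half_space k)) (chart_map c ` (chart_dom c \<inter> chart_dom d))"
  by (rule chart_open_image) (auto intro: chart_dom_open)

text \<open>The transition map is injective and continuous on an open set, so by invariance of domain its image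
  is open. An open set inside the closed half space misses the boundary hyperplane.\<close>

lemma interior_coordinate_invariant:
  assumes c: "c \<in> A" and d: "d \<in> A" and p: "p \<in> chart_dom c" "p \<in> chart_dom d" and pos: "0 < chart_map c p $ k"
  shows "0 < chart_map d p $ k"
proof -
  define S where "S = chart_map c ` (chart_dom c \<inter> chart_dom d)"
  define P where "P = S \<inter> {x. 0 < x $ k}"
  have S: "S \<subseteq> chart_image c" by (auto simp: S_def chart_image_def)
  have inS: "chart_inv c x \<in> chart_dom c \<inter> chart_dom d" if "x \<in> S" for x
    using that chart_inv_map[OF c] by (auto simp: S_def)
  have P: "open P" unfolding P_def S_def by (intro open_positive_part overlap_open_image c d)
  let ?\<tau> = "\<lambda>x. chart_map d (chart_inv c x)"
  have "continuous_map (top_of_set S) (subtopology X (chart_dom c)) (chart_inv c)"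
    by (rule continuous_map_from_subtopology_mono[OF chart_inv_continuous[OF c] S])
  then have "continuous_map (top_of_set S) (subtopology X (chart_dom d)) (chart_inv c)"
    using inS by (auto simp: continuous_map_in_subtopology)
  then have "continuous_map (top_of_set S) (top_of_set (chart_image d)) (chart_map d \<circ> chart_inv c)"
    by (rule continuous_map_compose[OF _ chart_continuous[OF d]])
  then have "continuous_on S ?\<tau>"
    by (simp add: continuous_map_in_subtopology o_def)
  then have cont: "continuous_on P ?\<tau>" by (rule continuous_on_subset) (simp add: P_def)
  have inj: "inj_on ?\<tau> P"
  proof (rule inj_onI)
    fix x y assume x: "x \<in> P" and y: "y \<in> P" and e: "?\<tau> x = ?\<tau> y"
    have "chart_inv c x = chart_inv c y"
      using inj_onD[OF chart_inj[OF d] e] inS x y by (auto simp: P_def)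
    then show "x = y" using chart_map_inv S x y by (metis P_def IntD1 subsetD)
  qed
  have "open (?\<tau> ` P)" by (rule invariance_of_domain[OF cont P inj])
  moreover have "?\<tau> ` P \<subseteq> half_space k"
    using inS chart_image_half_space[OF d] by (auto simp: P_def chart_image_def)
  moreover have "chart_map d p \<in> ?\<tau> ` P"
  proof
    show "chart_map c p \<in> P" using p pos by (auto simp: P_def S_def)
    show "chart_map d p = ?\<tau> (chart_map c p)" using chart_inv_map[OF c p(1)] by simp
  qed
  ultimately show ?thesis by (rule open_subset_half_space_pos)
qed

lemma not_boundary_iff:
  assumes "c \<in> A" "p \<in> chart_dom c"
  shows "p \<notin> manifold_boundary A k \<longleftrightarrow> 0 < chart_map c p $ k"
proof
  assume "p \<notin> manifold_boundary A k"
  then have "chart_map c p $ k \<noteq> 0" using assms by (auto simp: manifold_boundary_def)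
  moreover have "0 \<le> chart_map c p $ k"
    using chart_image_half_space[OF assms(1)] chart_map_image[OF assms(2)] by (auto simp: half_space_def)
  ultimately show "0 < chart_map c p $ k" by simp
next
  assume "0 < chart_map c p $ k"
  then show "p \<notin> manifold_boundary A k"
    using interior_coordinate_invariant[OF assms(1) _ assms(2)] by (fastforce simp: manifold_boundary_def)
qed

text \<open>The open part of the image of a chart, which is the image of the interior points of the manifold in
  its domain.\<close>

definition chart_interior :: "('a, 'n) chart \<Rightarrow> (real^'n) set" where
  "chart_interior c = chart_image c \<inter> {x. 0 < x $ k}"

lemma open_chart_interior: "c \<in> A \<Longrightarrow> open (chart_interior c)"
  unfolding chart_interior_def by (intro open_positive_part chart_image_open)

lemma pderiv_within_chart_interior:
  "c \<in> A \<Longrightarrow> x \<in> chart_interior c \<Longrightarrow> pderiv_within (chart_image c) i f x = pd i f x"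
  unfolding pderiv_within_def pd_def
  by (subst at_within_open_subset[of x "chart_interior c" "chart_image c"])
    (auto simp: open_chart_interior, auto simp: chart_interior_def)

lemma manifold_boundary_null: "manifold_null A (manifold_boundary A k)"
  unfolding manifold_null_def
proof
  fix c assume c: "c \<in> A"
  have "chart_map c ` (manifold_boundary A k \<inter> chart_dom c) \<subseteq> {x. x $ k = 0}"
    using not_boundary_iff[OF c] chart_image_half_space[OF c] chart_map_image[of _ c]
    by (fastforce simp: half_space_def)
  then show "negligible (chart_map c ` (manifold_boundary A k \<inter> chart_dom c))"
    using negligible_standard_hyperplane_cart negligible_subset by blast
qed

lemma smooth_function_continuous:
  assumes "smooth_function A u" "c \<in> A"
  shows "continuous_on (chart_image c) (\<lambda>x. u (chart_inv c x))"
  using assms by (auto simp: smooth_function_def intro: smooth_on_continuous)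

lemma smooth_function_open_preimage:
  assumes u: "smooth_function A u" and c: "c \<in> A" and T: "open T"
  shows "openin X {p \<in> chart_dom c. u p \<in> T}"
proof -
  have "continuous_map (subtopology X (chart_dom c)) euclideanreal ((\<lambda>x. u (chart_inv c x)) \<circ> chart_map c)"
    by (rule continuous_map_compose[OF chart_continuous[OF c]])
      (simp add: smooth_function_continuous[OF u c])
  from openin_continuous_map_preimage[OF this, of T] T
  have "openin (subtopology X (chart_dom c))
      {p \<in> topspace (subtopology X (chart_dom c)). u (chart_inv c (chart_map c p)) \<in> T}"
    by simp
  moreover have "{p \<in> topspace (subtopology X (chart_dom c)). u (chart_inv c (chart_map c p)) \<in> T} = {p \<in> chart_dom c. u p \<in> T}"
    unfolding topspace_subtopology_chart[OF c] using chart_inv_map[OF c] by auto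
  ultimately show ?thesis using chart_dom_open[OF c] openin_trans_full by metis
qed

text \<open>A superlevel set of a continuous function is relatively open in the half space in each chart, and a
  nonempty relatively open set has positive measure.\<close>

lemma null_superlevel_imp_bound:
  assumes u: "smooth_function A u" and null: "manifold_null A {p \<in> topspace X. M < \<bar>u p\<bar>}" and p: "p \<in> topspace X"
  shows "\<bar>u p\<bar> \<le> M"
proof (rule ccontr)
  assume "\<not> \<bar>u p\<bar> \<le> M"
  obtain c where c: "c \<in> A" "p \<in> chart_dom c" using p charts_cover by auto
  define V where "V = {q \<in> chart_dom c. u q \<in> {t. M < \<bar>t\<bar>}}"
  have V: "openin X V"
    unfolding V_def by (intro smooth_function_open_preimage[OF u c(1)] open_Collect_less continuous_intros)
  have "openin (top_of_set (half_space k)) (chart_map c ` V)"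
    by (rule chart_open_image[OF c(1) V]) (auto simp: V_def)
  then obtain T where T: "open T" "chart_map c ` V = half_space k \<inter> T" by (metis openin_open)
  have "chart_map c p \<in> half_space k \<inter> T"
    using T(2) \<open>\<not> \<bar>u p\<bar> \<le> M\<close> c(2) by (auto simp: V_def)
  then obtain e where e: "e > 0" "ball (chart_map c p) e \<subseteq> T" "0 \<le> chart_map c p $ k"
    using T(1) by (auto simp: half_space_def open_contains_ball)
  \<comment> \<open>Moving inwards from \<open>p\<close> gives a point of \<open>T\<close> off the boundary hyperplane.\<close>
  have "chart_map c p + (e/2) *\<^sub>R axis k 1 \<in> T \<inter> {x. 0 < x $ k}"
    using e by (auto intro!: subsetD[OF e(2)] simp: dist_norm add_nonneg_pos)
  moreover have op: "open (T \<inter> {x. 0 < x $ k})"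
    by (intro open_Int T open_Collect_less continuous_intros)
  ultimately have "\<not> negligible (T \<inter> {x. 0 < x $ k})" using open_not_negligible by blast
  moreover have "T \<inter> {x. 0 < x $ k} \<subseteq> chart_map c ` ({p \<in> topspace X. M < \<bar>u p\<bar>} \<inter> chart_dom c)"
  proof -
    have "T \<inter> {x. 0 < x $ k} \<subseteq> chart_map c ` V" unfolding T(2) by (auto simp: half_space_def)
    also have "\<dots> \<subseteq> chart_map c ` ({p \<in> topspace X. M < \<bar>u p\<bar>} \<inter> chart_dom c)"
      using chart_dom_topspace[OF c(1)] by (auto simp: V_def)
    finally show ?thesis .
  qed
  ultimately show False using null c(1) negligible_subset unfolding manifold_null_def by blast
qed

end

lemma compact_space_uniform_bound:
  fixes P :: "'a \<Rightarrow> real \<Rightarrow> bool"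
  assumes X: "compact_space X"
    and loc: "\<And>p. p \<in> topspace X \<Longrightarrow> \<exists>U B. openin X U \<and> p \<in> U \<and> (\<forall>q\<in>U. P q B)"
    and mono: "\<And>q B B'. P q B \<Longrightarrow> B \<le> B' \<Longrightarrow> P q B'"
  shows "\<exists>B. \<forall>q\<in>topspace X. P q B"
proof -
  let ?\<U> = "{U. openin X U \<and> (\<exists>B. \<forall>q\<in>U. P q B)}"
  have "topspace X \<subseteq> \<Union>?\<U>" using loc by fast
  then obtain \<F> where \<F>: "finite \<F>" "\<F> \<subseteq> ?\<U>" "topspace X \<subseteq> \<Union>\<F>"
    using X unfolding compact_space_alt by (metis (mono_tags, lifting) mem_Collect_eq)
  then have "\<forall>U\<in>\<F>. \<exists>B. \<forall>q\<in>U. P q B" by auto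
  then obtain B where B: "\<forall>U\<in>\<F>. \<forall>q\<in>U. P q (B U)" by metis
  have "P q (Max (insert 0 (B ` \<F>)))" if q: "q \<in> topspace X" for q
  proof -
    obtain U where U: "U \<in> \<F>" "q \<in> U" using q \<F> by blast
    have "P q (B U)" using B U by simp
    then show ?thesis by (rule mono) (use U \<F>(1) in \<open>auto intro: Max_ge\<close>)
  qed
  then show ?thesis by blast
qed

section \<open>The metric in charts\<close>

text \<open>The squared length of a covector does not depend on the coordinates: \<open>G\<close> and \<open>H\<close> are the metrics and \<open>D\<close>
  and \<open>E\<close> the covectors in two charts with Jacobian \<open>J\<close>.\<close>

lemma inverse_metric_transform:
  fixes G H J :: "real^'n^'n::finite"
  assumes G: "pos_def G" and H: "pos_def H" and GH: "G = transpose J ** H ** J" and D: "D = transpose J *v E"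
  shows "D \<bullet> (matrix_inv G *v D) = E \<bullet> (matrix_inv H *v E)"
proof -
  have dG: "det G \<noteq> 0" and dH: "det H \<noteq> 0" using pos_def_det_pos G H by force+
  then have dJ: "det J \<noteq> 0" using GH by (auto simp: det_mul)
  define w where "w = matrix_inv G *v D"
  have "transpose J *v (H *v (J *v w)) = G *v w" by (simp add: GH matrix_vector_mul_assoc matrix_mul_assoc)
  also have "\<dots> = transpose J *v E"
    by (simp add: w_def matrix_vector_mul_assoc matrix_inv_right[OF dG] D)
  finally have eq: "transpose J *v (H *v (J *v w)) = transpose J *v E" .
  have "inj ((*v) (transpose J))"
    using dJ by (simp add: inj_matrix_vector_mult invertible_det_nz)
  then have "H *v (J *v w) = E" using eq by (rule injD)
  then have "matrix_inv H *v E = (matrix_inv H ** H) *v (J *v w)" by (metis matrix_vector_mul_assoc)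
  also have "\<dots> = J *v w"
    using matrix_inv_right[OF dH] matrix_left_right_inverse by force
  finally have "E \<bullet> (matrix_inv H *v E) = E \<bullet> (J *v w)" by simp
  also have "\<dots> = D \<bullet> w" by (simp add: D dot_lmul_matrix flip: vector_transpose_matrix)
  finally show ?thesis by (simp add: w_def)
qed

context compact_riemannian_manifold_with_boundary
begin

lemma metric_pos_def: "c \<in> A \<Longrightarrow> p \<in> chart_dom c \<Longrightarrow> pos_def (g c p)"
  unfolding pos_def_def using metric_symmetric metric_positive by blast

text \<open>Near every point of the image of a chart, boundary points included, the functions \<open>g\<^sup>i\<^sup>j\<close> and \<open>sqrt (det g)\<close>
  extend to smooth functions \<open>h\<close> and \<open>r\<close> on a full neighbourhood, on which \<open>h\<close> is still symmetric and positive
  definite.\<close>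

lemma metric_extension:
  assumes c: "c \<in> A" and x0: "x0 \<in> chart_image c"
  obtains W h r where "open W" "x0 \<in> W" "W \<inter> half_space k \<subseteq> chart_image c"
    "\<And>i j m. Ck_on_open m W (h i j)" "\<And>m. Ck_on_open m W r"
    "\<And>x i j. x \<in> W \<Longrightarrow> h i j x = h j i x" "\<And>x. x \<in> W \<Longrightarrow> 0 < r x"
    "\<And>x \<xi>. x \<in> W \<Longrightarrow> \<xi> \<noteq> 0 \<Longrightarrow> 0 < (\<Sum>i\<in>UNIV. \<Sum>j\<in>UNIV. h i j x * \<xi> $ i * \<xi> $ j)"
    "\<And>x i j. x \<in> W \<inter> half_space k \<Longrightarrow> matrix_inv (g c (chart_inv c x)) $ i $ j = h i j x"
    "\<And>x. x \<in> W \<inter> half_space k \<Longrightarrow> sqrt (det (g c (chart_inv c x))) = r x"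
proof -
  have "\<exists>W F. open W \<and> x0 \<in> W \<and> (\<forall>m. Ck_on_open m W F) \<and> (\<forall>y\<in>chart_image c \<inter> W. F y = g c (chart_inv c y) $ i $ j)" for i j
    using bspec[OF metric_smooth[OF c, of i j, unfolded smooth_on_def] x0] .
  then obtain WW FF where WF: "\<And>i j. open (WW i j) \<and> x0 \<in> WW i j \<and> (\<forall>m. Ck_on_open m (WW i j) (FF i j))
      \<and> (\<forall>y\<in>chart_image c \<inter> WW i j. FF i j y = g c (chart_inv c y) $ i $ j)"
    by metis
  obtain T where T: "open T" "chart_image c = half_space k \<inter> T" using chart_image_open[OF c] openin_open by metis
  define W1 where "W1 = T \<inter> (\<Inter>i\<in>UNIV. \<Inter>j\<in>UNIV. WW i j)"
  have W1: "open W1" unfolding W1_def using T WF by (intro open_Int open_INT finite_UNIV ballI) auto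
  have x0W: "x0 \<in> W1" using x0 T WF by (auto simp: W1_def)
  have W1h: "W1 \<inter> half_space k \<subseteq> chart_image c" using T by (auto simp: W1_def)
  \<comment> \<open>Averaging keeps the extended matrix symmetric on the other side of the hyperplane.\<close>
  define G where "G x = (\<chi> i j. (1/2) * (FF i j x + FF j i x))" for x
  have CkF: "Ck_on_open m W1 (FF i j)" for i j m
    by (rule Ck_subset[of m "WW i j"]) (use WF W1 in \<open>auto simp: W1_def\<close>)
  have CkG: "Ck_on_open m W1 (\<lambda>x. G x $ i $ j)" for i j m
  proof -
    have "(\<lambda>x. G x $ i $ j) = (\<lambda>x. (1/2) * (FF i j x + FF j i x))" by (simp add: G_def fun_eq_iff)
    then show ?thesis by (simp only:) (intro Ck_mult[OF W1] Ck_add[OF W1] Ck_const[OF W1] CkF)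
  qed
  have Gg: "G x = g c (chart_inv c x)" if x: "x \<in> W1 \<inter> half_space k" for x
  proof -
    have xi: "x \<in> chart_image c" using x W1h by blast
    have "FF i j x = g c (chart_inv c x) $ i $ j" for i j
      using WF[of i j] xi x by (auto simp: W1_def)
    moreover have "g c (chart_inv c x) $ j $ i = g c (chart_inv c x) $ i $ j" for i j
      using metric_symmetric[OF c chart_inv_dom[OF xi]] by (simp add: vec_eq_iff transpose_def)
    ultimately show ?thesis by (simp add: G_def vec_eq_iff)
  qed
  define W where "W = {x \<in> W1. pos_def (G x)}"
  have Wopen: "open W"
  proof -
    let ?S = "sphere (0::real^'n) 1"
    let ?q = "\<lambda>z. \<Sum>i\<in>UNIV. \<Sum>j\<in>UNIV. G (snd z) $ i $ j * fst z $ i * fst z $ j"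
    let ?U = "(?S \<times> W1) \<inter> ?q -` {..0}"
    \<comment> \<open>The points at which some unit vector violates positivity form a closed set, as the sphere is compact.\<close>
    have "continuous_on (?S \<times> W1) ?q"
      by (intro continuous_intros continuous_on_compose2[OF Ck_continuous[OF CkG]]) auto
    then have "closedin (top_of_set (?S \<times> W1)) ?U"
      by (rule continuous_closedin_preimage) simp
    then have "closedin (top_of_set W1) {y. \<exists>x. x \<in> ?S \<and> (x, y) \<in> ?U}"
      by (intro closedin_compact_projection) auto
    moreover have "W = W1 - {y. \<exists>x. x \<in> ?S \<and> (x, y) \<in> ?U}"
    proof -
      have "pos_def (G y) \<longleftrightarrow> (\<forall>x\<in>?S. 0 < x \<bullet> (G y *v x))" for y
      proof
        assume r: "\<forall>x\<in>?S. 0 < x \<bullet> (G y *v x)"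
        have "0 < v \<bullet> (G y *v v)" if v: "v \<noteq> 0" for v
        proof -
          have "v /\<^sub>R norm v \<in> ?S" using v by simp
          then have "0 < (v /\<^sub>R norm v) \<bullet> (G y *v (v /\<^sub>R norm v))" by (rule bspec[OF r])
          then have "0 < inverse (norm v) * (inverse (norm v) * (v \<bullet> (G y *v v)))"
            by (simp only: matrix_vector_mult_scaleR inner_scaleR_left inner_scaleR_right)
          then show ?thesis using v by (simp add: zero_less_mult_iff)
        qed
        moreover have "transpose (G y) = G y" by (simp add: G_def transpose_def vec_eq_iff add.commute)
        ultimately show "pos_def (G y)" by (simp add: pos_def_def)
      next
        assume "pos_def (G y)"
        moreover have "x \<noteq> 0" if "x \<in> ?S" for x using that by auto
        ultimately show "\<forall>x\<in>?S. 0 < x \<bullet> (G y *v x)" by (simp add: pos_def_def)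
      qed
      then have "pos_def (G y) \<longleftrightarrow> \<not> (\<exists>x. x \<in> ?S \<and> ?q (x, y) \<le> 0)" for y
        unfolding quadratic_form_sum by (simp add: not_le Ball_def)
      then show ?thesis unfolding W_def by auto
    qed
    ultimately have "openin (top_of_set W1) W"
      using openin_diff[OF openin_subtopology_self] by simp
    then show ?thesis by (rule openin_open_trans[OF _ W1])
  qed
  have WW1: "W \<subseteq> W1" by (auto simp: W_def)
  have GW: "pos_def (G x)" if "x \<in> W" for x using that by (simp add: W_def)
  have dW: "0 < det (G x)" if "x \<in> W" for x using pos_def_det_pos[OF GW[OF that]] .
  have CkGW: "Ck_on_open m W (\<lambda>x. G x $ i $ j)" for i j m by (rule Ck_subset[OF CkG W1 Wopen WW1])
  define h where "h i j x = cramer_det (G x) i j * inverse (det (G x))" for i j x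
  define r where "r x = sqrt (det (G x))" for x
  have hinv: "matrix_inv (G x) $ i $ j = h i j x" if "x \<in> W" for x i j
    using matrix_inv_entry[of "G x" i j] dW[OF that] by (simp add: h_def divide_inverse)
  note PI = pos_def_matrix_inv[OF GW, unfolded pos_def_def]
  show thesis
  proof (rule that[OF Wopen])
    show "x0 \<in> W"
    proof -
      have "x0 \<in> W1 \<inter> half_space k" using x0W x0 T by auto
      then show ?thesis using Gg metric_pos_def[OF c chart_inv_dom[OF x0]] x0W by (simp add: W_def)
    qed
    show "W \<inter> half_space k \<subseteq> chart_image c" using WW1 W1h by blast
    show "Ck_on_open m W (h i j)" for i j m
      unfolding h_def cramer_det_def
    proof (intro Ck_mult[OF Wopen] Ck_inverse[OF Wopen] Ck_det[OF Wopen] CkGW)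
      show "Ck_on_open m W (\<lambda>x. (\<chi> p q. if q = i then axis j 1 $ p else G x $ p $ q) $ p $ q)" for p q
        by (cases "q = i") (simp_all add: Ck_const[OF Wopen] CkGW)
    qed (use dW in force)
    show "Ck_on_open m W r" for m
      unfolding r_def by (intro Ck_sqrt[OF Wopen] Ck_det[OF Wopen] CkGW dW)
    show "h i j x = h j i x" if "x \<in> W" for x i j
    proof -
      have "transpose (matrix_inv (G x)) $ i $ j = matrix_inv (G x) $ i $ j" using PI[OF that] by simp
      then show ?thesis by (simp add: transpose_def hinv[OF that])
    qed
    show "0 < r x" if "x \<in> W" for x using dW[OF that] by (simp add: r_def)
    show "0 < (\<Sum>i\<in>UNIV. \<Sum>j\<in>UNIV. h i j x * \<xi> $ i * \<xi> $ j)" if "x \<in> W" "\<xi> \<noteq> 0" for x \<xi>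
      using PI[OF that(1)] that(2) by (simp add: quadratic_form_sum hinv[OF that(1)])
    show "matrix_inv (g c (chart_inv c x)) $ i $ j = h i j x" if "x \<in> W \<inter> half_space k" for x i j
      using hinv[of x i j] Gg[of x] that WW1 by auto
    show "sqrt (det (g c (chart_inv c x))) = r x" if "x \<in> W \<inter> half_space k" for x
      using Gg[of x] that WW1 by (auto simp: r_def)
  qed
qed

text \<open>Only interior points are considered, where the transition map is differentiable in the usual sense
  and the chain rule applies.\<close>

lemma gradient_length_chart_independent:
  assumes u: "smooth_function A u" and c: "c \<in> A" and d: "d \<in> A" and p: "p \<in> chart_dom c" "p \<in> chart_dom d"
    and int: "p \<notin> manifold_boundary A k"
  shows "(length_in_chart g c p (gradient_in_chart g c u p))\<^sup>2 = (length_in_chart g d p (gradient_in_chart g d u p))\<^sup>2"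
proof -
  define x where "x = chart_map c p"
  define y where "y = chart_map d p"
  define S where "S = chart_map c ` (chart_dom c \<inter> chart_dom d)"
  define P where "P = S \<inter> {x. 0 < x $ k}"
  define \<tau> where "\<tau> = transition c d"
  define vc where "vc = (\<lambda>x. u (chart_inv c x))"
  define vd where "vd = (\<lambda>x. u (chart_inv d x))"
  have xc: "x \<in> chart_interior c" and yd: "y \<in> chart_interior d"
    using not_boundary_iff[OF c p(1)] not_boundary_iff[OF d p(2)] int
      chart_map_image[OF p(1)] chart_map_image[OF p(2)]
    by (auto simp: x_def y_def chart_interior_def)
  have P: "open P" unfolding P_def S_def by (intro open_positive_part overlap_open_image c d)
  have xP: "x \<in> P" using p xc by (auto simp: P_def S_def x_def chart_interior_def)
  have PS: "P \<subseteq> S" by (auto simp: P_def)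
  have atx: "at x within S = at x" by (rule at_within_open_subset[OF xP P PS])
  have \<tau>x: "\<tau> x = y" by (simp add: \<tau>_def transition_def x_def y_def chart_inv_map[OF c p(1)])
  have "\<tau> differentiable (at x)"
  proof -
    have g\<tau>: "has_grad (\<lambda>z. \<tau> z $ i) (\<lambda>j. pd j (\<lambda>z. \<tau> z $ i) x) x" for i
      by (rule Ck_has_grad[OF smooth_on_imp_Ck[OF transition_smooth[OF c d, of i, folded \<tau>_def S_def] P PS] P xP])
    have "(\<tau> has_derivative (\<lambda>h. \<chi> i. \<Sum>j\<in>UNIV. pd j (\<lambda>z. \<tau> z $ i) x * h $ j)) (at x)"
      unfolding has_derivative_componentwise_within[of \<tau>]
      using g\<tau> by (auto simp: Basis_vec_def inner_axis has_grad_def)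
    then show ?thesis by (auto simp: differentiable_def)
  qed
  define J where "J = jacobian \<tau> (at x within S)"
  have J: "(\<tau> has_derivative (\<lambda>h. J *v h)) (at x)"
    using \<open>\<tau> differentiable (at x)\<close> unfolding J_def atx jacobian_works .
  have gJ: "g c p = transpose J ** g d p ** J"
    by (rule metric_compatible[OF c d]) (use p in \<open>auto simp: J_def \<tau>_def x_def S_def\<close>)
  have Dd: "has_grad vd (\<lambda>i. pd i vd y) y"
  proof -
    have "smooth_on (chart_image d) vd" using u d by (simp add: smooth_function_def vd_def)
    then show ?thesis
      by (intro Ck_has_grad[OF smooth_on_imp_Ck open_chart_interior[OF d] yd] open_chart_interior[OF d])
        (auto simp: chart_interior_def)
  qed
  have Dc: "has_grad vc (\<lambda>j. \<Sum>i\<in>UNIV. pd i vd y * J $ i $ j) x"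
  proof (rule has_grad_cong_open[OF _ P xP])
    have "((\<lambda>z. vd (\<tau> z)) has_derivative (\<lambda>h. \<Sum>i\<in>UNIV. pd i vd y * (J *v h) $ i)) (at x)"
      by (rule has_derivative_compose[OF J]) (use Dd in \<open>simp add: has_grad_def \<tau>x\<close>)
    moreover have "(\<Sum>i\<in>UNIV. pd i vd y * (J *v h) $ i) = (\<Sum>j\<in>UNIV. (\<Sum>i\<in>UNIV. pd i vd y * J $ i $ j) * h $ j)" for h
    proof -
      have "(\<Sum>i\<in>UNIV. pd i vd y * (J *v h) $ i) = (\<Sum>i\<in>UNIV. \<Sum>j\<in>UNIV. pd i vd y * J $ i $ j * h $ j)"
        by (simp add: matrix_vector_mult_def sum_distrib_left mult_ac)
      also have "\<dots> = (\<Sum>j\<in>UNIV. \<Sum>i\<in>UNIV. pd i vd y * J $ i $ j * h $ j)" by (rule sum.swap)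
      finally show ?thesis by (simp only: sum_distrib_right)
    qed
    ultimately show "has_grad (\<lambda>z. vd (\<tau> z)) (\<lambda>j. \<Sum>i\<in>UNIV. pd i vd y * J $ i $ j) x"
      by (simp add: has_grad_def)
    fix z assume "z \<in> P"
    then obtain q where q: "q \<in> chart_dom c" "q \<in> chart_dom d" "z = chart_map c q" by (auto simp: P_def S_def)
    then show "vc z = vd (\<tau> z)"
      by (simp add: vc_def vd_def \<tau>_def transition_def chart_inv_map[OF c] chart_inv_map[OF d])
  qed
  let ?Dc = "(\<chi> i. partial_in_chart c i u p) :: real^'n" and ?Dd = "(\<chi> i. partial_in_chart d i u p) :: real^'n"
  have pc: "partial_in_chart c i u p = pd i vc x" for i
    unfolding partial_in_chart_def x_def[symmetric] vc_def[symmetric]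
    by (rule pderiv_within_chart_interior[OF c xc])
  have pdd: "partial_in_chart d i u p = pd i vd y" for i
    unfolding partial_in_chart_def y_def[symmetric] vd_def[symmetric]
    by (rule pderiv_within_chart_interior[OF d yd])
  have "?Dc = transpose J *v ?Dd"
    by (simp add: vec_eq_iff pc pdd has_grad_imp_pd[OF Dc] matrix_vector_mult_def transpose_def mult.commute)
  from inverse_metric_transform[OF metric_pos_def[OF c p(1)] metric_pos_def[OF d p(2)] gJ this]
  show ?thesis
    by (simp add: length_gradient_squared c d p quadratic_form_sum)
qed

text \<open>The eigenvalue equation in a chart, as an equation in divergence form for the coefficients \<open>h\<close> and \<open>r\<close>.\<close>

lemma chart_equation:
  assumes e: "dirichlet_eigenfunction X A k g \<mu> e" and c: "c \<in> A" and V: "open V" "V \<subseteq> chart_interior c" and x: "x \<in> V"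
    and h: "\<And>x i j. x \<in> V \<Longrightarrow> matrix_inv (g c (chart_inv c x)) $ i $ j = h i j x"
    and r: "\<And>x. x \<in> V \<Longrightarrow> sqrt (det (g c (chart_inv c x))) = r x" and rpos: "0 < r x"
  shows "(\<Sum>i\<in>UNIV. \<Sum>j\<in>UNIV. pd i (\<lambda>x. (h i j x * r x) * pd j (\<lambda>x. e (chart_inv c x)) x) x)
     = - \<mu> * (r x * e (chart_inv c x))"
proof -
  define p where "p = chart_inv c x"
  have xi: "x \<in> chart_image c" "x \<in> chart_interior c" using x V by (auto simp: chart_interior_def)
  have p: "p \<in> chart_dom c" "chart_map c p = x" unfolding p_def by (rule chart_inv_dom[OF xi(1)], rule chart_map_inv[OF xi(1)])
  have "p \<notin> manifold_boundary A k"
    using not_boundary_iff[OF c p(1)] p(2) xi by (simp add: chart_interior_def)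
  then have "laplacian_in_chart g c e p = \<mu> * e p"
    using e p(1) c chart_dom_topspace[OF c] unfolding dirichlet_eigenfunction_def by blast
  moreover have "pderiv_within (chart_image c) i
        (\<lambda>x. matrix_inv (g c (chart_inv c x)) $ i $ j * sqrt (det (g c (chart_inv c x))) * partial_in_chart c j e (chart_inv c x)) x
      = pd i (\<lambda>x. (h i j x * r x) * pd j (\<lambda>x. e (chart_inv c x)) x) x" for i j
    unfolding pderiv_within_chart_interior[OF c xi(2)]
  proof (rule pd_cong_open[OF V(1) x])
    fix z assume z: "z \<in> V"
    then have zi: "z \<in> chart_image c" "z \<in> chart_interior c" using V by (auto simp: chart_interior_def)
    have "partial_in_chart c j e (chart_inv c z) = pd j (\<lambda>x. e (chart_inv c x)) z"
      unfolding partial_in_chart_def chart_map_inv[OF zi(1)] by (rule pderiv_within_chart_interior[OF c zi(2)])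
    then show "matrix_inv (g c (chart_inv c z)) $ i $ j * sqrt (det (g c (chart_inv c z))) * partial_in_chart c j e (chart_inv c z)
        = (h i j z * r z) * pd j (\<lambda>x. e (chart_inv c x)) z"
      by (simp add: h[OF z] r[OF z])
  qed
  ultimately have "- (1 / r x) * (\<Sum>i\<in>UNIV. \<Sum>j\<in>UNIV. pd i (\<lambda>x. (h i j x * r x) * pd j (\<lambda>x. e (chart_inv c x)) x) x) = \<mu> * e p"
    using r[OF x] unfolding laplacian_in_chart_def p(2) by (simp add: p_def)
  then show ?thesis using rpos by (simp add: p_def field_simps)
qed

section \<open>The gradient estimate\<close>

text \<open>The constant \<open>B\<close> depends on the neighbourhood \<open>U\<close>, but not on the eigenfunction or the eigenvalue.\<close>

lemma local_interior_gradient_bound: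
  assumes p: "p \<in> topspace X"
  shows "\<exists>U B. openin X U \<and> p \<in> U \<and> (\<forall>q\<in>U. \<forall>lam e M. 1 \<le> lam \<longrightarrow> 0 < M \<longrightarrow>
     dirichlet_eigenfunction X A k g (lam\<^sup>2) e \<longrightarrow> (\<forall>z\<in>topspace X. \<bar>e z\<bar> \<le> M) \<longrightarrow>
     q \<notin> manifold_boundary A k \<longrightarrow> (gradient_length A g e q)\<^sup>2 \<le> B * (lam * M)\<^sup>2)"
proof -
  obtain c where c: "c \<in> A" "p \<in> chart_dom c" using p charts_cover by auto
  define x0 where "x0 = chart_map c p"
  obtain W h r where W: "open W" "x0 \<in> W" "W \<inter> half_space k \<subseteq> chart_image c"
    and h: "\<And>i j m. Ck_on_open m W (h i j)" and r: "\<And>m. Ck_on_open m W r"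
    and hsym: "\<And>x i j. x \<in> W \<Longrightarrow> h i j x = h j i x" and rpos: "\<And>x. x \<in> W \<Longrightarrow> 0 < r x"
    and hpos: "\<And>x \<xi>. x \<in> W \<Longrightarrow> \<xi> \<noteq> 0 \<Longrightarrow> 0 < (\<Sum>i\<in>UNIV. \<Sum>j\<in>UNIV. h i j x * \<xi> $ i * \<xi> $ j)"
    and hg: "\<And>x i j. x \<in> W \<inter> half_space k \<Longrightarrow> matrix_inv (g c (chart_inv c x)) $ i $ j = h i j x"
    and rg: "\<And>x. x \<in> W \<inter> half_space k \<Longrightarrow> sqrt (det (g c (chart_inv c x))) = r x"
    by (fact metric_extension[OF c(1) chart_map_image[OF c(2)], folded x0_def])
  have apos: "\<forall>x\<in>W. \<forall>\<xi>. \<xi> \<noteq> 0 \<longrightarrow> 0 < (\<Sum>i\<in>UNIV. \<Sum>j\<in>UNIV. h i j x * r x * \<xi> $ i * \<xi> $ j)"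
  proof (intro ballI allI impI)
    fix x and \<xi> :: "real^'n" assume x: "x \<in> W" and \<xi>: "\<xi> \<noteq> 0"
    have "(\<Sum>i\<in>UNIV. \<Sum>j\<in>UNIV. h i j x * r x * \<xi> $ i * \<xi> $ j) = r x * (\<Sum>i\<in>UNIV. \<Sum>j\<in>UNIV. h i j x * \<xi> $ i * \<xi> $ j)"
      by (simp add: sum_distrib_left mult_ac)
    then show "0 < (\<Sum>i\<in>UNIV. \<Sum>j\<in>UNIV. h i j x * r x * \<xi> $ i * \<xi> $ j)"
      using hpos[OF x \<xi>] rpos[OF x] by simp
  qed
  have asym: "\<forall>x\<in>W. \<forall>i j. h i j x * r x = h j i x * r x" using hsym by simp
  have aCk: "Ck_on_open (Suc (Suc 0)) W (\<lambda>x. h i j x * r x)" for i j by (rule Ck_mult[OF W(1) h r])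
  obtain R C where R: "0 < R" "0 < C" "ball x0 R \<subseteq> W" and est:
    "\<And>lam v M y. \<lbrakk>1 \<le> lam; 0 < M; Ck_on_open (Suc (Suc (Suc 0))) (ball x0 R \<inter> {x. 0 < x $ k}) v;
       continuous_on (ball x0 R \<inter> half_space k) v;
       \<And>x. x \<in> ball x0 R \<Longrightarrow> x $ k = 0 \<Longrightarrow> v x = 0;
       \<And>x. x \<in> ball x0 R \<inter> half_space k \<Longrightarrow> \<bar>v x\<bar> \<le> M;
       \<And>x. x \<in> ball x0 R \<inter> {x. 0 < x $ k} \<Longrightarrow>
          (\<Sum>i\<in>UNIV. \<Sum>j\<in>UNIV. pd i (\<lambda>x. (h i j x * r x) * pd j v x) x) = - (lam\<^sup>2) * (r x * v x);
       y \<in> ball x0 (R / 4) \<inter> {x. 0 < x $ k}\<rbrakk> \<Longrightarrow> (\<Sum>i\<in>UNIV. (pd i v y)\<^sup>2) \<le> C * (lam * M)\<^sup>2"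
    by (fact local_gradient_estimate[OF W(1,2) aCk r asym apos, where k=k])
  define H where "H x = (\<Sum>i\<in>UNIV. \<Sum>j\<in>UNIV. \<bar>h i j x\<bar>)" for x
  have cb: "cball x0 (R / 4) \<subseteq> ball x0 R" using R by auto
  have "continuous_on W H"
    unfolding H_def by (intro continuous_intros Ck_continuous[OF h])
  then have "continuous_on (cball x0 (R / 4)) H" using cb R(3) by (elim continuous_on_subset) blast
  then have "bounded (H ` cball x0 (R / 4))"
    by (intro compact_imp_bounded compact_continuous_image) auto
  then obtain K where "\<forall>y\<in>H ` cball x0 (R / 4). norm y \<le> K" unfolding bounded_iff by blast
  then have K: "\<bar>H x\<bar> \<le> K" if "x \<in> cball x0 (R / 4)" for x using that by auto
  have K0: "0 \<le> K" using K[of x0] R by auto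
  define U where "U = {q \<in> chart_dom c. chart_map c q \<in> ball x0 (R / 4)}"
  have "openin X U"
  proof -
    have "continuous_map (subtopology X (chart_dom c)) euclidean (chart_map c)"
      using chart_continuous[OF c(1)] by (simp add: continuous_map_in_subtopology)
    from openin_continuous_map_preimage[OF this, of "ball x0 (R / 4)"]
    have "openin (subtopology X (chart_dom c)) U"
      unfolding U_def topspace_subtopology_chart[OF c(1)] by simp
    then show ?thesis using chart_dom_open[OF c(1)] openin_trans_full by blast
  qed
  moreover have "p \<in> U" using c R by (simp add: U_def x0_def)
  moreover have "(gradient_length A g e q)\<^sup>2 \<le> (K * C) * (lam * M)\<^sup>2"
    if q: "q \<in> U" and lam: "1 \<le> lam" and M: "0 < M" and e: "dirichlet_eigenfunction X A k g (lam\<^sup>2) e"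
      and bound: "\<forall>z\<in>topspace X. \<bar>e z\<bar> \<le> M" and qi: "q \<notin> manifold_boundary A k" for q lam e M
  proof -
    define v where "v = (\<lambda>x. e (chart_inv c x))"
    define V where "V = ball x0 R \<inter> {x. 0 < x $ k}"
    have sm: "smooth_function A e" using e by (simp add: dirichlet_eigenfunction_def)
    have sv: "smooth_on (chart_image c) v" using sm c by (simp add: smooth_function_def v_def)
    have V: "open V" unfolding V_def by (intro open_Int open_ball open_Collect_less continuous_intros)
    have bi: "ball x0 R \<inter> half_space k \<subseteq> chart_image c" using R(3) W(3) by blast
    have Vh: "V \<subseteq> ball x0 R \<inter> half_space k" by (auto simp: V_def half_space_def)
    have Vc: "V \<subseteq> chart_interior c" using Vh bi by (auto simp: V_def chart_interior_def)
    have VW: "V \<subseteq> W \<inter> half_space k" using Vh R(3) by blast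
    have qc: "q \<in> chart_dom c" and qb: "chart_map c q \<in> ball x0 (R / 4)" using q by (auto simp: U_def)
    have q0: "0 < chart_map c q $ k" using not_boundary_iff[OF c(1) qc] qi by blast
    have "chart_map c q \<in> ball x0 R" using subsetD[OF cb] qb by simp
    then have qV: "chart_map c q \<in> V" using q0 by (simp add: V_def)
    have S: "(\<Sum>i\<in>UNIV. (pd i v (chart_map c q))\<^sup>2) \<le> C * (lam * M)\<^sup>2"
    proof (rule est[OF lam M, folded V_def])
      show "Ck_on_open (Suc (Suc (Suc 0))) V v"
        by (rule smooth_on_imp_Ck[OF sv V]) (use Vh bi in blast)
      show "continuous_on (ball x0 R \<inter> half_space k) v"
        by (rule continuous_on_subset[OF smooth_on_continuous[OF sv] bi])
      show "v x = 0" if x: "x \<in> ball x0 R" "x $ k = 0" for x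
      proof -
        have xi: "x \<in> chart_image c" using x bi by (auto simp: half_space_def)
        have "chart_inv c x \<in> manifold_boundary A k"
          unfolding manifold_boundary_def using c(1) chart_inv_dom[OF xi] chart_map_inv[OF xi] x(2) by auto
        then show "v x = 0" using e by (simp add: dirichlet_eigenfunction_def v_def)
      qed
      show "\<bar>v x\<bar> \<le> M" if "x \<in> ball x0 R \<inter> half_space k" for x
        using bound chart_inv_dom[OF subsetD[OF bi that]] chart_dom_topspace[OF c(1)] unfolding v_def by blast
      show "(\<Sum>i\<in>UNIV. \<Sum>j\<in>UNIV. pd i (\<lambda>x. (h i j x * r x) * pd j v x) x) = - (lam\<^sup>2) * (r x * v x)"
        if x: "x \<in> V" for x
        unfolding v_def
        by (rule chart_equation[OF e c(1) V Vc x hg[OF subsetD[OF VW]] rg[OF subsetD[OF VW]]])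
          (use VW rpos x in auto)
      show "chart_map c q \<in> ball x0 (R / 4) \<inter> {x. 0 < x $ k}" using qb q0 by simp
    qed
    define D where "D i = pd i v (chart_map c q)" for i
    have pD: "partial_in_chart c i e q = D i" for i
      unfolding partial_in_chart_def D_def v_def
      by (rule pderiv_within_chart_interior[OF c(1)]) (use qV Vc in blast)
    define y where "y = chart_map c q"
    have hq: "matrix_inv (g c q) $ i $ j = h i j y" for i j
      using hg[of y i j] qV VW chart_inv_map[OF c(1) qc] by (auto simp: y_def)
    have DD: "\<bar>D i * D j\<bar> \<le> (\<Sum>i\<in>UNIV. (D i)\<^sup>2)" for i j
    proof -
      have one: "(D i)\<^sup>2 \<le> (\<Sum>i\<in>UNIV. (D i)\<^sup>2)" for i by (intro member_le_sum) auto
      have "2 * \<bar>D i * D j\<bar> \<le> (D i)\<^sup>2 + (D j)\<^sup>2" using abs_mult_le_weighted[of 1 "D i" "D j"] by simp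
      then show ?thesis using one[of i] one[of j] by linarith
    qed
    \<comment> \<open>the chart in which \<open>gradient_length\<close> is computed\<close>
    define c0 where "c0 = (SOME c. c \<in> A \<and> q \<in> chart_dom c)"
    have c0: "c0 \<in> A \<and> q \<in> chart_dom c0" unfolding c0_def by (rule someI[of _ c]) (use c qc in simp)
    have "(gradient_length A g e q)\<^sup>2 = (length_in_chart g c0 q (gradient_in_chart g c0 e q))\<^sup>2"
      by (simp add: gradient_length_def c0_def Let_def)
    also have "\<dots> = (length_in_chart g c q (gradient_in_chart g c e q))\<^sup>2"
      by (rule gradient_length_chart_independent[OF sm]) (use c0 c qc qi in auto)
    also have "\<dots> = (\<Sum>i\<in>UNIV. \<Sum>j\<in>UNIV. h i j y * D i * D j)"
      by (simp add: length_gradient_squared[OF c(1) qc] pD hq)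
    also have "\<dots> \<le> (\<Sum>i\<in>UNIV. \<Sum>j\<in>UNIV. \<bar>h i j y\<bar> * (\<Sum>i\<in>UNIV. (D i)\<^sup>2))"
    proof (intro sum_mono)
      fix i j
      have "h i j y * D i * D j \<le> \<bar>h i j y\<bar> * \<bar>D i * D j\<bar>"
        by (metis abs_ge_self abs_mult mult.assoc)
      also have "\<dots> \<le> \<bar>h i j y\<bar> * (\<Sum>i\<in>UNIV. (D i)\<^sup>2)" by (intro mult_left_mono DD) simp
      finally show "h i j y * D i * D j \<le> \<bar>h i j y\<bar> * (\<Sum>i\<in>UNIV. (D i)\<^sup>2)" .
    qed
    also have "\<dots> = H y * (\<Sum>i\<in>UNIV. (D i)\<^sup>2)" by (simp add: H_def sum_distrib_right)
    also have "\<dots> \<le> K * (C * (lam * M)\<^sup>2)"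
      using K[of y] S qb K0 by (intro mult_mono) (auto simp: y_def D_def sum_nonneg)
    finally show ?thesis by (simp add: mult.assoc)
  qed
  ultimately show ?thesis by (intro exI[of _ U] exI[of _ "K * C"]) simp
qed

lemma smooth_function_bounded:
  assumes "smooth_function A u"
  shows "\<exists>B. \<forall>p\<in>topspace X. \<bar>u p\<bar> \<le> B"
proof (rule compact_space_uniform_bound[OF compact])
  fix p assume "p \<in> topspace X"
  then obtain c where c: "c \<in> A" "p \<in> chart_dom c" using charts_cover by auto
  have "openin X {q \<in> chart_dom c. u q \<in> {t. \<bar>t\<bar> < \<bar>u p\<bar> + 1}}"
    by (intro smooth_function_open_preimage[OF assms c(1)] open_Collect_less continuous_intros)
  then show "\<exists>U B. openin X U \<and> p \<in> U \<and> (\<forall>q\<in>U. \<bar>u q\<bar> \<le> B)"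
    using c by (intro exI[of _ "{q \<in> chart_dom c. u q \<in> {t. \<bar>t\<bar> < \<bar>u p\<bar> + 1}}"] exI[of _ "\<bar>u p\<bar> + 1"]) auto
qed auto

text \<open>For continuous functions the essential supremum is a pointwise bound. Boundedness is needed for the
  infimum in \<open>Linf_norm\<close> to range over a nonempty set.\<close>

lemma abs_le_Linf_norm:
  assumes u: "smooth_function A u" and p: "p \<in> topspace X"
  shows "\<bar>u p\<bar> \<le> Linf_norm X A u"
  unfolding Linf_norm_def
proof (rule cInf_greatest)
  obtain B where B: "\<And>q. q \<in> topspace X \<Longrightarrow> \<bar>u q\<bar> \<le> B" using smooth_function_bounded[OF u] by blast
  then have "{q \<in> topspace X. B < \<bar>u q\<bar>} = {}" by force
  then have "B \<in> {M. 0 \<le> M \<and> manifold_null A {p \<in> topspace X. M < \<bar>u p\<bar>}}"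
    using B[OF p] by (auto simp: manifold_null_def simp del: Collect_empty_eq)
  then show "{M. 0 \<le> M \<and> manifold_null A {p \<in> topspace X. M < \<bar>u p\<bar>}} \<noteq> {}" by blast
qed (use null_superlevel_imp_bound[OF u _ p] in auto)

text \<open>The boundary is a null set, so a bound at the interior points is enough.\<close>

lemma Linf_norm_le:
  assumes "0 \<le> B" "\<And>p. p \<in> topspace X \<Longrightarrow> p \<notin> manifold_boundary A k \<Longrightarrow> \<bar>f p\<bar> \<le> B"
  shows "Linf_norm X A f \<le> B"
  unfolding Linf_norm_def
proof (rule cInf_lower)
  have sub: "{p \<in> topspace X. B < \<bar>f p\<bar>} \<subseteq> manifold_boundary A k" using assms(2) by force
  have "manifold_null A {p \<in> topspace X. B < \<bar>f p\<bar>}"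
    unfolding manifold_null_def
  proof
    fix c assume c: "c \<in> A"
    have "negligible (chart_map c ` (manifold_boundary A k \<inter> chart_dom c))"
      using manifold_boundary_null c by (simp add: manifold_null_def)
    then show "negligible (chart_map c ` ({p \<in> topspace X. B < \<bar>f p\<bar>} \<inter> chart_dom c))"
      by (rule negligible_subset) (use sub in blast)
  qed
  then show "B \<in> {M. 0 \<le> M \<and> manifold_null A {p \<in> topspace X. M < \<bar>f p\<bar>}}" using assms(1) by simp
  show "bdd_below {M. 0 \<le> M \<and> manifold_null A {p \<in> topspace X. M < \<bar>f p\<bar>}}"
    by (rule bdd_belowI[of _ 0]) simp
qed

end

theorem corollary1p1:
  fixes X :: "'a topology"
    and A :: "('a, 'n::finite) chart set"
    and k :: 'n
    and g :: "('a, 'n) metric"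
  assumes "compact_riemannian_manifold_with_boundary X A k g"
  shows "\<exists>C>0. \<forall>lam\<ge>1. \<forall>e. dirichlet_eigenfunction X A k g (lam\<^sup>2) e \<longrightarrow>
           Linf_norm X A (gradient_length A g e) \<le> C * lam * Linf_norm X A e"
proof -
  interpret compact_riemannian_manifold_with_boundary X A k g by fact
  have "\<exists>B. \<forall>q\<in>topspace X. \<forall>lam e M. 1 \<le> lam \<longrightarrow> 0 < M \<longrightarrow>
     dirichlet_eigenfunction X A k g (lam\<^sup>2) e \<longrightarrow> (\<forall>z\<in>topspace X. \<bar>e z\<bar> \<le> M) \<longrightarrow>
     q \<notin> manifold_boundary A k \<longrightarrow> (gradient_length A g e q)\<^sup>2 \<le> B * (lam * M)\<^sup>2"
  proof (rule compact_space_uniform_bound[OF compact local_interior_gradient_bound])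
    fix q and B B' :: real
    assume B: "B \<le> B'" and q: "\<forall>lam e M. 1 \<le> lam \<longrightarrow> 0 < M \<longrightarrow>
     dirichlet_eigenfunction X A k g (lam\<^sup>2) e \<longrightarrow> (\<forall>z\<in>topspace X. \<bar>e z\<bar> \<le> M) \<longrightarrow>
     q \<notin> manifold_boundary A k \<longrightarrow> (gradient_length A g e q)\<^sup>2 \<le> B * (lam * M)\<^sup>2"
    have "B * (lam * M)\<^sup>2 \<le> B' * (lam * M)\<^sup>2" for lam M :: real
      by (rule mult_right_mono[OF B]) simp
    then show "\<forall>lam e M. 1 \<le> lam \<longrightarrow> 0 < M \<longrightarrow>
     dirichlet_eigenfunction X A k g (lam\<^sup>2) e \<longrightarrow> (\<forall>z\<in>topspace X. \<bar>e z\<bar> \<le> M) \<longrightarrow>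
     q \<notin> manifold_boundary A k \<longrightarrow> (gradient_length A g e q)\<^sup>2 \<le> B' * (lam * M)\<^sup>2"
      using q order_trans by blast
  qed
  then obtain B where B: "\<And>q lam e M. q \<in> topspace X \<Longrightarrow> 1 \<le> lam \<Longrightarrow> 0 < M \<Longrightarrow>
     dirichlet_eigenfunction X A k g (lam\<^sup>2) e \<Longrightarrow> (\<forall>z\<in>topspace X. \<bar>e z\<bar> \<le> M) \<Longrightarrow>
     q \<notin> manifold_boundary A k \<Longrightarrow> (gradient_length A g e q)\<^sup>2 \<le> B * (lam * M)\<^sup>2"
    by blast
  define C where "C = sqrt (\<bar>B\<bar> + 1)"
  have C: "0 < C" "B \<le> C\<^sup>2" by (auto simp: C_def)
  have "Linf_norm X A (gradient_length A g e) \<le> C * lam * Linf_norm X A e"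
    if lam: "1 \<le> lam" and e: "dirichlet_eigenfunction X A k g (lam\<^sup>2) e" for lam e
  proof -
    define M where "M = Linf_norm X A e"
    have sm: "smooth_function A e" using e by (simp add: dirichlet_eigenfunction_def)
    have bound: "\<forall>z\<in>topspace X. \<bar>e z\<bar> \<le> M" unfolding M_def using abs_le_Linf_norm[OF sm] by blast
    obtain z where "z \<in> topspace X" "e z \<noteq> 0" using e by (auto simp: dirichlet_eigenfunction_def)
    then have M: "0 < M" using bound by force
    show ?thesis
      unfolding M_def[symmetric]
    proof (rule Linf_norm_le)
      show 0: "0 \<le> C * lam * M" using C lam M by simp
      fix q assume q: "q \<in> topspace X" "q \<notin> manifold_boundary A k"
      have "(gradient_length A g e q)\<^sup>2 \<le> B * (lam * M)\<^sup>2" by (rule B[OF q(1) lam M e bound q(2)])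
      also have "\<dots> \<le> C\<^sup>2 * (lam * M)\<^sup>2" by (rule mult_right_mono[OF C(2)]) simp
      finally have "(gradient_length A g e q)\<^sup>2 \<le> (C * lam * M)\<^sup>2" by (simp add: power_mult_distrib)
      then have "\<bar>gradient_length A g e q\<bar> \<le> \<bar>C * lam * M\<bar>" by (simp only: abs_le_square_iff)
      then show "\<bar>gradient_length A g e q\<bar> \<le> C * lam * M" using 0 by linarith
    qed
  qed
  then show ?thesis using C(1) by blast
qed

end
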